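(* Let $d\in\mathbb N$, $T>0$, and let $G:\mathcal P_2(\mathbb R^d)\to\mathbb R$ be bounded from below, continuous, and such that for any probability space $(\Omega,\mathcal F,\mathbb P)$, $$G\big(\mathcal L(\mathbb E[X\,|\,Y])\big)\le G\big(\mathcal L(X)\big)\qquad\text{for all }X,Y\in L^2(\Omega;\mathbb R^d).$$ Let $V^N$ and $U$ be the deterministic $N$-particle and mean field value functions on $\mathbb R^d$ with terminal cost $G$ defined in the context. Then for all $N\in\mathbb N$, $t\in[0,T]$ and $\boldsymbol x\in(\mathbb R^d)^N$, $$V^N(t,\boldsymbol x)=U(t,m^N_{\boldsymbol x}).$$
   Context: $\mathcal P_2(\mathbb R^d)$ is the space of Borel probability measures on $\mathbb R^d$ with finite second moment, endowed with the 2-Wasserstein distance; $\mathcal L(X)$ is the law of $X$; $m^N_{\boldsymbol x}=\frac1N\sum_{i=1}^N\delta_{x^i}$. **$N$-particle value function:** for $(t_0,\boldsymbol x_0)\in[0,T]\times(\mathbb R^d)^N$, $$V^N(t_0,\boldsymbol x_0)=\inf_{\alpha^1,\dots,\alpha^N\in L^2([t_0,T];\mathbb R^d)}\ \frac1N\sum_{i=1}^N\int_{t_0}^T\tfrac12|\alpha^i_t|^2dt+G(m^N_{\boldsymbol X_T}),\qquad \dot X^i_t=\alpha^i_t,\ X^i_{t_0}=x^i_0 .$$ **Mean field value function:** for $(t_0,m_0)\in[0,T]\times\mathcal P_2(\mathbb R^d)$, $$U(t_0,m_0)=\inf_{(m,\alpha)}\int_{t_0}^T\int_{\mathbb R^d}\tfrac12|\alpha_t(x)|^2dm_t(x)dt+G(m_T),$$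 the infimum being over pairs with $m\in AC([t_0,T];\mathcal P_2(\mathbb R^d))$ (absolutely continuous curves), $\alpha\in L^2(dt\otimes m_t;\mathbb R^d)$, and $\partial_tm_t+\mathrm{div}(\alpha_tm_t)=0$ in $(t_0,T)\times\mathbb R^d$ (in the sense of distributions), $m_{t_0}=m_0$. *)

theory Defs
  imports "HOL-Probability.Probability"
begin

section \<open>Square-integrable random vectors, laws and conditional expectations\<close>

definition L2_rv :: "'w measure \<Rightarrow> ('w \<Rightarrow> real ^ 'd) set" where
  "L2_rv M = {X \<in> borel_measurable M. integrable M (\<lambda>\<omega>. (norm (X \<omega>))\<^sup>2)}"

abbreviation law :: "'w measure \<Rightarrow> ('w \<Rightarrow> real ^ 'd) \<Rightarrow> (real ^ 'd) measure" where
  "law M X \<equiv> distr M borel X"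

text \<open>A version of \<open>E[X | Y]\<close>, that is, of the conditional expectation of the vector \<open>X\<close> given
  the \<open>\<sigma>\<close>-algebra generated by \<open>Y\<close>, taken componentwise.\<close>

definition cond_exp_given :: "'w measure \<Rightarrow> ('w \<Rightarrow> real ^ 'd) \<Rightarrow> ('w \<Rightarrow> real ^ 'd) \<Rightarrow> 'w \<Rightarrow> real ^ 'd"
  where
  "cond_exp_given M X Y \<omega> =
     (\<chi> i. real_cond_exp M (vimage_algebra (space M) Y borel) (\<lambda>\<omega>. X \<omega> $ i) \<omega>)"

text \<open>The inequality \<open>G(L(E[X | Y])) \<le> G(L(X))\<close> on every probability space whose underlying set is
  a subset of the type \<open>'w\<close> (with an arbitrary \<open>\<sigma>\<close>-algebra and probability). A hypothesis cannot
  quantify over the type \<open>'w\<close>, so the theorem uses \<open>'w = R^d \<times> R^d\<close>; lemma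
  \<open>cond_exp_decreasing_transfer\<close> below shows that the inequality then holds for every \<open>'w\<close>.\<close>

definition cond_exp_decreasing :: "'w itself \<Rightarrow> ((real ^ 'd) measure \<Rightarrow> real) \<Rightarrow> bool" where
  "cond_exp_decreasing _ G \<longleftrightarrow>
     (\<forall>(M :: 'w measure) X Y. prob_space M \<and> X \<in> L2_rv M \<and> Y \<in> L2_rv M \<longrightarrow>
        G (law M (cond_exp_given M X Y)) \<le> G (law M X))"


section \<open>The 2-Wasserstein space\<close>

definition P2 :: "(real ^ 'd) measure set" where
  "P2 = {\<mu>. prob_space \<mu> \<and> sets \<mu> = sets borel \<and> integrable \<mu> (\<lambda>x. (norm x)\<^sup>2)}"

definition couplings ::
  "(real ^ 'd) measure \<Rightarrow> (real ^ 'd) measure \<Rightarrow> ((real ^ 'd) \<times> (real ^ 'd)) measure set" where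
  "couplings \<mu> \<nu> = {\<gamma>. sets \<gamma> = sets (borel \<Otimes>\<^sub>M borel) \<and>
     distr \<gamma> borel fst = \<mu> \<and> distr \<gamma> borel snd = \<nu>}"

text \<open>For \<open>\<mu>\<close> and \<open>\<nu>\<close> in \<open>P2\<close> the integrals are finite and the set of couplings is nonempty.\<close>

definition W2 :: "(real ^ 'd) measure \<Rightarrow> (real ^ 'd) measure \<Rightarrow> real" where
  "W2 \<mu> \<nu> = sqrt (INF \<gamma>\<in>couplings \<mu> \<nu>. LINT z|\<gamma>. (norm (fst z - snd z))\<^sup>2)"

definition W2_continuous :: "((real ^ 'd) measure \<Rightarrow> real) \<Rightarrow> bool" where
  "W2_continuous G \<longleftrightarrow>
     (\<forall>\<mu>\<in>P2. \<forall>\<epsilon>>0. \<exists>\<delta>>0. \<forall>\<nu>\<in>P2. W2 \<mu> \<nu> < \<delta> \<longrightarrow> \<bar>G \<nu> - G \<mu>\<bar> < \<epsilon>)"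

text \<open>Metric absolute continuity: the increments are dominated by the integrals of an \<open>L^1\<close>
  function.\<close>

definition AC_curve :: "real \<Rightarrow> real \<Rightarrow> (real \<Rightarrow> (real ^ 'd) measure) \<Rightarrow> bool" where
  "AC_curve a b m \<longleftrightarrow>
     (\<forall>t\<in>{a..b}. m t \<in> P2) \<and>
     (\<exists>g. set_integrable lborel {a..b} g \<and>
       (\<forall>s t. a \<le> s \<and> s \<le> t \<and> t \<le> b \<longrightarrow> W2 (m s) (m t) \<le> (LINT r:{s..t}|lborel. g r)))"


section \<open>The \<open>N\<close>-particle problem\<close>

text \<open>Configurations in \<open>(R^d)^N\<close> and \<open>N\<close>-tuples of controls are functions on \<open>nat\<close> of which only
  the values at \<open>i < N\<close> are used.\<close>

definition empirical :: "nat \<Rightarrow> (nat \<Rightarrow> real ^ 'd) \<Rightarrow> (real ^ 'd) measure" where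
  "empirical N x = distr (uniform_count_measure {..<N}) borel x"

lemma integral_empirical:
  fixes f :: "real ^ 'd \<Rightarrow> real"
  assumes "f \<in> borel_measurable borel"
  shows "(LINT y|empirical N x. f y) = (1 / real N) * (\<Sum>i<N. f (x i))"
  unfolding empirical_def using assms
  by (subst integral_distr) (auto simp: integral_uniform_count_measure)

definition L2_controls :: "real \<Rightarrow> real \<Rightarrow> (real \<Rightarrow> real ^ 'd) set" where
  "L2_controls a b = {\<alpha>. set_borel_measurable lborel {a..b} \<alpha> \<and>
     set_integrable lborel {a..b} (\<lambda>t. (norm (\<alpha> t))\<^sup>2)}"

text \<open>The solution of \<open>X' = \<alpha>\<close>, \<open>X t0 = x0\<close>.\<close>

definition trajectory :: "real \<Rightarrow> real ^ 'd \<Rightarrow> (real \<Rightarrow> real ^ 'd) \<Rightarrow> real \<Rightarrow> real ^ 'd" where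
  "trajectory t0 x0 \<alpha> t = x0 + (LINT s:{t0..t}|lborel. \<alpha> s)"

definition particle_cost ::
  "real \<Rightarrow> ((real ^ 'd) measure \<Rightarrow> real) \<Rightarrow> nat \<Rightarrow> real \<Rightarrow> (nat \<Rightarrow> real ^ 'd)
     \<Rightarrow> (nat \<Rightarrow> real \<Rightarrow> real ^ 'd) \<Rightarrow> real" where
  "particle_cost T G N t0 x0 \<alpha> =
     (1 / real N) * (\<Sum>i<N. LINT t:{t0..T}|lborel. (1/2) * (norm (\<alpha> i t))\<^sup>2)
     + G (empirical N (\<lambda>i. trajectory t0 (x0 i) (\<alpha> i) T))"

text \<open>The infimum is taken in the reals: for \<open>N \<ge> 1\<close> and \<open>G\<close> bounded from below on \<open>P2\<close> the set of
  costs is bounded from below, and it is nonempty. The same applies to \<open>mf_value\<close>.\<close>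

definition particle_value ::
  "real \<Rightarrow> ((real ^ 'd) measure \<Rightarrow> real) \<Rightarrow> nat \<Rightarrow> real \<Rightarrow> (nat \<Rightarrow> real ^ 'd) \<Rightarrow> real" where
  "particle_value T G N t0 x0 =
     (INF \<alpha>\<in>{\<alpha>. \<forall>i<N. \<alpha> i \<in> L2_controls t0 T}. particle_cost T G N t0 x0 \<alpha>)"


section \<open>The mean field problem\<close>

text \<open>\<open>C^k\<close> functions; differentiability together with \<open>C^k\<close> regularity of all directional
  derivatives is the usual recursive definition in finite dimension.\<close>

fun Ck :: "nat \<Rightarrow> ('a::euclidean_space \<Rightarrow> real) \<Rightarrow> bool" where
  "Ck 0 f \<longleftrightarrow> continuous_on UNIV f"
| "Ck (Suc k) f \<longleftrightarrow>
     (\<forall>x. f differentiable (at x)) \<and> (\<forall>v. Ck k (\<lambda>x. frechet_derivative f (at x) v))"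

definition test_functions :: "real \<Rightarrow> real \<Rightarrow> (real \<times> (real ^ 'd) \<Rightarrow> real) set" where
  "test_functions a b = {\<phi>. (\<forall>k. Ck k \<phi>) \<and>
     (\<exists>K. compact K \<and> K \<subseteq> {a<..<b} \<times> UNIV \<and> (\<forall>z. z \<notin> K \<longrightarrow> \<phi> z = 0))}"

text \<open>Elements of \<open>L^2(dt \<otimes> m_t; R^d)\<close> on \<open>[a,b] \<times> R^d\<close>, through Borel representatives.\<close>

definition L2_fields ::
  "real \<Rightarrow> real \<Rightarrow> (real \<Rightarrow> (real ^ 'd) measure) \<Rightarrow> (real \<Rightarrow> real ^ 'd \<Rightarrow> real ^ 'd) set" where
  "L2_fields a b m = {\<alpha>. case_prod \<alpha> \<in> borel_measurable (borel \<Otimes>\<^sub>M borel) \<and>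
     (\<integral>\<^sup>+t\<in>{a..b}. (\<integral>\<^sup>+x. ennreal ((norm (\<alpha> t x))\<^sup>2) \<partial>m t) \<partial>lborel) < \<infinity>}"

text \<open>\<open>\<partial>_t m + div (\<alpha> m) = 0\<close> in the sense of distributions on \<open>(a,b) \<times> R^d\<close>. The first derivative
  in the integrand is \<open>\<partial>_t \<phi>(t,x)\<close>, the second one is the inner product of \<open>\<nabla>_x \<phi>(t,x)\<close> with
  \<open>\<alpha>_t(x)\<close>.\<close>

definition continuity_equation ::
  "real \<Rightarrow> real \<Rightarrow> (real \<Rightarrow> (real ^ 'd) measure) \<Rightarrow> (real \<Rightarrow> real ^ 'd \<Rightarrow> real ^ 'd) \<Rightarrow> bool" where
  "continuity_equation a b m \<alpha> \<longleftrightarrow>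
     (\<forall>\<phi>\<in>test_functions a b.
       (LINT t:{a..b}|lborel. LINT x|m t.
          frechet_derivative \<phi> (at (t, x)) (1, 0)
          + frechet_derivative \<phi> (at (t, x)) (0, \<alpha> t x)) = 0)"

definition mf_admissible ::
  "real \<Rightarrow> real \<Rightarrow> (real ^ 'd) measure
     \<Rightarrow> ((real \<Rightarrow> (real ^ 'd) measure) \<times> (real \<Rightarrow> real ^ 'd \<Rightarrow> real ^ 'd)) set" where
  "mf_admissible T t0 m0 = {(m, \<alpha>). AC_curve t0 T m \<and> \<alpha> \<in> L2_fields t0 T m \<and>
     continuity_equation t0 T m \<alpha> \<and> m t0 = m0}"

definition mf_cost ::
  "real \<Rightarrow> ((real ^ 'd) measure \<Rightarrow> real) \<Rightarrow> real \<Rightarrow> (real \<Rightarrow> (real ^ 'd) measure)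
     \<Rightarrow> (real \<Rightarrow> real ^ 'd \<Rightarrow> real ^ 'd) \<Rightarrow> real" where
  "mf_cost T G t0 m \<alpha> =
     (LINT t:{t0..T}|lborel. LINT x|m t. (1/2) * (norm (\<alpha> t x))\<^sup>2) + G (m T)"

definition mf_value ::
  "real \<Rightarrow> ((real ^ 'd) measure \<Rightarrow> real) \<Rightarrow> real \<Rightarrow> (real ^ 'd) measure \<Rightarrow> real" where
  "mf_value T G t0 m0 = (INF (m, \<alpha>)\<in>mf_admissible T t0 m0. mf_cost T G t0 m \<alpha>)"


section \<open>The choice of the underlying set of the probability space is immaterial\<close>

lemma borel_measurable_vec_iff:
  fixes f :: "'w \<Rightarrow> real ^ 'd"
  shows "f \<in> borel_measurable M \<longleftrightarrow> (\<forall>i. (\<lambda>\<omega>. f \<omega> $ i) \<in> borel_measurable M)"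
  by (subst borel_measurable_euclidean_space) (auto simp: Basis_vec_def inner_axis)

lemma L2_rv_component_integrable:
  fixes X :: "'w \<Rightarrow> real ^ 'd"
  assumes "prob_space M" "X \<in> L2_rv M"
  shows "integrable M (\<lambda>\<omega>. X \<omega> $ i)"
proof -
  interpret prob_space M by fact
  have X: "X \<in> borel_measurable M" and X2: "integrable M (\<lambda>\<omega>. (norm (X \<omega>))\<^sup>2)"
    using assms(2) by (auto simp: L2_rv_def)
  have [measurable]: "(\<lambda>\<omega>. X \<omega> $ i) \<in> borel_measurable M"
    using X by (simp add: borel_measurable_vec_iff)
  have "integrable M (\<lambda>\<omega>. (X \<omega> $ i)\<^sup>2)"
  proof (rule Bochner_Integration.integrable_bound[OF X2])
    show "AE \<omega> in M. norm ((X \<omega> $ i)\<^sup>2) \<le> norm ((norm (X \<omega>))\<^sup>2)"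
      using component_le_norm_cart[of "X _" i] by (auto intro!: AE_I2 abs_le_square_iff[THEN iffD1])
  qed measurable
  then show ?thesis
    by (rule square_integrable_imp_integrable[rotated]) measurable
qed

lemma subalgebra_vimage_algebra:
  fixes Y :: "'w \<Rightarrow> real ^ 'd"
  assumes "Y \<in> borel_measurable M"
  shows "subalgebra M (vimage_algebra (space M) Y borel)"
  unfolding subalgebra_def using sets_image_in_sets[OF refl assms] by simp

lemma cond_exp_given_measurable:
  "cond_exp_given M X Y \<in> borel_measurable M"
  by (simp add: borel_measurable_vec_iff cond_exp_given_def)

lemma cond_exp_decreasing_transfer:
  fixes G :: "(real ^ 'd) measure \<Rightarrow> real"
  assumes G: "cond_exp_decreasing TYPE((real ^ 'd) \<times> (real ^ 'd)) G"
  shows "cond_exp_decreasing TYPE('w) G"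
  unfolding cond_exp_decreasing_def
proof (intro allI impI, elim conjE)
  fix M :: "'w measure" and X Y :: "'w \<Rightarrow> real ^ 'd"
  assume M: "prob_space M" and XL: "X \<in> L2_rv M" and YL: "Y \<in> L2_rv M"
  interpret M: prob_space M by fact
  have [measurable]: "X \<in> borel_measurable M" "Y \<in> borel_measurable M"
    using XL YL by (auto simp: L2_rv_def)
  define Z where "Z \<omega> = (X \<omega>, Y \<omega>)" for \<omega>
  have Z[measurable]: "Z \<in> M \<rightarrow>\<^sub>M borel \<Otimes>\<^sub>M borel"
    unfolding Z_def by measurable
  define P where "P = distr M (borel \<Otimes>\<^sub>M borel) Z"
  have P: "prob_space P"
    unfolding P_def by (rule M.prob_space_distr) measurable
  interpret P: prob_space P by fact
  have setsP[measurable_cong]: "sets P = sets (borel \<Otimes>\<^sub>M borel)" and spP[simp]: "space P = UNIV"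
    by (auto simp: P_def space_pair_measure)
  have fstL: "fst \<in> L2_rv P" and sndL: "snd \<in> L2_rv P"
    using XL YL unfolding L2_rv_def P_def by (auto simp: integrable_distr_eq Z_def)
  define FM where "FM = vimage_algebra (space M) Y borel"
  define FP where "FP = vimage_algebra (space P) (snd :: (real ^ 'd) \<times> (real ^ 'd) \<Rightarrow> real ^ 'd) borel"
  have subM: "subalgebra M FM" and subP: "subalgebra P FP"
    unfolding FM_def FP_def by (rule subalgebra_vimage_algebra; measurable)+
  interpret SM: finite_measure_subalgebra M FM by unfold_locales (rule subM)
  interpret SP: finite_measure_subalgebra P FP by unfold_locales (rule subP)
  have ZF: "Z \<in> FM \<rightarrow>\<^sub>M FP"
    unfolding FP_def
    by (rule measurable_vimage_algebra2) (auto simp: Z_def FM_def intro: measurable_vimage_algebra1)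
  have ae: "AE \<omega> in M. cond_exp_given M X Y \<omega> $ i = cond_exp_given P fst snd (Z \<omega>) $ i" for i
  proof -
    define h where "h = real_cond_exp P FP (\<lambda>z. fst z $ i)"
    have intX: "integrable M (\<lambda>\<omega>. X \<omega> $ i)" and intP: "integrable P (\<lambda>z. fst z $ i)"
      using L2_rv_component_integrable[OF M XL] L2_rv_component_integrable[OF P fstL] by auto
    have inth: "integrable P h"
      unfolding h_def by (rule SP.real_cond_exp_int(1)[OF intP])
    have hP: "h \<in> borel_measurable (borel \<Otimes>\<^sub>M borel)"
      using borel_measurable_integrable[OF inth] unfolding measurable_cong_sets[OF setsP refl] .
    have hF: "h \<in> borel_measurable FP"
      unfolding h_def by simp
    have "AE \<omega> in M. real_cond_exp M FM (\<lambda>\<omega>. X \<omega> $ i) \<omega> = h (Z \<omega>)"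
    proof (rule SM.real_cond_exp_charact[OF _ intX])
      show "integrable M (\<lambda>\<omega>. h (Z \<omega>))"
        using inth hP unfolding P_def by (simp add: integrable_distr_eq)
      show "(\<lambda>\<omega>. h (Z \<omega>)) \<in> borel_measurable FM"
        using measurable_compose[OF ZF hF] .
      fix A assume "A \<in> sets FM"
      then obtain B where B[measurable]: "B \<in> sets borel" and A: "A = Y -` B \<inter> space M"
        unfolding FM_def by (subst (asm) sets_vimage_algebra2) auto
      define C where "C = (snd -` B :: ((real ^ 'd) \<times> (real ^ 'd)) set)"
      have C: "C \<in> sets FP"
        unfolding C_def FP_def using in_vimage_algebra[OF B, of snd "space P"] by simp
      then have C'[measurable]: "C \<in> sets (borel \<Otimes>\<^sub>M borel)"
        using subP setsP by (auto simp: subalgebra_def)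
      have ind: "indicator A \<omega> = (indicator C (Z \<omega>) :: real)" if "\<omega> \<in> space M" for \<omega>
        using that by (auto simp: A C_def Z_def indicator_def)
      have tr: "(\<integral>\<omega>\<in>A. f (Z \<omega>) \<partial>M) = (\<integral>z\<in>C. f z \<partial>P)"
        if [measurable]: "f \<in> borel_measurable (borel \<Otimes>\<^sub>M borel)" for f :: "_ \<Rightarrow> real"
        unfolding set_lebesgue_integral_def P_def
        by (subst integral_distr) (auto simp: ind cong: Bochner_Integration.integral_cong)
      have fm: "(\<lambda>z :: (real ^ 'd) \<times> (real ^ 'd). fst z $ i) \<in> borel_measurable (borel \<Otimes>\<^sub>M borel)"
        using borel_measurable_integrable[OF intP] unfolding measurable_cong_sets[OF setsP refl] .
      have "(\<integral>\<omega>\<in>A. X \<omega> $ i \<partial>M) = (\<integral>z\<in>C. fst z $ i \<partial>P)"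
        using tr[OF fm] by (simp add: Z_def)
      also have "\<dots> = (\<integral>z\<in>C. h z \<partial>P)"
        unfolding h_def by (rule SP.real_cond_exp_intA[OF intP C])
      also have "\<dots> = (\<integral>\<omega>\<in>A. h (Z \<omega>) \<partial>M)"
        using tr[OF hP] by simp
      finally show "(\<integral>\<omega>\<in>A. X \<omega> $ i \<partial>M) = (\<integral>\<omega>\<in>A. h (Z \<omega>) \<partial>M)" .
    qed
    then show ?thesis
      by (simp add: cond_exp_given_def h_def FM_def FP_def)
  qed
  have ae': "AE \<omega> in M. cond_exp_given M X Y \<omega> = cond_exp_given P fst snd (Z \<omega>)"
    unfolding vec_eq_iff using ae by (subst AE_all_countable) auto
  have cP: "cond_exp_given P fst snd \<in> borel_measurable (borel \<Otimes>\<^sub>M borel)"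
    using cond_exp_given_measurable[of P] unfolding measurable_cong_sets[OF setsP refl] .
  have "law M (cond_exp_given M X Y) = law M (\<lambda>\<omega>. cond_exp_given P fst snd (Z \<omega>))"
    by (rule distr_cong_AE[OF refl refl ae' cond_exp_given_measurable measurable_compose[OF Z cP]])
  also have "\<dots> = law P (cond_exp_given P fst snd)"
    unfolding P_def by (subst distr_distr) (use cP in \<open>auto simp: comp_def P_def\<close>)
  finally have 1: "law M (cond_exp_given M X Y) = law P (cond_exp_given P fst snd)" .
  have 2: "law M X = law P fst"
    unfolding P_def by (subst distr_distr) (auto simp: comp_def Z_def)
  show "G (law M (cond_exp_given M X Y)) \<le> G (law M X)"
    unfolding 1 2 using G P fstL sndL unfolding cond_exp_decreasing_def by blast
qed

end

theory Submission
  imports Defs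
begin

text \<open>For \<open>U \<le> V\<close>, Jensen replaces the controls by constant ones; the empirical measures of the resulting
  straight lines, driven by the velocities of the lines, solve the continuity equation because two
  distinct lines meet at most once.

  For \<open>V \<le> U\<close>, let \<open>(m, \<alpha>)\<close> be admissible with kinetic cost \<open>C\<close>. For every potential \<open>\<psi>\<close> the soft
  minimum over \<open>i\<close> of the functions \<open>|y - x_i|^2 / (2 (t - t0 + e)) - \<psi>_i\<close> is a smooth subsolution of the
  Hamilton--Jacobi equation, so testing the continuity equation with it bounds the dual value of an
  entropic transport problem between the empirical measure and \<open>m_T\<close> by \<open>C\<close>. For the optimal \<open>\<psi>\<close> the
  softmax weights are a partition of unity that splits \<open>m_T\<close> into \<open>N\<close> pieces of mass \<open>1/N\<close>, at a
  transport cost of at most \<open>C\<close> plus an entropic error. Moving the \<open>i\<close>-th particle to the barycentre of the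
  \<open>i\<close>-th piece does not increase the transport cost, by Jensen, nor \<open>G\<close>, since the empirical measure of the
  barycentres is the law of a conditional expectation.\<close>

section \<open>Smooth functions on open sets\<close>

text \<open>A distributional solution of the continuity equation offers no flow along which the
  particles could be followed up to time \<open>T\<close>, so the lower bound on the kinetic cost
  has to come from test functions alone. Duality does this: each Hamilton--Jacobi subsolution bounds
  the cost from below, and only a functional of \<open>N\<close> real variables has to be maximised,
  never one of transport plans. The price is smoothness and compact support of everything tested.
  The minimum of the kernels has kinks, hence the soft minimum; its entropy costs at most
  \<open>ln N / \<beta>\<close>. The kernel is singular at the initial time, hence the shift
  \<open>e\<close>; it costs the factor \<open>(T - t + e) / (T - t)\<close>. The kernel grows at
  infinity, hence a cut-off in height, which the finite second moment of \<open>m T\<close> allows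
  to remove. With \<open>N\<close> and the pair fixed, all losses vanish in the limit. That the
  weights are soft does no harm: the index of the piece is an extra random variable and need not be
  a function of the point.\<close>

fun Ck_on :: "nat \<Rightarrow> 'a set \<Rightarrow> ('a::euclidean_space \<Rightarrow> real) \<Rightarrow> bool" where
  "Ck_on 0 S f \<longleftrightarrow> continuous_on S f"
| "Ck_on (Suc k) S f \<longleftrightarrow>
     (\<forall>x\<in>S. f differentiable (at x)) \<and> (\<forall>v. Ck_on k S (\<lambda>x. frechet_derivative f (at x) v))"

lemma Ck_on_UNIV: "Ck_on k UNIV f \<longleftrightarrow> Ck k f"
  by (induction k arbitrary: f) auto

text \<open>\<open>frechet_derivative\<close> at a point does not see the set, so only the
  continuity at the bottom of the recursion has to be glued, and there openness makes it work. Test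
  functions will be built this way: a product where the kernel is smooth, zero near the ends of the
  time interval.\<close>

lemma Ck_on_Un:
  assumes "open A" "open B" "Ck_on k A f" "Ck_on k B f"
  shows "Ck_on k (A \<union> B) f"
  using assms(3,4) by (induction k arbitrary: f) (auto intro: continuous_on_open_Un assms(1,2))

lemma frechet_derivative_cong_open:
  assumes "open S" "x \<in> S" "\<And>y. y \<in> S \<Longrightarrow> f y = g y" "f differentiable (at x)"
  shows "g differentiable (at x)" "frechet_derivative g (at x) = frechet_derivative f (at x)"
proof -
  have "(f has_derivative frechet_derivative f (at x)) (at x)"
    using assms(4) frechet_derivative_works by blast
  then have "(g has_derivative frechet_derivative f (at x)) (at x)"
    using has_derivative_transform_within_open assms(1-3) by blast
  then show "g differentiable (at x)" "frechet_derivative g (at x) = frechet_derivative f (at x)"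
    using differentiable_def frechet_derivative_at by metis+
qed

lemma Ck_on_cong:
  assumes "open S" "\<And>x. x \<in> S \<Longrightarrow> f x = g x" "Ck_on k S f"
  shows "Ck_on k S g"
  using assms(2,3)
proof (induction k arbitrary: f g)
  case 0
  then show ?case by (auto cong: continuous_on_cong)
next
  case (Suc k)
  have "g differentiable (at x)" "frechet_derivative g (at x) = frechet_derivative f (at x)"
    if "x \<in> S" for x
    using frechet_derivative_cong_open[OF assms(1) that, of f g] Suc.prems that by auto
  then show ?case
    using Suc by (auto intro!: Suc.IH[of "\<lambda>x. frechet_derivative f (at x) v" for v])
qed

text \<open>\<open>frechet_derivative\<close> is a choice operator; uniqueness of derivatives lets
  an explicit formula \<open>f'\<close> stand in for it, so that the inductions below can work with
  the product and chain rules.\<close>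

lemma Ck_on_SucI:
  assumes "open S" "\<And>x. x \<in> S \<Longrightarrow> (f has_derivative f' x) (at x)" "\<And>v. Ck_on k S (\<lambda>x. f' x v)"
  shows "Ck_on (Suc k) S f"
proof -
  have "frechet_derivative f (at x) = f' x" if "x \<in> S" for x
    using assms(2)[OF that] frechet_derivative_at by metis
  then show ?thesis
    using assms by (auto simp: differentiable_def intro!: Ck_on_cong[OF assms(1) _ assms(3)])
qed

lemma Ck_on_has_derivative:
  "Ck_on (Suc k) S f \<Longrightarrow> x \<in> S \<Longrightarrow> (f has_derivative frechet_derivative f (at x)) (at x)"
  using frechet_derivative_works by auto

lemma Ck_on_Suc: "Ck_on (Suc k) S f \<Longrightarrow> Ck_on k S f"
  by (induction k arbitrary: f)
     (auto intro!: continuous_at_imp_continuous_on differentiable_imp_continuous_within)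

lemma Ck_on_continuous: "Ck_on k S f \<Longrightarrow> continuous_on S f"
proof (induction k)
  case (Suc k)
  then show ?case using Ck_on_Suc by blast
qed simp

lemma Ck_on_const: "open S \<Longrightarrow> Ck_on k S (\<lambda>x. c)"
proof (induction k arbitrary: c)
  case (Suc k)
  then show ?case by (intro Ck_on_SucI[OF _ has_derivative_const]) auto
qed auto

lemma Ck_on_linear:
  assumes "open S" "bounded_linear f"
  shows "Ck_on k S f"
proof (cases k)
  case 0
  then show ?thesis
    using assms(2) by (simp add: linear_continuous_on)
next
  case (Suc n)
  have "(f has_derivative f) (at x)" for x
    using assms(2) by (rule bounded_linear_imp_has_derivative)
  then show ?thesis
    unfolding Suc by (intro Ck_on_SucI[where f' = "\<lambda>_. f"] assms(1) Ck_on_const)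
qed

lemma Ck_on_add:
  assumes "open S" "Ck_on k S f" "Ck_on k S g"
  shows "Ck_on k S (\<lambda>x. f x + g x)"
  using assms(2,3)
proof (induction k arbitrary: f g)
  case 0
  then show ?case by (auto intro: continuous_intros)
next
  case (Suc k)
  show ?case
    by (rule Ck_on_SucI[OF assms(1) has_derivative_add[OF Ck_on_has_derivative[OF Suc.prems(1)]
          Ck_on_has_derivative[OF Suc.prems(2)]]]) (use Suc in auto)
qed

lemma Ck_on_mult:
  assumes "open S" "Ck_on k S f" "Ck_on k S g"
  shows "Ck_on k S (\<lambda>x. f x * g x)"
  using assms(2,3)
proof (induction k arbitrary: f g)
  case 0
  then show ?case by (auto intro: continuous_intros)
next
  case (Suc k)
  have "Ck_on k S f" "Ck_on k S g"
    using Suc.prems Ck_on_Suc by blast+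
  then show ?case
    by (intro Ck_on_SucI[OF assms(1) has_derivative_mult[OF Ck_on_has_derivative[OF Suc.prems(1)]
          Ck_on_has_derivative[OF Suc.prems(2)]]] Ck_on_add[OF assms(1)] Suc.IH)
       (use Suc.prems in auto)
qed

lemma Ck_on_minus: "open S \<Longrightarrow> Ck_on k S f \<Longrightarrow> Ck_on k S (\<lambda>x. - f x)"
  using Ck_on_mult[of S k "\<lambda>_. -1" f] Ck_on_const[of S k "-1"] by simp

lemma Ck_on_diff: "open S \<Longrightarrow> Ck_on k S f \<Longrightarrow> Ck_on k S g \<Longrightarrow> Ck_on k S (\<lambda>x. f x - g x)"
  using Ck_on_add[of S k f "\<lambda>x. - g x"] Ck_on_minus[of S k g] by simp

lemma Ck_on_sum:
  assumes "open S" "\<And>i. i \<in> I \<Longrightarrow> Ck_on k S (f i)"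
  shows "Ck_on k S (\<lambda>x. \<Sum>i\<in>I. f i x)"
  using assms(2) by (induction I rule: infinite_finite_induct)
    (auto intro!: Ck_on_const Ck_on_add assms(1))

text \<open>As \<open>f\<close> is scalar, the chain rule gives a directional derivative of
  \<open>f\<close> times \<open>?g' (f x)\<close>, and the second factor is again a composition of
  this shape, so the induction on \<open>k\<close> closes.\<close>

lemma Ck_on_compose:
  fixes g :: "real \<Rightarrow> real"
  assumes "open S" "open U" "f ` S \<subseteq> U" "Ck_on k U g" "Ck_on k S f"
  shows "Ck_on k S (\<lambda>x. g (f x))"
  using assms(3-)
proof (induction k arbitrary: f g)
  case 0
  then show ?case by (auto intro: continuous_on_compose2)
next
  case (Suc k)
  let ?g' = "\<lambda>y. frechet_derivative g (at y) 1"
  have g': "frechet_derivative g (at y) v = v * ?g' y" if "y \<in> U" for y v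
  proof -
    have "linear (frechet_derivative g (at y))"
      using Ck_on_has_derivative[OF Suc.prems(2) that] has_derivative_linear by blast
    from linear_scale[OF this, of v 1] show ?thesis by simp
  qed
  have A: "((\<lambda>x. g (f x)) has_derivative (\<lambda>v. frechet_derivative f (at x) v * ?g' (f x))) (at x)"
    if "x \<in> S" for x
  proof -
    have fx: "f x \<in> U" using that Suc.prems(1) by auto
    show ?thesis
      using diff_chain_at[OF Ck_on_has_derivative[OF Suc.prems(3) that]
          Ck_on_has_derivative[OF Suc.prems(2) fx]]
      unfolding comp_def by (rule has_derivative_eq_rhs) (rule ext, rule g'[OF fx])
  qed
  have B: "Ck_on k S (\<lambda>x. ?g' (f x))"
    using Suc.IH[OF Suc.prems(1), of ?g'] Suc.prems(2) Ck_on_Suc[OF Suc.prems(3)] by simp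
  show ?case
    by (rule Ck_on_SucI[OF assms(1) A]) (use Suc.prems Ck_on_mult[OF assms(1) _ B] in auto)
qed

lemma Ck_on_SucI_real:
  fixes g :: "real \<Rightarrow> real"
  assumes "open U" "\<And>x. x \<in> U \<Longrightarrow> (g has_real_derivative g' x) (at x)" "Ck_on k U g'"
  shows "Ck_on (Suc k) U g"
  using assms by (intro Ck_on_SucI[where f' = "\<lambda>x v. g' x * v"] Ck_on_mult Ck_on_const)
    (auto simp: has_field_derivative_def)

lemma Ck_on_exp: "open U \<Longrightarrow> Ck_on k U (exp :: real \<Rightarrow> real)"
proof (induction k)
  case (Suc k)
  with DERIV_exp show ?case by (intro Ck_on_SucI_real)
qed (auto intro: continuous_intros)

lemma Ck_on_inverse: "Ck_on k {0<..} (inverse :: real \<Rightarrow> real)"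
proof (induction k)
  case 0
  then show ?case by (auto intro!: continuous_intros)
next
  case (Suc k)
  have "Ck_on k {0<..} (\<lambda>x::real. - (inverse x * inverse x))"
    by (intro Ck_on_minus Ck_on_mult Suc) auto
  then show ?case
    by (rule Ck_on_SucI_real[rotated 2]) (auto intro!: derivative_eq_intros)
qed

lemma Ck_on_ln: "Ck_on k {0<..} (ln :: real \<Rightarrow> real)"
proof (cases k)
  case 0
  then show ?thesis by (auto intro!: continuous_intros)
next
  case (Suc n)
  show ?thesis unfolding Suc
    by (rule Ck_on_SucI_real[OF _ _ Ck_on_inverse])
       (auto intro!: derivative_eq_intros simp: field_simps)
qed

section \<open>Flat exponentials, a smooth step and a plateau in time\<close>

definition expflat :: "nat \<Rightarrow> real \<Rightarrow> real" where
  "expflat n u = (if u > 0 then (1 / u) ^ n * exp (- (1 / u)) else 0)"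

lemma expflat_tendsto_0: "(expflat n \<longlongrightarrow> 0) (at 0)"
proof -
  have "((\<lambda>u. (inverse u) ^ n / exp (inverse u)) \<longlongrightarrow> (0::real)) (at_right 0)"
    by (rule filterlim_compose[OF tendsto_power_div_exp_0 filterlim_inverse_at_top_right])
  then have "(expflat n \<longlongrightarrow> 0) (at_right 0)"
    by (rule Lim_transform_eventually)
       (auto simp: expflat_def eventually_at_filter exp_minus field_simps)
  moreover have "(expflat n \<longlongrightarrow> 0) (at_left 0)"
    by (rule Lim_transform_eventually[OF tendsto_const])
       (auto simp: expflat_def eventually_at_filter)
  ultimately show ?thesis
    by (simp add: filterlim_at_split)
qed

text \<open>The powers of \<open>1 / u\<close> are carried along because
  \<open>exp (- (1 / u))\<close> alone is not closed under differentiation, whereas linear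
  combinations of the family are.\<close>

lemma expflat_has_derivative:
  "(expflat n has_real_derivative (expflat (n + 2) u - real n * expflat (n + 1) u)) (at u)"
proof -
  consider "u > 0" | "u < 0" | "u = 0" by linarith
  then show ?thesis
  proof cases
    case 1
    have w: "((\<lambda>u. 1 / u) has_real_derivative - ((1 / u) * (1 / u))) (at u)"
      using 1 by (auto intro!: derivative_eq_intros)
    have "((\<lambda>u. (1 / u) ^ n * exp (- (1 / u))) has_real_derivative
        real n * (- ((1 / u) * (1 / u)) * (1 / u) ^ (n - Suc 0)) * exp (- (1 / u))
        + exp (- (1 / u)) * - (- ((1 / u) * (1 / u))) * (1 / u) ^ n) (at u)"
      by (intro DERIV_mult DERIV_power DERIV_fun_exp DERIV_minus w)
    also have "real n * (- ((1 / u) * (1 / u)) * (1 / u) ^ (n - Suc 0)) * exp (- (1 / u))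
        + exp (- (1 / u)) * - (- ((1 / u) * (1 / u))) * (1 / u) ^ n
        = expflat (n + 2) u - real n * expflat (n + 1) u"
      using 1 by (cases n) (simp_all add: expflat_def algebra_simps power_one_over)
    finally have "((\<lambda>u. (1 / u) ^ n * exp (- (1 / u))) has_real_derivative
        expflat (n + 2) u - real n * expflat (n + 1) u) (at u)" .
    then show ?thesis
      by (rule has_field_derivative_transform_within_open[where S = "{0<..}"])
         (use 1 in \<open>auto simp: expflat_def\<close>)
  next
    case 2
    have "((\<lambda>u. 0) has_real_derivative expflat (n + 2) u - real n * expflat (n + 1) u) (at u)"
      using 2 by (simp add: expflat_def)
    then show ?thesis
      by (rule has_field_derivative_transform_within_open[where S = "{..<0}"])
         (use 2 in \<open>auto simp: expflat_def\<close>)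
  next
    case 3
    \<comment> \<open>Away from 0 the difference quotient of \<open>expflat n\<close> at 0 is
      \<open>expflat (Suc n)\<close> itself.\<close>
    have "((\<lambda>h. (expflat n (0 + h) - expflat n 0) / h) \<longlongrightarrow> 0) (at 0)"
      by (rule Lim_transform_eventually[OF expflat_tendsto_0[of "Suc n"]])
         (auto simp: expflat_def eventually_at_filter)
    then show ?thesis
      unfolding 3 DERIV_def by (simp add: expflat_def)
  qed
qed

lemma Ck_on_expflat: "Ck_on k UNIV (expflat n)"
proof (induction k arbitrary: n)
  case 0
  have "isCont (expflat n) u" for u
    using expflat_has_derivative DERIV_isCont by blast
  then show ?case by (simp add: continuous_at_imp_continuous_on)
next
  case (Suc k)
  have "Ck_on k UNIV (\<lambda>u. expflat (n + 2) u - real n * expflat (n + 1) u)"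
    by (intro Ck_on_diff Ck_on_mult Ck_on_const Suc) auto
  with expflat_has_derivative show ?case
    by (intro Ck_on_SucI_real) auto
qed

lemma expflat_nonneg: "expflat n u \<ge> 0"
  by (simp add: expflat_def)

lemma expflat0_pos: "u > 0 \<Longrightarrow> expflat 0 u > 0"
  by (simp add: expflat_def)

definition sstep :: "real \<Rightarrow> real" where
  "sstep u = expflat 0 u * inverse (expflat 0 u + expflat 0 (1 - u))"

lemma sstep_denom_pos: "expflat 0 u + expflat 0 (1 - u) > 0"
  using expflat0_pos[of u] expflat0_pos[of "1 - u"] expflat_nonneg[of 0 u] expflat_nonneg[of 0 "1 - u"]
  by (cases "u > 0") linarith+

lemma sstep_nonneg: "sstep u \<ge> 0" and sstep_le_1: "sstep u \<le> 1"
  using sstep_denom_pos[of u] expflat_nonneg[of 0 u] expflat_nonneg[of 0 "1 - u"]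
  by (auto simp: sstep_def field_simps)

lemma sstep_0: "u \<le> 0 \<Longrightarrow> sstep u = 0" and sstep_1: "u \<ge> 1 \<Longrightarrow> sstep u = 1"
  by (auto simp: sstep_def expflat_def)

lemma Ck_on_sstep: "Ck_on k UNIV sstep"
  unfolding sstep_def[abs_def]
proof (intro Ck_on_mult Ck_on_compose[of UNIV "{0<..}" _ _ inverse] Ck_on_add Ck_on_expflat Ck_on_inverse)
  show "Ck_on k UNIV (\<lambda>u. expflat 0 (1 - u))"
    by (rule Ck_on_compose[of UNIV UNIV, OF _ _ _ Ck_on_expflat])
       (intro Ck_on_diff Ck_on_const Ck_on_linear bounded_linear_ident | simp)+
qed (use sstep_denom_pos in auto)

text \<open>In the quotient rule the numerator is a sum of two nonnegative products, and for
  \<open>u \<le> 0\<close> or \<open>u \<ge> 1\<close> each of them has a factor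
  \<open>expflat\<close> at a nonpositive argument. Sign and support of the derivative are all that
  the plateau uses.\<close>

lemma sstep_has_derivative:
  "\<exists>D\<ge>0. (sstep has_real_derivative D) (at u) \<and> (u \<le> 0 \<or> u \<ge> 1 \<longrightarrow> D = 0)"
proof -
  let ?a = "expflat 0 u" and ?b = "expflat 0 (1 - u)" and ?a' = "expflat 2 u" and ?b' = "expflat 2 (1 - u)"
  have a: "(expflat 0 has_real_derivative ?a') (at u)"
    using expflat_has_derivative[of 0 u] by (simp add: numeral_2_eq_2)
  have "(expflat 0 has_real_derivative ?b') (at (1 - u))"
    using expflat_has_derivative[of 0 "1 - u"] by (simp add: numeral_2_eq_2)
  then have "((\<lambda>u. expflat 0 (1 - u)) has_real_derivative ?b' * (- 1)) (at u)"
    by (rule DERIV_chain2) (auto intro!: derivative_eq_intros)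
  then have "(sstep has_real_derivative (?a' * ?b + ?a * ?b') / (?a + ?b)\<^sup>2) (at u)"
    unfolding sstep_def[abs_def] using sstep_denom_pos[of u]
    by (auto intro!: derivative_eq_intros a simp: field_simps power2_eq_square)
  moreover have "(?a' * ?b + ?a * ?b') / (?a + ?b)\<^sup>2 \<ge> 0"
    by (simp add: expflat_nonneg)
  moreover have "u \<le> 0 \<or> u \<ge> 1 \<longrightarrow> ?a' * ?b + ?a * ?b' = 0"
    by (auto simp: expflat_def)
  ultimately show ?thesis by (metis div_0)
qed

lemma Ck_on_real_deriv:
  fixes f :: "real \<Rightarrow> real"
  assumes "Ck_on (Suc k) UNIV f"
  shows "(f has_real_derivative deriv f x) (at x)" "continuous_on S (deriv f)"
proof -
  have "f differentiable (at x)" for x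
    using assms by simp
  then have f': "(f has_real_derivative deriv f x) (at x)" for x
    using real_differentiable_def DERIV_imp_deriv by metis
  then show "(f has_real_derivative deriv f x) (at x)" .
  have "frechet_derivative f (at x) 1 = deriv f x" for x
    using fun_cong[OF frechet_derivative_at[of f "(*) (deriv f x)" x], of 1] f'[of x]
    by (simp add: has_field_derivative_def)
  moreover have "Ck_on k UNIV (\<lambda>x. frechet_derivative f (at x) 1)"
    using assms by simp
  then have "continuous_on UNIV (\<lambda>x. frechet_derivative f (at x) 1)"
    by (rule Ck_on_continuous)
  ultimately show "continuous_on S (deriv f)"
    by (auto intro: continuous_on_subset)
qed

text \<open>The derivative of \<open>\<eta>\<close> plays the role of a unit mass at
  \<open>a\<close> minus a unit mass at \<open>b\<close>: its signs on the two halves allow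
  one-sided estimates of integrals against it, and \<open>\<eta> c = 1\<close> fixes the masses. The
  bound \<open>4 * \<delta> \<le> b - a\<close> keeps each ramp on its own side of the
  midpoint.\<close>

lemma smooth_plateau:
  fixes a b \<delta> :: real
  assumes \<delta>: "\<delta> > 0" "4 * \<delta> \<le> b - a"
  defines "c \<equiv> (a + b) / 2"
  obtains \<eta> :: "real \<Rightarrow> real" where
    "\<And>k. Ck_on k UNIV \<eta>" "\<And>t. 0 \<le> \<eta> t" "\<And>t. \<eta> t \<le> 1"
    "\<And>t. t < a + \<delta> \<Longrightarrow> \<eta> t = 0" "\<And>t. t > b - \<delta> \<Longrightarrow> \<eta> t = 0" "\<eta> c = 1"
    "\<And>t. t \<le> c \<Longrightarrow> deriv \<eta> t \<ge> 0" "\<And>t. t \<ge> c \<Longrightarrow> deriv \<eta> t \<le> 0"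
    "\<And>t. a + 2 * \<delta> \<le> t \<Longrightarrow> t \<le> b - 2 * \<delta> \<Longrightarrow> deriv \<eta> t = 0"
proof -
  \<comment> \<open>\<open>u\<close> increases from 0 to 1 between \<open>a + \<delta>\<close> and
    \<open>a + 2 * \<delta>\<close>, and \<open>v\<close> decreases from 1 to 0 between
    \<open>b - 2 * \<delta>\<close> and \<open>b - \<delta>\<close>.\<close>
  define u v where "u t = (t - a - \<delta>) / \<delta>" and "v t = (b - \<delta> - t) / \<delta>" for t
  define \<eta> where "\<eta> t = sstep (u t) * sstep (v t)" for t
  have lin: "Ck_on k UNIV (\<lambda>t. (s * t + r) / \<delta>)" for k and s r :: real
  proof -
    have "Ck_on k UNIV (\<lambda>t. (s / \<delta>) * t + r / \<delta>)"
      by (intro Ck_on_add Ck_on_linear Ck_on_const bounded_linear_mult_right open_UNIV)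
    then show ?thesis by (simp add: add_divide_distrib)
  qed
  have uv: "Ck_on k UNIV u" "Ck_on k UNIV v" for k
    using lin[of k 1 "- a - \<delta>"] lin[of k "-1" "b - \<delta>"]
    by (simp_all add: u_def[abs_def] v_def[abs_def] algebra_simps)
  have sm: "Ck_on k UNIV \<eta>" for k
    unfolding \<eta>_def[abs_def]
    by (intro Ck_on_mult Ck_on_compose[of UNIV UNIV, OF _ _ _ Ck_on_sstep] uv) auto
  have der: "\<exists>D1\<ge>0. \<exists>D2\<ge>0. deriv \<eta> t = D1 - D2 \<and> (u t \<le> 0 \<or> u t \<ge> 1 \<longrightarrow> D1 = 0) \<and>
      (v t \<le> 0 \<or> v t \<ge> 1 \<longrightarrow> D2 = 0)" for t
  proof -
    obtain D E where D: "D \<ge> 0" "(sstep has_real_derivative D) (at (u t))" "u t \<le> 0 \<or> u t \<ge> 1 \<longrightarrow> D = 0"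
      and E: "E \<ge> 0" "(sstep has_real_derivative E) (at (v t))" "v t \<le> 0 \<or> v t \<ge> 1 \<longrightarrow> E = 0"
      using sstep_has_derivative by metis
    have "((\<lambda>t. sstep (u t)) has_real_derivative D * (1 / \<delta>)) (at t)"
      by (rule DERIV_chain2[where f = sstep and g = u, OF D(2)]) (use \<delta> in \<open>auto intro!: derivative_eq_intros simp: u_def[abs_def]\<close>)
    moreover have "((\<lambda>t. sstep (v t)) has_real_derivative E * (- (1 / \<delta>))) (at t)"
      by (rule DERIV_chain2[where f = sstep and g = v, OF E(2)]) (use \<delta> in \<open>auto intro!: derivative_eq_intros simp: v_def[abs_def]\<close>)
    ultimately have "(\<eta> has_real_derivative
        D * (1 / \<delta>) * sstep (v t) + E * (- (1 / \<delta>)) * sstep (u t)) (at t)"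
      unfolding \<eta>_def[abs_def] by (rule DERIV_mult)
    then have "deriv \<eta> t = D * (1 / \<delta>) * sstep (v t) - E * (1 / \<delta>) * sstep (u t)"
      by (simp add: DERIV_imp_deriv)
    moreover have "D * (1 / \<delta>) * sstep (v t) \<ge> 0" "E * (1 / \<delta>) * sstep (u t) \<ge> 0"
      using D(1) E(1) \<delta> sstep_nonneg by simp_all
    ultimately show ?thesis
      using D(3) E(3) by (intro exI[of _ "D * (1 / \<delta>) * sstep (v t)"] exI[of _ "E * (1 / \<delta>) * sstep (u t)"] conjI) auto
  qed
  show thesis
  proof (rule that[of \<eta>])
    show "Ck_on k UNIV \<eta>" for k by (rule sm)
    show "0 \<le> \<eta> t" "\<eta> t \<le> 1" for t
      using sstep_nonneg sstep_le_1 by (auto simp: \<eta>_def intro!: mult_le_one)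
    show "\<eta> t = 0" if "t < a + \<delta>" for t
    proof -
      have "u t \<le> 0" using that \<delta> by (simp add: u_def field_simps)
      then show ?thesis by (simp add: \<eta>_def sstep_0)
    qed
    show "\<eta> t = 0" if "t > b - \<delta>" for t
    proof -
      have "v t \<le> 0" using that \<delta> by (simp add: v_def field_simps)
      then show ?thesis by (simp add: \<eta>_def sstep_0)
    qed
    have v1: "v t \<ge> 1" if "t \<le> b - 2 * \<delta>" for t
      using that \<delta> by (simp add: v_def field_simps)
    have u1: "u t \<ge> 1" if "t \<ge> a + 2 * \<delta>" for t
      using that \<delta> by (simp add: u_def field_simps)
    have c: "a + 2 * \<delta> \<le> c" "c \<le> b - 2 * \<delta>"
      using \<delta> by (simp_all add: c_def field_simps)
    show "\<eta> c = 1"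
      using u1[OF c(1)] v1[OF c(2)] by (simp add: \<eta>_def sstep_1)
    show "deriv \<eta> t \<ge> 0" if "t \<le> c" for t
      using der[of t] v1[of t] c that by auto
    show "deriv \<eta> t \<le> 0" if "t \<ge> c" for t
      using der[of t] u1[of t] c that by auto
    show "deriv \<eta> t = 0" if "a + 2 * \<delta> \<le> t" "t \<le> b - 2 * \<delta>" for t
      using der[of t] u1[of t] v1[of t] that by auto
  qed
qed

section \<open>Couplings and curves in the Wasserstein space\<close>

lemma norm_diff_square_le:
  fixes x y :: "'a::real_inner"
  shows "(norm (x - y))\<^sup>2 \<le> 2 * (norm x)\<^sup>2 + 2 * (norm y)\<^sup>2"
proof -
  have "0 \<le> (norm (x + y))\<^sup>2" by simp
  then show ?thesis
    by (simp add: power2_norm_eq_inner algebra_simps inner_commute)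
qed

lemma norm_le_1_plus_square: "norm x \<le> 1 + (norm x)\<^sup>2" for x :: "'a::real_normed_vector"
proof -
  have "0 \<le> (norm x - 1)\<^sup>2" by simp
  then have "2 * norm x \<le> 1 + (norm x)\<^sup>2"
    by (simp add: power2_eq_square algebra_simps)
  with norm_ge_zero[of x] show ?thesis by linarith
qed

lemma P2_D:
  assumes "\<mu> \<in> P2"
  shows "prob_space \<mu>" "sets \<mu> = sets borel" "space \<mu> = UNIV" "integrable \<mu> (\<lambda>x. (norm x)\<^sup>2)"
  using assms sets_eq_imp_space_eq[of \<mu> borel] by (auto simp: P2_def)

lemma P2_measurable: "\<mu> \<in> P2 \<Longrightarrow> f \<in> borel_measurable borel \<Longrightarrow> f \<in> borel_measurable \<mu>"
  using measurable_cong_sets[OF P2_D(2) refl] by blast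

lemma P2_integrable_bounded:
  fixes f :: "real ^ 'd \<Rightarrow> real"
  assumes "\<mu> \<in> P2" "f \<in> borel_measurable borel" "\<And>x. \<bar>f x\<bar> \<le> C"
  shows "integrable \<mu> f"
proof -
  interpret prob_space \<mu> using P2_D assms(1) by blast
  show ?thesis
    by (rule integrable_const_bound[of _ C]) (use assms in \<open>auto intro: P2_measurable\<close>)
qed

lemma couplings_D:
  assumes "\<gamma> \<in> couplings \<mu> \<nu>"
  shows "sets \<gamma> = sets (borel \<Otimes>\<^sub>M borel)" "fst \<in> \<gamma> \<rightarrow>\<^sub>M borel" "snd \<in> \<gamma> \<rightarrow>\<^sub>M borel"
    "distr \<gamma> borel fst = \<mu>" "distr \<gamma> borel snd = \<nu>"
proof -
  have s: "sets \<gamma> = sets (borel \<Otimes>\<^sub>M borel)"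
    and d: "distr \<gamma> borel fst = \<mu>" "distr \<gamma> borel snd = \<nu>"
    using assms by (auto simp: couplings_def)
  show "sets \<gamma> = sets (borel \<Otimes>\<^sub>M borel)" "fst \<in> \<gamma> \<rightarrow>\<^sub>M borel" "snd \<in> \<gamma> \<rightarrow>\<^sub>M borel"
    "distr \<gamma> borel fst = \<mu>" "distr \<gamma> borel snd = \<nu>"
    using s d measurable_cong_sets[OF s refl] by (auto)
qed

lemma couplings_prob:
  assumes "\<gamma> \<in> couplings \<mu> \<nu>" "\<mu> \<in> P2"
  shows "prob_space \<gamma>"
  using prob_space_distrD[OF couplings_D(2)[OF assms(1)]] couplings_D(4)[OF assms(1)]
    P2_D(1)[OF assms(2)] by auto

lemma couplings_integral:
  fixes f :: "real ^ 'd \<Rightarrow> real"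
  assumes "\<gamma> \<in> couplings \<mu> \<nu>" and [measurable]: "f \<in> borel_measurable borel"
  shows "integral\<^sup>L \<mu> f = (LINT z|\<gamma>. f (fst z))" "integral\<^sup>L \<nu> f = (LINT z|\<gamma>. f (snd z))"
    "integrable \<mu> f = integrable \<gamma> (\<lambda>z. f (fst z))" "integrable \<nu> f = integrable \<gamma> (\<lambda>z. f (snd z))"
  using integral_distr[OF couplings_D(2)[OF assms(1)] assms(2)]
    integral_distr[OF couplings_D(3)[OF assms(1)] assms(2)]
    integrable_distr_eq[OF couplings_D(2)[OF assms(1)] assms(2)]
    integrable_distr_eq[OF couplings_D(3)[OF assms(1)] assms(2)] couplings_D(4,5)[OF assms(1)]
  by auto

lemma couplings_cost_integrable:
  assumes "\<gamma> \<in> couplings \<mu> \<nu>" "\<mu> \<in> P2" "\<nu> \<in> P2"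
  shows "integrable \<gamma> (\<lambda>z. (norm (fst z - snd z))\<^sup>2)"
proof -
  note [measurable_cong] = couplings_D(1)[OF assms(1)]
  have "integrable \<gamma> (\<lambda>z. (norm (fst z))\<^sup>2)" "integrable \<gamma> (\<lambda>z. (norm (snd z))\<^sup>2)"
    using couplings_integral(3,4)[OF assms(1), of "\<lambda>x. (norm x)\<^sup>2"] P2_D(4) assms by auto
  then have "integrable \<gamma> (\<lambda>z. 2 * (norm (fst z))\<^sup>2 + 2 * (norm (snd z))\<^sup>2)"
    by auto
  then show ?thesis
  proof (rule Bochner_Integration.integrable_bound)
    show "AE z in \<gamma>. norm ((norm (fst z - snd z))\<^sup>2) \<le> norm (2 * (norm (fst z))\<^sup>2 + 2 * (norm (snd z))\<^sup>2)"
      using norm_diff_square_le by auto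
  qed measurable
qed

lemma couplings_nonempty:
  assumes "\<mu> \<in> P2" "\<nu> \<in> P2"
  shows "couplings \<mu> \<nu> \<noteq> {}"
proof -
  interpret M: prob_space \<mu> using P2_D assms(1) by blast
  interpret N: prob_space \<nu> using P2_D assms(2) by blast
  interpret pair_sigma_finite \<mu> \<nu> ..
  have [measurable_cong]: "sets \<mu> = sets borel" "sets \<nu> = sets borel"
    using P2_D assms by auto
  have "distr (\<mu> \<Otimes>\<^sub>M \<nu>) borel fst = distr (\<mu> \<Otimes>\<^sub>M \<nu>) \<mu> fst"
    by (rule distr_cong) (use P2_D(2)[OF assms(1)] in auto)
  also have "\<dots> = \<mu>" by (rule N.distr_pair_fst)
  finally have 1: "distr (\<mu> \<Otimes>\<^sub>M \<nu>) borel fst = \<mu>" .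
  have "distr (\<mu> \<Otimes>\<^sub>M \<nu>) borel snd = distr (distr (\<nu> \<Otimes>\<^sub>M \<mu>) (\<mu> \<Otimes>\<^sub>M \<nu>) (\<lambda>(x, y). (y, x))) borel snd"
    by (rule arg_cong[OF distr_pair_swap])
  also have "\<dots> = distr (\<nu> \<Otimes>\<^sub>M \<mu>) borel fst"
    by (subst distr_distr) (auto simp: comp_def case_prod_beta)
  also have "\<dots> = distr (\<nu> \<Otimes>\<^sub>M \<mu>) \<nu> fst"
    by (rule distr_cong) (use P2_D(2)[OF assms(2)] in auto)
  also have "\<dots> = \<nu>" by (rule M.distr_pair_fst)
  finally have "\<mu> \<Otimes>\<^sub>M \<nu> \<in> couplings \<mu> \<nu>"
    unfolding couplings_def
    using 1 sets_pair_measure_cong[OF P2_D(2)[OF assms(1)] P2_D(2)[OF assms(2)]] by blast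
  then show ?thesis by blast
qed

lemma W2_nonneg: "\<mu> \<in> P2 \<Longrightarrow> \<nu> \<in> P2 \<Longrightarrow> W2 \<mu> \<nu> \<ge> 0"
  unfolding W2_def by (intro real_sqrt_ge_zero cINF_greatest couplings_nonempty) auto

lemma W2_le_coupling:
  assumes "\<gamma> \<in> couplings \<mu> \<nu>"
  shows "W2 \<mu> \<nu> \<le> sqrt (LINT z|\<gamma>. (norm (fst z - snd z))\<^sup>2)"
  unfolding W2_def by (intro real_sqrt_le_mono cINF_lower bdd_belowI[of _ 0] assms) auto

text \<open>Integrate the pointwise bound against an arbitrary coupling and pass to the infimum, so
  that no optimal coupling has to exist. A quadratic modulus with an error \<open>e\<close> fits the
  square of \<open>W2\<close> directly; two functions \<open>f\<close> and \<open>g\<close> are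
  allowed so that the integrand may change with time along with the measure.\<close>

lemma integral_diff_le_W2:
  fixes f g :: "real ^ 'd \<Rightarrow> real"
  assumes P: "\<mu> \<in> P2" "\<nu> \<in> P2" and K: "K \<ge> 0"
    and meas: "f \<in> borel_measurable borel" "g \<in> borel_measurable borel"
    and bnd: "\<And>x. \<bar>f x\<bar> \<le> C" "\<And>x. \<bar>g x\<bar> \<le> C"
    and fg: "\<And>x y. \<bar>f x - g y\<bar> \<le> e + K * (norm (x - y))\<^sup>2"
  shows "\<bar>integral\<^sup>L \<mu> f - integral\<^sup>L \<nu> g\<bar> \<le> e + K * (W2 \<mu> \<nu>)\<^sup>2"
proof -
  let ?c = "\<lambda>\<gamma>. LINT z|\<gamma>. (norm (fst z - snd z :: real ^ 'd))\<^sup>2"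
  have *: "\<bar>integral\<^sup>L \<mu> f - integral\<^sup>L \<nu> g\<bar> \<le> e + K * ?c \<gamma>" if \<gamma>: "\<gamma> \<in> couplings \<mu> \<nu>" for \<gamma>
  proof -
    interpret prob_space \<gamma> using couplings_prob[OF \<gamma> P(1)] .
    have [simp]: "integrable \<gamma> (\<lambda>z. f (fst z))" "integrable \<gamma> (\<lambda>z. g (snd z))"
      by (rule couplings_integral(3)[OF \<gamma> meas(1), THEN iffD1, OF P2_integrable_bounded[OF P(1) meas(1) bnd(1)]],
          rule couplings_integral(4)[OF \<gamma> meas(2), THEN iffD1, OF P2_integrable_bounded[OF P(2) meas(2) bnd(2)]])
    have ci: "integrable \<gamma> (\<lambda>z. (norm (fst z - snd z))\<^sup>2)"
      by (rule couplings_cost_integrable[OF \<gamma> P])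
    have "\<bar>integral\<^sup>L \<mu> f - integral\<^sup>L \<nu> g\<bar> = \<bar>LINT z|\<gamma>. f (fst z) - g (snd z)\<bar>"
      using couplings_integral(1)[OF \<gamma> meas(1)] couplings_integral(2)[OF \<gamma> meas(2)] by simp
    also have "\<dots> \<le> (LINT z|\<gamma>. \<bar>f (fst z) - g (snd z)\<bar>)"
      by (rule integral_abs_bound)
    also have "\<dots> \<le> (LINT z|\<gamma>. e + K * (norm (fst z - snd z))\<^sup>2)"
      using fg ci by (intro integral_mono) auto
    also have "\<dots> = e + K * ?c \<gamma>"
      using ci by (simp add: prob_space)
    finally show ?thesis .
  qed
  show ?thesis
  \<comment> \<open>For \<open>K > 0\<close> the infimum is isolated by dividing by
    \<open>K\<close>; for \<open>K = 0\<close> any one coupling will do.\<close>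
  proof (cases "K = 0")
    case True
    then show ?thesis using * couplings_nonempty[OF P] by auto
  next
    case False
    have "(\<bar>integral\<^sup>L \<mu> f - integral\<^sup>L \<nu> g\<bar> - e) / K \<le> (INF \<gamma>\<in>couplings \<mu> \<nu>. ?c \<gamma>)"
      using * K False couplings_nonempty[OF P]
      by (intro cINF_greatest) (auto simp: field_simps)
    moreover have "(INF \<gamma>\<in>couplings \<mu> \<nu>. ?c \<gamma>) \<ge> 0"
      by (intro cINF_greatest couplings_nonempty P) auto
    ultimately show ?thesis
      using K False by (simp add: W2_def field_simps)
  qed
qed

section \<open>Regularity in time of absolutely continuous curves\<close>

lemma AC_curve_P2: "AC_curve a b m \<Longrightarrow> t \<in> {a..b} \<Longrightarrow> m t \<in> P2"
  by (auto simp: AC_curve_def)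

text \<open>Increments of the indefinite integral of the dominating function control
  \<open>W2\<close>, and that integral is continuous. \<open>min\<close> and \<open>max\<close> put
  the times in order: \<open>AC_curve\<close> bounds \<open>W2\<close> only forwards in time, and
  symmetry of \<open>W2\<close> is never called upon.\<close>

lemma AC_curve_W2_small:
  assumes AC: "AC_curve a b m" and t: "t \<in> {a..b}" and e: "e > 0"
  shows "\<exists>\<delta>>0. \<forall>s\<in>{a..b}. \<bar>s - t\<bar> < \<delta> \<longrightarrow> W2 (m (min s t)) (m (max s t)) < e"
proof -
  obtain g where g: "set_integrable lborel {a..b} g"
    and W: "\<And>s t. a \<le> s \<Longrightarrow> s \<le> t \<Longrightarrow> t \<le> b \<Longrightarrow> W2 (m s) (m t) \<le> (LINT r:{s..t}|lborel. g r)"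
    using AC by (auto simp: AC_curve_def)
  have gi: "g integrable_on {a..b}"
    using set_borel_integral_eq_integral(1)[OF g] .
  have W': "W2 (m s) (m t) \<le> integral {a..t} g - integral {a..s} g" if "a \<le> s" "s \<le> t" "t \<le> b" for s t
  proof -
    have "set_integrable lborel {s..t} g"
      by (rule set_integrable_subset[OF g]) (use that in auto)
    from set_borel_integral_eq_integral(2)[OF this]
    have "W2 (m s) (m t) \<le> integral {s..t} g"
      using W[OF that] by simp
    moreover have "integral {a..s} g + integral {s..t} g = integral {a..t} g"
      using that by (intro Henstock_Kurzweil_Integration.integral_combine
          integrable_subinterval_real[OF gi]) auto
    ultimately show ?thesis by simp
  qed
  have "continuous_on {a..b} (\<lambda>x. integral {a..x} g)"
    by (rule indefinite_integral_continuous_1[OF gi])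
  then obtain \<delta> where \<delta>: "\<delta> > 0"
    "\<And>s. s \<in> {a..b} \<Longrightarrow> dist s t < \<delta> \<Longrightarrow> dist (integral {a..s} g) (integral {a..t} g) < e"
    using t e by (auto simp: continuous_on_iff) (meson atLeastAtMost_iff)
  show ?thesis
  proof (intro exI[of _ \<delta>] conjI ballI impI)
    fix s assume s: "s \<in> {a..b}" "\<bar>s - t\<bar> < \<delta>"
    show "W2 (m (min s t)) (m (max s t)) < e"
      using \<delta>(2)[OF s(1)] s t W'[of s t] W'[of t s]
      by (auto simp: dist_real_def min_def max_def abs_if split: if_splits)
  qed (use \<delta> in auto)
qed

text \<open>The modulus has the shape that \<open>integral_diff_le_W2\<close> asks for, uniformly in
  time. Bounded Lipschitz integrands have one, and so do compactly supported continuous ones; these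
  are the two uses below.\<close>

lemma AC_curve_integral_continuous:
  fixes g :: "real \<Rightarrow> real ^ 'd \<Rightarrow> real"
  assumes AC: "AC_curve a b m"
    and meas: "\<And>t. t \<in> {a..b} \<Longrightarrow> g t \<in> borel_measurable borel"
    and bnd: "\<And>t x. t \<in> {a..b} \<Longrightarrow> \<bar>g t x\<bar> \<le> C"
    and uc: "\<And>e. e > 0 \<Longrightarrow> \<exists>\<delta>>0. \<exists>K\<ge>0. \<forall>s\<in>{a..b}. \<forall>t\<in>{a..b}. \<bar>s - t\<bar> < \<delta> \<longrightarrow>
               (\<forall>x y. \<bar>g s x - g t y\<bar> \<le> e + K * (norm (x - y))\<^sup>2)"
  shows "continuous_on {a..b} (\<lambda>t. LINT x|m t. g t x)"
  unfolding continuous_on_iff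
proof (intro ballI allI impI)
  fix t and e :: real assume t: "t \<in> {a..b}" and e: "e > 0"
  obtain \<delta> K where \<delta>: "\<delta> > 0" and K: "K \<ge> 0"
    and *: "\<And>s t x y. s \<in> {a..b} \<Longrightarrow> t \<in> {a..b} \<Longrightarrow> \<bar>s - t\<bar> < \<delta> \<Longrightarrow> \<bar>g s x - g t y\<bar> \<le> e / 2 + K * (norm (x - y))\<^sup>2"
    using uc[of "e / 2"] e by auto
  \<comment> \<open>Chosen so that \<open>K * r^2 < e / 2\<close>; the \<open>+ 1\<close> covers
    \<open>K = 0\<close>.\<close>
  define r where "r = sqrt (e / (2 * (K + 1)))"
  have r: "r > 0" and r2: "r\<^sup>2 = e / (2 * (K + 1))"
    using e K by (auto simp: r_def)
  obtain \<delta>' where \<delta>': "\<delta>' > 0"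
    and W: "\<And>s. s \<in> {a..b} \<Longrightarrow> \<bar>s - t\<bar> < \<delta>' \<Longrightarrow> W2 (m (min s t)) (m (max s t)) < r"
    using AC_curve_W2_small[OF AC t r] by auto
  show "\<exists>d>0. \<forall>s\<in>{a..b}. dist s t < d \<longrightarrow> dist (LINT x|m s. g s x) (LINT x|m t. g t x) < e"
  proof (intro exI[of _ "min \<delta> \<delta>'"] conjI ballI impI)
    fix s assume s: "s \<in> {a..b}" and d: "dist s t < min \<delta> \<delta>'"
    let ?u = "min s t" and ?v = "max s t"
    have uv: "?u \<in> {a..b}" "?v \<in> {a..b}" "\<bar>?u - ?v\<bar> < \<delta>"
      using s t d by (auto simp: dist_real_def min_def max_def split: if_splits)
    have P: "m ?u \<in> P2" "m ?v \<in> P2"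
      using AC_curve_P2[OF AC] uv by blast+
    have "W2 (m ?u) (m ?v) < r"
      using W[OF s] d by (auto simp: dist_real_def)
    then have "(W2 (m ?u) (m ?v))\<^sup>2 \<le> r\<^sup>2"
      using W2_nonneg[OF P] by (intro power_mono) auto
    then have "K * (W2 (m ?u) (m ?v))\<^sup>2 \<le> K * (e / (2 * (K + 1)))"
      using K r2 by (intro mult_left_mono) auto
    also have "\<dots> < e / 2"
      using K e by (simp add: field_simps)
    finally have "K * (W2 (m ?u) (m ?v))\<^sup>2 < e / 2" .
    moreover have "\<bar>(LINT x|m ?u. g ?u x) - (LINT x|m ?v. g ?v x)\<bar> \<le> e / 2 + K * (W2 (m ?u) (m ?v))\<^sup>2"
      by (rule integral_diff_le_W2[OF P K meas[OF uv(1)] meas[OF uv(2)] bnd[OF uv(1)] bnd[OF uv(2)]])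
         (use * uv in auto)
    ultimately show "dist (LINT x|m s. g s x) (LINT x|m t. g t x) < e"
      by (auto simp: dist_real_def min_def max_def split: if_splits)
  qed (use \<delta> \<delta>' in auto)
qed

text \<open>Open sets are increasing limits of Lipschitz functions, whose integrals depend continuously
  on time.\<close>

lemma AC_curve_kernel:
  fixes m :: "real \<Rightarrow> (real ^ 'd) measure"
  assumes AC: "AC_curve a b m" and ab: "a \<le> b"
  shows "(\<lambda>t. if t \<in> {a..b} then m t else m a) \<in> borel \<rightarrow>\<^sub>M subprob_algebra borel"
proof -
  define k where "k t = (if t \<in> {a..b} then m t else m a)" for t
  have kP: "k t \<in> P2" for t
    using AC_curve_P2[OF AC] ab by (auto simp: k_def)
  have "k \<in> borel \<rightarrow>\<^sub>M subprob_algebra borel"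
  proof (rule measurable_subprob_algebra_generated[where \<Omega> = UNIV and G = "{S. open S}"])
    show "sets borel = sigma_sets UNIV {S. open S}"
      by (simp add: borel_def)
    show "Int_stable {S :: (real ^ 'd) set. open S}"
      by (auto simp: Int_stable_def)
    show "subprob_space (k t)" for t
      using P2_D(1)[OF kP] by (rule prob_space_imp_subprob_space)
    show "sets (k t) = sets borel" for t
      using P2_D(2)[OF kP] .
    have "emeasure (k t) UNIV = 1" for t
      using prob_space.emeasure_space_1[OF P2_D(1)[OF kP, of t]] P2_D(3)[OF kP, of t] by simp
    then show U: "(\<lambda>t. emeasure (k t) UNIV) \<in> borel_measurable borel"
      by simp
    fix U :: "(real ^ 'd) set" assume "U \<in> {S. open S}"
    then have op: "open U" by simp
    then have [measurable]: "U \<in> sets borel" by simp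
    show "(\<lambda>t. emeasure (k t) U) \<in> borel_measurable borel"
    \<comment> \<open>For the whole space, \<open>infdist\<close> to the empty complement is 0 by
      convention and the approximation below would give 0; the total mass is therefore treated
      apart.\<close>
    proof (cases "U = UNIV")
      case False
      define f where "f n x = min 1 (real n * infdist x (- U))" for n x
      have fm[measurable]: "f n \<in> borel_measurable borel" for n
        unfolding f_def by (intro borel_measurable_continuous_onI continuous_intros)
      have fb: "\<bar>f n x\<bar> \<le> 1" for n x
        using infdist_nonneg[of x "- U"] by (auto simp: f_def min_def)
      have fL: "\<bar>f n x - f n y\<bar> \<le> real n * norm (x - y)" for n x y
      proof -
        have "\<bar>f n x - f n y\<bar> \<le> \<bar>real n * infdist x (- U) - real n * infdist y (- U)\<bar>"
          unfolding f_def by linarith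
        also have "\<dots> = real n * \<bar>infdist x (- U) - infdist y (- U)\<bar>"
          by (simp add: abs_mult flip: right_diff_distrib)
        also have "\<dots> \<le> real n * norm (x - y)"
          using infdist_triangle_abs[of x "- U" y] by (intro mult_left_mono) (auto simp: dist_norm)
        finally show ?thesis .
      qed
      have cont: "continuous_on {a..b} (\<lambda>t. LINT x|m t. f n x)" for n
      proof (rule AC_curve_integral_continuous[OF AC fm fb])
        fix e :: real assume e: "e > 0"
        \<comment> \<open>A Lipschitz bound turned into a quadratic modulus: either
          \<open>real n * norm (x - y)\<close> is at most \<open>e\<close>, or it is at most its own
          square divided by \<open>e\<close>.\<close>
        have "\<bar>f n x - f n y\<bar> \<le> e + (real n)\<^sup>2 / e * (norm (x - y))\<^sup>2" for x y
        proof (cases "real n * norm (x - y) \<le> e")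
          case True
          have "0 \<le> (real n)\<^sup>2 / e * (norm (x - y))\<^sup>2" using e by simp
          with True fL[of n x y] show ?thesis by linarith
        next
          case False
          then have "e * (real n * norm (x - y)) \<le> (real n * norm (x - y)) * (real n * norm (x - y))"
            using e by (intro mult_right_mono) auto
          then have "real n * norm (x - y) \<le> (real n)\<^sup>2 / e * (norm (x - y))\<^sup>2"
            using e by (simp add: field_simps power2_eq_square)
          with fL[of n x y] e show ?thesis by linarith
        qed
        then show "\<exists>\<delta>>0. \<exists>K\<ge>0. \<forall>s\<in>{a..b}. \<forall>t\<in>{a..b}. \<bar>s - t\<bar> < \<delta> \<longrightarrow>
            (\<forall>x y. \<bar>f n x - f n y\<bar> \<le> e + K * (norm (x - y))\<^sup>2)"
          using e by (intro exI[of _ 1] exI[of _ "(real n)\<^sup>2 / e"] conjI) auto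
      qed
      have [measurable]: "(\<lambda>t. LINT x|k t. f n x) \<in> borel_measurable borel" for n
      proof -
        have "(\<lambda>t. if t \<in> {a..b} then LINT x|m t. f n x else LINT x|m a. f n x) \<in> borel_measurable borel"
          by (intro borel_measurable_continuous_on_if cont continuous_intros) auto
        also have "(\<lambda>t. if t \<in> {a..b} then LINT x|m t. f n x else LINT x|m a. f n x) = (\<lambda>t. LINT x|k t. f n x)"
          by (auto simp: k_def)
        finally show ?thesis .
      qed
      have lim: "(\<lambda>n. f n x) \<longlonglongrightarrow> indicator U x" for x
      proof (cases "x \<in> U")
        case True
        then have pos: "infdist x (- U) > 0"
          using False op by (intro infdist_pos_not_in_closed) auto
        obtain n0 where n0: "real n0 * infdist x (- U) > 1"
          using reals_Archimedean3[OF pos] by blast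
        have "f n x = 1" if "n \<ge> n0" for n
        proof -
          have "real n0 * infdist x (- U) \<le> real n * infdist x (- U)"
            using that pos by (intro mult_right_mono) auto
          with n0 show ?thesis by (simp add: f_def)
        qed
        then show ?thesis
          using True by (intro tendsto_eventually) (auto simp: eventually_sequentially)
      qed (simp add: f_def)
      have "(\<lambda>n. LINT x|k t. f n x) \<longlonglongrightarrow> (LINT x|k t. indicator U x)" for t
      proof -
        interpret prob_space "k t" using P2_D(1)[OF kP] .
        show ?thesis
          by (rule integral_dominated_convergence[where w = "\<lambda>_. 1"])
             (use lim fb in \<open>auto intro!: P2_measurable[OF kP]\<close>)
      qed
      moreover have "(LINT x|k t. indicator U x) = measure (k t) U" for t
        using P2_D(3)[OF kP, of t] by simp
      ultimately have "(\<lambda>n. LINT x|k t. f n x) \<longlonglongrightarrow> measure (k t) U" for t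
        by simp
      then have [measurable]: "(\<lambda>t. measure (k t) U) \<in> borel_measurable borel"
        by (rule borel_measurable_LIMSEQ_real) measurable
      have "emeasure (k t) U = ennreal (measure (k t) U)" for t
      proof -
        interpret prob_space "k t" using P2_D(1)[OF kP] .
        show ?thesis by (rule emeasure_eq_measure)
      qed
      then show ?thesis by simp
    qed (use U in auto)
  qed auto
  then show ?thesis by (simp add: k_def[abs_def])
qed

text \<open>Pushing \<open>k t\<close> forward along the map from \<open>x\<close> to
  \<open>(t, x)\<close> makes the integrand independent of \<open>t\<close>, so that measurability
  of the integral of a fixed function against a kernel applies.\<close>

lemma kernel_integral_measurable:
  fixes f :: "'a \<times> 'b \<Rightarrow> 'c::{banach, second_countable_topology}"
  assumes [measurable]: "k \<in> M \<rightarrow>\<^sub>M subprob_algebra N" "f \<in> borel_measurable (M \<Otimes>\<^sub>M N)"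
  shows "(\<lambda>t. LINT x|k t. f (t, x)) \<in> borel_measurable M"
proof -
  have "(\<lambda>t. integral\<^sup>L (distr (k t) (M \<Otimes>\<^sub>M N) (\<lambda>x. (t, x))) f) \<in> borel_measurable M"
    by (rule measurable_compose[OF measurable_distr2 integral_measurable_subprob_algebra]) measurable
  then show ?thesis
    by (rule measurable_cong[THEN iffD1, rotated])
       (auto simp: sets_kernel[OF assms(1)] intro!: integral_distr)
qed

section \<open>Subsolutions of the Hamilton--Jacobi equation along the continuity equation\<close>

lemma Ck_frechet_continuous:
  "Ck_on (Suc k) S f \<Longrightarrow> continuous_on S (\<lambda>x. frechet_derivative f (at x) v)"
  using Ck_on_continuous[of k S "\<lambda>x. frechet_derivative f (at x) v"] by simp

text \<open>In the continuity equation both the derivative and its direction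
  \<open>\<alpha> t x\<close> vary with the point. The expansion reduces measurability and bounds to
  finitely many fixed directions.\<close>

lemma linear_snd_expand:
  fixes L :: "real \<times> 'a::euclidean_space \<Rightarrow> real"
  assumes "linear L"
  shows "L (0, w) = (\<Sum>e\<in>Basis. (w \<bullet> e) * L (0, e))"
proof -
  have "linear (\<lambda>w :: 'a. (0 :: real, w))"
    by (rule linearI) auto
  then have "linear (\<lambda>w. L (0, w))"
    using linear_compose[of "\<lambda>w. (0, w)" L] assms by (simp add: comp_def)
  then have "L (0, \<Sum>e\<in>Basis. (w \<bullet> e) *\<^sub>R e) = (\<Sum>e\<in>Basis. (w \<bullet> e) * L (0, e))"
    by (simp only: linear_sum[of "\<lambda>w. L (0, w)"] linear_scale[of "\<lambda>w. L (0, w)"] real_scaleR_def)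
  then show ?thesis by (simp add: euclidean_representation)
qed

lemma linear_split_pair:
  fixes L :: "real \<times> 'a::euclidean_space \<Rightarrow> real"
  assumes "linear L"
  shows "L (1, 0) + L (0, w) = L (1, w)"
  using linear_add[OF assms, of "(1, 0)" "(0, w)"] by simp

lemma test_functions_D:
  assumes "\<phi> \<in> test_functions a b"
  shows "Ck_on k UNIV \<phi>" "\<phi> differentiable (at z)" "linear (frechet_derivative \<phi> (at z))"
    "continuous_on S (\<lambda>z. frechet_derivative \<phi> (at z) v)"
    "(\<phi> has_derivative frechet_derivative \<phi> (at z)) (at z)"
proof -
  show 1: "Ck_on k UNIV \<phi>" for k
    using assms by (auto simp: test_functions_def Ck_on_UNIV)
  show "\<phi> differentiable (at z)"
    using 1[of "Suc 0"] by (simp del: split_paired_All)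
  then show "linear (frechet_derivative \<phi> (at z))" "(\<phi> has_derivative frechet_derivative \<phi> (at z)) (at z)"
    using linear_frechet_derivative frechet_derivative_works by auto
  show "continuous_on S (\<lambda>z. frechet_derivative \<phi> (at z) v)"
    using Ck_frechet_continuous[OF 1[of "Suc 0"]] continuous_on_subset by blast
qed

lemma test_functions_deriv_bounded:
  assumes "\<phi> \<in> test_functions a b"
  shows "\<exists>C. \<forall>z. \<bar>frechet_derivative \<phi> (at z) v\<bar> \<le> C"
proof -
  obtain K where K: "compact K" "\<And>z. z \<notin> K \<Longrightarrow> \<phi> z = 0"
    using assms by (auto simp: test_functions_def)
  let ?f = "\<lambda>z. frechet_derivative \<phi> (at z) v"
  have "bounded (?f ` K)"
    using K test_functions_D(4)[OF assms] by (intro compact_imp_bounded compact_continuous_image)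
  then obtain C where C: "\<And>z. z \<in> K \<Longrightarrow> \<bar>?f z\<bar> \<le> C"
    by (auto simp: bounded_iff)
  have "?f z = 0" if "z \<notin> K" for z
  proof -
    have "frechet_derivative \<phi> (at z) = frechet_derivative (\<lambda>_. 0) (at z)"
      using K that compact_imp_closed[OF K(1)]
      by (intro frechet_derivative_cong_open(2)[of "- K"]) auto
    then show ?thesis by (simp add: frechet_derivative_const)
  qed
  then have "\<bar>?f z\<bar> \<le> max C 0" for z
    using C[of z] by (cases "z \<in> K") auto
  then show ?thesis by blast
qed

lemma test_functions_deriv_measurable:
  fixes \<alpha> :: "real \<Rightarrow> real ^ 'd \<Rightarrow> real ^ 'd"
  assumes "\<phi> \<in> test_functions a b" and [measurable]: "case_prod \<alpha> \<in> borel_measurable (borel \<Otimes>\<^sub>M borel)"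
  shows "(\<lambda>z. frechet_derivative \<phi> (at z) (1, 0) + frechet_derivative \<phi> (at z) (0, case_prod \<alpha> z))
           \<in> borel_measurable (borel \<Otimes>\<^sub>M borel)"
proof -
  have [measurable]: "(\<lambda>z. frechet_derivative \<phi> (at z) v) \<in> borel_measurable (borel \<Otimes>\<^sub>M borel)" for v
    unfolding borel_prod by (intro borel_measurable_continuous_onI test_functions_D(4)[OF assms(1)])
  show ?thesis
    by (subst linear_snd_expand[OF test_functions_D(3)[OF assms(1)]]) measurable
qed

text \<open>Finiteness of the iterated \<open>ennreal\<close> integral becomes a statement on
  Bochner integrals once the inner integral is known to be measurable in time, which the kernel
  property of the curve provides.\<close>

lemma L2_fields_D:
  assumes "AC_curve a b m" "a \<le> b" "\<alpha> \<in> L2_fields a b m"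
  shows "case_prod \<alpha> \<in> borel_measurable (borel \<Otimes>\<^sub>M borel)" "\<alpha> t \<in> borel_measurable borel"
    "AE t in lborel. t \<in> {a..b} \<longrightarrow> integrable (m t) (\<lambda>x. (1/2) * (norm (\<alpha> t x))\<^sup>2)"
    "set_integrable lborel {a..b} (\<lambda>t. LINT x|m t. (1/2) * (norm (\<alpha> t x))\<^sup>2)"
proof -
  define k where "k t = (if t \<in> {a..b} then m t else m a)" for t
  have [measurable]: "k \<in> borel \<rightarrow>\<^sub>M subprob_algebra borel"
    unfolding k_def[abs_def] by (rule AC_curve_kernel[OF assms(1,2)])
  show am[measurable]: "case_prod \<alpha> \<in> borel_measurable (borel \<Otimes>\<^sub>M borel)"
    using assms(3) by (auto simp: L2_fields_def)
  show at[measurable]: "\<alpha> t \<in> borel_measurable borel" for t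
    using measurable_compose[OF measurable_Pair1'[of t borel borel] am] by simp
  have kP: "k t \<in> P2" for t
    using AC_curve_P2[OF assms(1)] assms(2) by (auto simp: k_def)
  define N where "N t = (\<integral>\<^sup>+x. ennreal ((norm (\<alpha> t x))\<^sup>2) \<partial>k t)" for t
  have [measurable]: "N \<in> borel_measurable borel"
    unfolding N_def[abs_def] by (rule nn_integral_measurable_subprob_algebra2[where N = borel]) measurable
  have "(\<integral>\<^sup>+t\<in>{a..b}. (\<integral>\<^sup>+x. ennreal ((norm (\<alpha> t x))\<^sup>2) \<partial>m t) \<partial>lborel) < \<infinity>"
    using assms(3) by (auto simp: L2_fields_def)
  also have "(\<integral>\<^sup>+t\<in>{a..b}. (\<integral>\<^sup>+x. ennreal ((norm (\<alpha> t x))\<^sup>2) \<partial>m t) \<partial>lborel) = (\<integral>\<^sup>+t\<in>{a..b}. N t \<partial>lborel)"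
    by (rule nn_integral_cong) (auto simp: N_def k_def indicator_def)
  finally have fin: "(\<integral>\<^sup>+t\<in>{a..b}. N t \<partial>lborel) < \<infinity>" .
  have int: "integrable (k t) (\<lambda>x. (1/2) * (norm (\<alpha> t x))\<^sup>2)" if "N t < \<infinity>" for t
  proof -
    have "integrable (k t) (\<lambda>x. (norm (\<alpha> t x))\<^sup>2)"
      by (rule integrableI_bounded) (use that in \<open>auto simp: N_def intro!: P2_measurable[OF kP]\<close>)
    then show ?thesis by simp
  qed
  have "AE t in lborel. N t * indicator {a..b} t \<noteq> \<infinity>"
    using fin by (intro nn_integral_PInf_AE) auto
  then show "AE t in lborel. t \<in> {a..b} \<longrightarrow> integrable (m t) (\<lambda>x. (1/2) * (norm (\<alpha> t x))\<^sup>2)"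
  proof eventually_elim
    case (elim t)
    then show ?case using int[of t] by (auto simp: k_def less_top)
  qed
  let ?A = "\<lambda>t. LINT x|k t. (1/2) * (norm (\<alpha> t x))\<^sup>2"
  have [measurable]: "?A \<in> borel_measurable borel"
    using kernel_integral_measurable[of k borel borel "\<lambda>z. (1/2) * (norm (case_prod \<alpha> z))\<^sup>2"] by simp
  have AN: "ennreal (?A t) \<le> N t" for t
  proof (cases "integrable (k t) (\<lambda>x. (1/2) * (norm (\<alpha> t x))\<^sup>2)")
    case True
    have "ennreal (?A t) = (\<integral>\<^sup>+x. ennreal ((1/2) * (norm (\<alpha> t x))\<^sup>2) \<partial>k t)"
      by (rule nn_integral_eq_integral[symmetric, OF True]) auto
    also have "\<dots> \<le> N t"
      unfolding N_def by (intro nn_integral_mono ennreal_leI) auto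
    finally show ?thesis .
  next
    \<comment> \<open>A divergent inner integral is 0 as a Bochner integral, so the comparison with
      \<open>N t\<close> holds at every time.\<close>
    case False
    from not_integrable_integral_eq[OF this] show ?thesis by (simp only: ennreal_0 zero_le)
  qed
  have "set_integrable lborel {a..b} ?A"
    unfolding set_integrable_def
  proof (rule integrableI_bounded)
    have "(\<integral>\<^sup>+t. ennreal (norm (indicator {a..b} t *\<^sub>R ?A t)) \<partial>lborel) \<le> (\<integral>\<^sup>+t\<in>{a..b}. N t \<partial>lborel)"
    proof (rule nn_integral_mono)
      fix t
      have "?A t \<ge> 0" by simp
      then show "ennreal (norm (indicator {a..b} t *\<^sub>R ?A t)) \<le> N t * indicator {a..b} t"
        using AN[of t] by (auto simp: indicator_def simp del: integral_mult_right_zero)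
    qed
    also have "\<dots> < \<infinity>" by (rule fin)
    finally show "(\<integral>\<^sup>+t. ennreal (norm (indicator {a..b} t *\<^sub>R ?A t)) \<partial>lborel) < \<infinity>" .
  qed measurable
  also have "set_integrable lborel {a..b} ?A \<longleftrightarrow>
      set_integrable lborel {a..b} (\<lambda>t. LINT x|m t. (1/2) * (norm (\<alpha> t x))\<^sup>2)"
    by (rule set_integrable_cong) (auto simp: k_def)
  finally show "set_integrable lborel {a..b} (\<lambda>t. LINT x|m t. (1/2) * (norm (\<alpha> t x))\<^sup>2)" .
qed

text \<open>A Bochner integral that does not converge is 0, so the equation carries information only
  after integrability is known. The integrand is dominated by an affine function of the kinetic
  energy, since a norm is at most 1 plus its square.\<close>

lemma continuity_equation_integrable:
  fixes m :: "real \<Rightarrow> (real ^ 'd) measure"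
  assumes AC: "AC_curve a b m" and ab: "a \<le> b" and \<alpha>: "\<alpha> \<in> L2_fields a b m"
    and \<phi>: "\<phi> \<in> test_functions a b"
  defines "h \<equiv> \<lambda>t x. frechet_derivative \<phi> (at (t, x)) (1, 0) + frechet_derivative \<phi> (at (t, x)) (0, \<alpha> t x)"
  shows "set_integrable lborel {a..b} (\<lambda>t. LINT x|m t. h t x)"
    "AE t in lborel. t \<in> {a..b} \<longrightarrow> integrable (m t) (h t)"
proof -
  define k where "k t = (if t \<in> {a..b} then m t else m a)" for t
  have km[measurable]: "k \<in> borel \<rightarrow>\<^sub>M subprob_algebra borel"
    unfolding k_def[abs_def] by (rule AC_curve_kernel[OF assms(1,2)])
  note L = L2_fields_D[OF AC ab \<alpha>]
  note [measurable] = L(1)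
  let ?D = "\<lambda>v z. frechet_derivative \<phi> (at z) v"
  have hm[measurable]: "case_prod h \<in> borel_measurable (borel \<Otimes>\<^sub>M borel)"
    using test_functions_deriv_measurable[OF \<phi> L(1)] by (simp add: h_def case_prod_beta')
  have ht[measurable]: "h t \<in> borel_measurable borel" for t
    using measurable_compose[OF measurable_Pair1'[of t borel borel] hm] by simp
  obtain C where C: "\<And>v z. \<bar>?D v z\<bar> \<le> C v"
    using test_functions_deriv_bounded[OF \<phi>] by metis
  define C1 where "C1 = (\<Sum>e\<in>Basis. C (0, e :: real ^ 'd))"
  have C0: "C v \<ge> 0" for v using C[where v = v and z = undefined] by linarith
  have C1: "C1 \<ge> 0" unfolding C1_def by (intro sum_nonneg C0)
  have hb: "\<bar>h t x\<bar> \<le> (C (1, 0) + C1) + 2 * C1 * ((1/2) * (norm (\<alpha> t x))\<^sup>2)" for t x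
  proof -
    let ?w = "\<alpha> t x"
    have "\<bar>?D (0, ?w) (t, x)\<bar> \<le> (\<Sum>e\<in>Basis. \<bar>(?w \<bullet> e) * ?D (0, e) (t, x)\<bar>)"
      by (subst linear_snd_expand[OF test_functions_D(3)[OF \<phi>]]) (rule sum_abs)
    also have "\<dots> \<le> (\<Sum>e\<in>Basis. norm ?w * C (0, e))"
      unfolding abs_mult by (intro sum_mono mult_mono Basis_le_norm C) auto
    also have "\<dots> = norm ?w * C1" by (simp add: C1_def sum_distrib_left)
    also have "\<dots> \<le> (1 + (norm ?w)\<^sup>2) * C1"
      by (rule mult_right_mono[OF norm_le_1_plus_square C1])
    finally show ?thesis
      using C[where v = "(1, 0)" and z = "(t, x)"] unfolding h_def by (simp add: algebra_simps)
  qed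
  let ?A = "\<lambda>t. LINT x|m t. (1/2) * (norm (\<alpha> t x))\<^sup>2"
  have key: "integrable (m t) (h t) \<and> \<bar>LINT x|m t. h t x\<bar> \<le> (C (1, 0) + C1) + 2 * C1 * ?A t"
    if t: "t \<in> {a..b}" and i: "integrable (m t) (\<lambda>x. (1/2) * (norm (\<alpha> t x))\<^sup>2)" for t
  proof -
    have mt: "m t \<in> P2" using AC_curve_P2[OF AC t] .
    interpret prob_space "m t" using P2_D(1)[OF mt] .
    have ib: "integrable (m t) (\<lambda>x. (C (1, 0) + C1) + 2 * C1 * ((1/2) * (norm (\<alpha> t x))\<^sup>2))"
      by (intro Bochner_Integration.integrable_add integrable_const integrable_mult_right i)
    have ih: "integrable (m t) (h t)"
      by (rule Bochner_Integration.integrable_bound[OF ib])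
         (use hb C0 C1 in \<open>auto intro!: P2_measurable[OF mt] AE_I2 order_trans[OF hb]\<close>)
    have "\<bar>LINT x|m t. h t x\<bar> \<le> (LINT x|m t. \<bar>h t x\<bar>)"
      by (rule integral_abs_bound)
    also have "\<dots> \<le> (LINT x|m t. (C (1, 0) + C1) + 2 * C1 * ((1/2) * (norm (\<alpha> t x))\<^sup>2))"
      by (intro integral_mono ib integrable_abs ih hb)
    also have "\<dots> = (LINT x|m t. C (1, 0) + C1) + (LINT x|m t. 2 * C1 * ((1/2) * (norm (\<alpha> t x))\<^sup>2))"
      by (intro Bochner_Integration.integral_add integrable_const integrable_mult_right i)
    also have "\<dots> = (C (1, 0) + C1) + 2 * C1 * ?A t"
      by (subst Bochner_Integration.integral_mult_right) (use i in \<open>auto simp: prob_space\<close>)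
    finally show ?thesis using ih by blast
  qed
  show "AE t in lborel. t \<in> {a..b} \<longrightarrow> integrable (m t) (h t)"
    using L(3) by eventually_elim (use key in blast)
  have hk: "(\<lambda>t. LINT x|k t. h t x) \<in> borel_measurable borel"
    using kernel_integral_measurable[OF km hm] by simp
  have eq: "indicator {a..b} t *\<^sub>R (LINT x|m t. h t x) = indicator {a..b} t *\<^sub>R (LINT x|k t. h t x)" for t
    by (simp add: k_def indicator_def)
  show "set_integrable lborel {a..b} (\<lambda>t. LINT x|m t. h t x)"
    unfolding set_integrable_def
  proof (rule Bochner_Integration.integrable_bound)
    have "set_integrable lborel {a..b} (\<lambda>t. C (1, 0) + C1 :: real)"
      by (rule borel_integrable_atLeastAtMost') auto
    then have "set_integrable lborel {a..b} (\<lambda>t. (C (1, 0) + C1) + 2 * C1 * ?A t)"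
      by (rule set_integral_add(1)) (intro set_integrable_mult_right L(4))
    then show "integrable lborel (\<lambda>t. indicator {a..b} t *\<^sub>R ((C (1, 0) + C1) + 2 * C1 * ?A t))"
      by (simp add: set_integrable_def)
    show "(\<lambda>t. indicator {a..b} t *\<^sub>R (LINT x|m t. h t x)) \<in> borel_measurable lborel"
      unfolding eq using hk by simp
    show "AE t in lborel. norm (indicator {a..b} t *\<^sub>R (LINT x|m t. h t x)) \<le>
        norm (indicator {a..b} t *\<^sub>R ((C (1, 0) + C1) + 2 * C1 * ?A t))"
      using L(3)
    proof eventually_elim
      case (elim t)
      show ?case
      proof (cases "t \<in> {a..b}")
        case True
        with elim key[OF True] show ?thesis
          by (auto simp: abs_le_iff simp del: integral_mult_right_zero)
      qed simp
    qed
  qed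
qed

text \<open>Testing the continuity equation with \<open>\<eta>(t) g(t, x)\<close>, where \<open>\<eta>\<close> increases to the indicator of
  the time interval.\<close>

lemma subsolution_integral_le:
  fixes m :: "real \<Rightarrow> (real ^ 'd) measure" and g :: "real \<times> (real ^ 'd) \<Rightarrow> real"
  assumes AC: "AC_curve a b m" and ab: "a < b" and \<alpha>: "\<alpha> \<in> L2_fields a b m"
    and CE: "continuity_equation a b m \<alpha>"
    and U: "open U" "{a..b} \<subseteq> U" and g: "\<And>k. Ck_on k (U \<times> UNIV) g"
    and supp: "\<And>t x. t \<in> {a..b} \<Longrightarrow> norm x > B \<Longrightarrow> g (t, x) = 0"
    and HJ: "\<And>t x w. t \<in> {a..b} \<Longrightarrow> frechet_derivative g (at (t, x)) (1, w) \<le> (1/2) * (norm w)\<^sup>2"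
  shows "(LINT x|m b. g (b, x)) - (LINT x|m a. g (a, x))
           \<le> (LINT t:{a..b}|lborel. LINT x|m t. (1/2) * (norm (\<alpha> t x))\<^sup>2)"
proof -
  let ?A = "\<lambda>t. LINT x|m t. (1/2) * (norm (\<alpha> t x))\<^sup>2"
  let ?F = "\<lambda>t. LINT x|m t. g (t, x)"
  note L = L2_fields_D[OF AC less_imp_le[OF ab] \<alpha>]
  have opS: "open (U \<times> (UNIV :: (real ^ 'd) set))"
    using U(1) by (intro open_Times) auto
  have gc: "continuous_on ({a..b} \<times> UNIV) g"
    by (rule continuous_on_subset[OF Ck_on_continuous[OF g[of 0]]]) (use U(2) in auto)
  have gcx: "continuous_on UNIV (\<lambda>x. g (t, x))" if "t \<in> {a..b}" for t
    using that by (intro continuous_on_compose2[OF gc] continuous_intros) auto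
  \<comment> \<open>The margin 1 beyond the support: two points closer than 1 either both have norm
    at most \<open>B + 1\<close> or both have norm above \<open>B\<close>, where \<open>g\<close>
    vanishes.\<close>
  define Q where "Q = {a..b} \<times> cball (0 :: real ^ 'd) (B + 1)"
  have Q: "compact Q" unfolding Q_def by (intro compact_Times) auto
  have gQ: "continuous_on Q g"
    using gc by (rule continuous_on_subset) (auto simp: Q_def)
  obtain C where C: "\<And>z. z \<in> Q \<Longrightarrow> \<bar>g z\<bar> \<le> C"
    using compact_imp_bounded[OF compact_continuous_image[OF gQ Q]] by (auto simp: bounded_iff)
  have gb: "\<bar>g (t, x)\<bar> \<le> max C 0" if "t \<in> {a..b}" for t x
    using C[of "(t, x)"] supp[OF that, of x] that
    by (cases "norm x > B") (auto simp: Q_def)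
  have gm: "(\<lambda>x. g (t, x)) \<in> borel_measurable borel" if "t \<in> {a..b}" for t
    using gcx[OF that] by (rule borel_measurable_continuous_onI)
  have Fc: "continuous_on {a..b} ?F"
  proof (rule AC_curve_integral_continuous[OF AC gm gb])
    fix e :: real assume e: "e > 0"
    have "uniformly_continuous_on Q g"
      by (rule compact_uniformly_continuous[OF gQ Q])
    then obtain d where d: "d > 0" "\<And>z z'. z \<in> Q \<Longrightarrow> z' \<in> Q \<Longrightarrow> dist z' z < d \<Longrightarrow> dist (g z') (g z) < e"
      unfolding uniformly_continuous_on_def using e by metis
    \<comment> \<open>Half of \<open>d\<close>, as time and space differences add up.
      \<open>K\<close> lets the quadratic term absorb the oscillation of \<open>g\<close>, at most
      \<open>2 * max C 0\<close>, for points at distance at least \<open>r\<close>.\<close>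
    define r where "r = min 1 (d / 2)"
    define K where "K = 2 * max C 0 / r\<^sup>2"
    have r: "r > 0" using d by (simp add: r_def)
    have K: "K \<ge> 0" by (simp add: K_def)
    have "\<bar>g (s, x) - g (t, y)\<bar> \<le> e + K * (norm (x - y))\<^sup>2"
      if st: "s \<in> {a..b}" "t \<in> {a..b}" "\<bar>s - t\<bar> < r" for s t x y
    proof (cases "norm (x - y) < r")
      case True
      have "\<bar>g (s, x) - g (t, y)\<bar> \<le> e"
      proof (cases "norm x \<le> B + 1 \<and> norm y \<le> B + 1")
        case True
        have "dist (s, x) (t, y) \<le> dist s t + dist x y"
          unfolding dist_Pair_Pair by (rule order_trans[OF sqrt_sum_squares_le_sum_abs]) simp
        also have "\<dots> = \<bar>s - t\<bar> + norm (x - y)"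
          by (simp add: dist_real_def dist_norm)
        also have "\<dots> < d"
          using \<open>norm (x - y) < r\<close> st(3) by (simp add: r_def)
        finally show ?thesis
          using d(2)[of "(t, y)" "(s, x)"] True st by (auto simp: Q_def dist_real_def)
      next
        case False
        have "norm x \<le> norm y + norm (x - y)" "norm y \<le> norm x + norm (x - y)"
          using norm_triangle_sub[of x y] norm_triangle_sub[of y x] by (auto simp: norm_minus_commute)
        then have "norm x > B" "norm y > B"
          using False True by (auto simp: r_def)
        then show ?thesis using supp st e by simp
      qed
      moreover have "0 \<le> K * (norm (x - y))\<^sup>2" using K by simp
      ultimately show ?thesis by linarith
    next
      case False
      then have "r\<^sup>2 \<le> (norm (x - y))\<^sup>2" using r by (intro power_mono) auto
      then have "K * r\<^sup>2 \<le> K * (norm (x - y))\<^sup>2" using K by (rule mult_left_mono)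
      then have "2 * max C 0 \<le> K * (norm (x - y))\<^sup>2" using r by (simp add: K_def)
      then show ?thesis using gb[OF st(1), of x] gb[OF st(2), of y] e by linarith
    qed
    then show "\<exists>\<delta>>0. \<exists>K\<ge>0. \<forall>s\<in>{a..b}. \<forall>t\<in>{a..b}. \<bar>s - t\<bar> < \<delta> \<longrightarrow>
        (\<forall>x y. \<bar>g (s, x) - g (t, y)\<bar> \<le> e + K * (norm (x - y))\<^sup>2)"
      using r K by blast
  qed
  have "?F b - ?F a \<le> (LINT t:{a..b}|lborel. ?A t) + e" if e: "e > 0" for e
  proof -
    define c where "c = (a + b) / 2"
    have cab: "a \<le> c" "c \<le> b" using ab by (auto simp: c_def)
    obtain d1 where d1: "d1 > 0" "\<And>t. t \<in> {a..b} \<Longrightarrow> \<bar>t - a\<bar> < d1 \<Longrightarrow> \<bar>?F t - ?F a\<bar> < e / 2"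
      using Fc ab e unfolding continuous_on_iff dist_real_def
      by (metis atLeastAtMost_iff half_gt_zero less_imp_le order_refl)
    obtain d2 where d2: "d2 > 0" "\<And>t. t \<in> {a..b} \<Longrightarrow> \<bar>t - b\<bar> < d2 \<Longrightarrow> \<bar>?F t - ?F b\<bar> < e / 2"
      using Fc ab e unfolding continuous_on_iff dist_real_def
      by (metis atLeastAtMost_iff half_gt_zero less_imp_le order_refl)
    \<comment> \<open>Both ramps lie within \<open>2 * \<delta>\<close> of the end times, hence
      where \<open>?F\<close> is within \<open>e / 2\<close> of its end values.\<close>
    define \<delta> where "\<delta> = min ((b - a) / 4) (min d1 d2 / 3)"
    have \<delta>: "\<delta> > 0" "4 * \<delta> \<le> b - a" "2 * \<delta> < d1" "2 * \<delta> < d2"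
      using ab d1 d2 by (auto simp: \<delta>_def min_def)
    obtain \<eta> where \<eta>: "\<And>k. Ck_on k UNIV \<eta>" "\<And>t. 0 \<le> \<eta> t" "\<And>t. \<eta> t \<le> 1"
      "\<And>t. t < a + \<delta> \<Longrightarrow> \<eta> t = 0" "\<And>t. t > b - \<delta> \<Longrightarrow> \<eta> t = 0" "\<eta> c = 1"
      "\<And>t. t \<le> c \<Longrightarrow> deriv \<eta> t \<ge> 0" "\<And>t. t \<ge> c \<Longrightarrow> deriv \<eta> t \<le> 0"
      "\<And>t. a + 2 * \<delta> \<le> t \<Longrightarrow> t \<le> b - 2 * \<delta> \<Longrightarrow> deriv \<eta> t = 0"
      using smooth_plateau[OF \<delta>(1,2)] unfolding c_def by metis
    note \<eta>' = Ck_on_real_deriv[OF \<eta>(1)[of "Suc 0"]]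
    define \<phi> where "\<phi> z = \<eta> (fst z) * g z" for z
    have \<phi>: "\<phi> \<in> test_functions a b"
      unfolding test_functions_def
    proof (intro CollectI conjI allI exI)
      fix k
      \<comment> \<open>\<open>g\<close> is smooth only around \<open>{a..b}\<close>, but on
        \<open>?V\<close> the factor \<open>\<eta>\<close> vanishes; the two open sets cover
        everything.\<close>
      let ?V = "({..<a + \<delta>} \<union> {b - \<delta><..}) \<times> (UNIV :: (real ^ 'd) set)"
      have "Ck_on k (U \<times> UNIV) (\<lambda>z. \<eta> (fst z) * g z)"
        by (intro Ck_on_mult opS g Ck_on_compose[OF opS open_UNIV _ \<eta>(1)] Ck_on_linear bounded_linear_fst) auto
      moreover have "Ck_on k ?V (\<lambda>z. \<eta> (fst z) * g z)"
        by (rule Ck_on_cong[OF _ _ Ck_on_const[of _ _ 0]]) (auto intro!: open_Times simp: \<eta>(4,5))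
      ultimately have "Ck_on k (U \<times> UNIV \<union> ?V) (\<lambda>z. \<eta> (fst z) * g z)"
        by (intro Ck_on_Un opS open_Times) auto
      also have "U \<times> UNIV \<union> ?V = UNIV"
      proof -
        have "t \<in> U \<or> t < a + \<delta> \<or> b - \<delta> < t" for t
          using subsetD[OF U(2), of t] \<delta> unfolding atLeastAtMost_iff by linarith
        then show ?thesis by auto
      qed
      finally show "Ck k \<phi>"
        by (simp add: Ck_on_UNIV \<phi>_def[abs_def])
    next
      show "compact ({a + \<delta>..b - \<delta>} \<times> cball (0 :: real ^ 'd) B)"
        by (intro compact_Times) auto
      show "{a + \<delta>..b - \<delta>} \<times> cball (0 :: real ^ 'd) B \<subseteq> {a<..<b} \<times> UNIV"
        using \<delta> by auto
      fix z :: "real \<times> (real ^ 'd)"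
      show "z \<notin> {a + \<delta>..b - \<delta>} \<times> cball 0 B \<longrightarrow> \<phi> z = 0"
        using \<eta>(4)[of "fst z"] \<eta>(5)[of "fst z"] supp[of "fst z" "snd z"] \<delta>
        by (cases "fst z < a + \<delta>"; cases "fst z > b - \<delta>"; cases z) (auto simp: \<phi>_def not_le)
    qed
    define h where "h = (\<lambda>t x. frechet_derivative \<phi> (at (t, x)) (1, 0) + frechet_derivative \<phi> (at (t, x)) (0, \<alpha> t x))"
    have hle: "h t x \<le> deriv \<eta> t * g (t, x) + (1/2) * (norm (\<alpha> t x))\<^sup>2" if t: "t \<in> {a..b}" for t x
    proof -
      let ?z = "(t, x)" and ?w = "\<alpha> t x"
      have gd: "(g has_derivative frechet_derivative g (at ?z)) (at ?z)"
        by (rule Ck_on_has_derivative[OF g[of "Suc 0"]]) (use t U in auto)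
      have "((\<lambda>z. \<eta> (fst z)) has_derivative (\<lambda>v. deriv \<eta> t * fst v)) (at ?z)"
        by (rule has_derivative_eq_rhs[OF has_derivative_compose[OF has_derivative_fst[OF has_derivative_ident]
            \<eta>'(1)[of "fst ?z", unfolded has_field_derivative_def]]]) (auto simp: fun_eq_iff)
      from has_derivative_mult[OF this gd]
      have "(\<phi> has_derivative (\<lambda>v. \<eta> t * frechet_derivative g (at ?z) v + deriv \<eta> t * fst v * g ?z)) (at ?z)"
        by (simp add: \<phi>_def[abs_def])
      then have "frechet_derivative \<phi> (at ?z) = (\<lambda>v. \<eta> t * frechet_derivative g (at ?z) v + deriv \<eta> t * fst v * g ?z)"
        by (rule frechet_derivative_at[symmetric])
      moreover have "h t x = frechet_derivative \<phi> (at ?z) (1, ?w)"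
        unfolding h_def by (rule linear_split_pair[OF test_functions_D(3)[OF \<phi>]])
      ultimately have "h t x = \<eta> t * frechet_derivative g (at ?z) (1, ?w) + deriv \<eta> t * g ?z"
        by simp
      \<comment> \<open>\<open>\<eta>\<close> lies between 0 and 1 and the kinetic energy is
        nonnegative, so the cut-off preserves the subsolution bound.\<close>
      also have "\<eta> t * frechet_derivative g (at ?z) (1, ?w) \<le> \<eta> t * ((1/2) * (norm ?w)\<^sup>2)"
        by (intro mult_left_mono HJ t \<eta>)
      also have "\<dots> \<le> 1 * ((1/2) * (norm ?w)\<^sup>2)"
        by (intro mult_right_mono \<eta>) auto
      finally show ?thesis by simp
    qed
    have CI: "set_integrable lborel {a..b} (\<lambda>t. LINT x|m t. h t x)"
      "AE t in lborel. t \<in> {a..b} \<longrightarrow> integrable (m t) (h t)"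
      using continuity_equation_integrable[OF AC less_imp_le[OF ab] \<alpha> \<phi>] by (simp_all add: h_def)
    have h0: "(LINT t:{a..b}|lborel. LINT x|m t. h t x) = 0"
      using CE \<phi> unfolding continuity_equation_def h_def by blast
    have Fc': "continuous_on {a..b} (\<lambda>t. deriv \<eta> t * ?F t)"
      by (intro continuous_intros Fc \<eta>'(2))
    have Fint: "set_integrable lborel {a..b} (\<lambda>t. deriv \<eta> t * ?F t)"
      by (rule borel_integrable_atLeastAtMost'[OF Fc'])
    have "AE t in lborel. t \<in> {a..b} \<longrightarrow> (LINT x|m t. h t x) \<le> deriv \<eta> t * ?F t + ?A t"
      using L(3) CI(2)
    proof eventually_elim
      case (elim t)
      show ?case
      proof
        assume t: "t \<in> {a..b}"
        have gi: "integrable (m t) (\<lambda>x. g (t, x))"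
          by (rule P2_integrable_bounded[OF AC_curve_P2[OF AC t] gm[OF t] gb[OF t]])
        have gi': "integrable (m t) (\<lambda>x. deriv \<eta> t * g (t, x))"
          using gi by simp
        have ai: "integrable (m t) (\<lambda>x. (1/2) * (norm (\<alpha> t x))\<^sup>2)" and hi: "integrable (m t) (h t)"
          using elim t by blast+
        have "(LINT x|m t. h t x) \<le> (LINT x|m t. deriv \<eta> t * g (t, x) + (1/2) * (norm (\<alpha> t x))\<^sup>2)"
          by (rule integral_mono[OF hi Bochner_Integration.integrable_add[OF gi' ai] hle[OF t]])
        also have "\<dots> = (LINT x|m t. deriv \<eta> t * g (t, x)) + ?A t"
          by (rule Bochner_Integration.integral_add[OF gi' ai])
        also have "(LINT x|m t. deriv \<eta> t * g (t, x)) = deriv \<eta> t * ?F t"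
          using gi by simp
        finally show "(LINT x|m t. h t x) \<le> deriv \<eta> t * ?F t + ?A t" .
      qed
    qed
    then have "(LINT t:{a..b}|lborel. LINT x|m t. h t x) \<le> (LINT t:{a..b}|lborel. deriv \<eta> t * ?F t + ?A t)"
      by (intro set_integral_mono_AE set_integral_add(1) CI(1) Fint L(4)) auto
    also have "\<dots> = (LINT t:{a..b}|lborel. deriv \<eta> t * ?F t) + (LINT t:{a..b}|lborel. ?A t)"
      by (rule set_integral_add(2)[OF Fint L(4)])
    also have "(LINT t:{a..b}|lborel. deriv \<eta> t * ?F t) = integral {a..b} (\<lambda>t. deriv \<eta> t * ?F t)"
      by (rule set_borel_integral_eq_integral(2)[OF Fint])
    also have "\<dots> = integral {a..c} (\<lambda>t. deriv \<eta> t * ?F t) + integral {c..b} (\<lambda>t. deriv \<eta> t * ?F t)"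
      by (rule Henstock_Kurzweil_Integration.integral_combine[symmetric])
         (use cab Fc' in \<open>auto intro: integrable_continuous_real\<close>)
    \<comment> \<open>\<open>deriv \<eta>\<close> is nonnegative here and lives on the ramp at
      \<open>a\<close>, where \<open>?F\<close> is below \<open>?F a + e / 2\<close>; its total mass
      is 1.\<close>
    also have "integral {a..c} (\<lambda>t. deriv \<eta> t * ?F t) \<le> integral {a..c} (\<lambda>t. deriv \<eta> t * (?F a + e / 2))"
    proof (rule integral_le)
      show "(\<lambda>t. deriv \<eta> t * ?F t) integrable_on {a..c}"
        using cab by (intro integrable_continuous_real continuous_on_subset[OF Fc']) auto
      show "(\<lambda>t. deriv \<eta> t * (?F a + e / 2)) integrable_on {a..c}"
        by (intro integrable_continuous_real continuous_intros \<eta>'(2))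
      fix t assume t: "t \<in> {a..c}"
      show "deriv \<eta> t * ?F t \<le> deriv \<eta> t * (?F a + e / 2)"
      proof (cases "t < a + 2 * \<delta>")
        case True
        then have "\<bar>?F t - ?F a\<bar> < e / 2"
          using t cab \<delta>(3) by (intro d1(2)) auto
        then have "?F t \<le> ?F a + e / 2" by linarith
        then show ?thesis using \<eta>(7)[of t] t by (intro mult_left_mono) auto
      next
        case False
        then show ?thesis using \<eta>(9)[of t] t \<delta>(2) by (auto simp: c_def field_simps)
      qed
    qed
    also have "\<dots> = (?F a + e / 2) * (\<eta> c - \<eta> a)"
    proof -
      have "((\<lambda>t. deriv \<eta> t) has_integral (\<eta> c - \<eta> a)) {a..c}"
        using \<eta>'(1) cab by (intro fundamental_theorem_of_calculus)
          (auto simp: has_real_derivative_iff_has_vector_derivative[symmetric] intro: has_field_derivative_at_within)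
      from integral_unique[OF has_integral_mult_left[OF this, of "?F a + e / 2"]] show ?thesis
        by (simp only: mult.commute)
    qed
    \<comment> \<open>On the falling half \<open>deriv \<eta>\<close> is nonpositive, so it takes a
      lower bound of \<open>?F\<close> to bound the product from above.\<close>
    also have "integral {c..b} (\<lambda>t. deriv \<eta> t * ?F t) \<le> integral {c..b} (\<lambda>t. deriv \<eta> t * (?F b - e / 2))"
    proof (rule integral_le)
      show "(\<lambda>t. deriv \<eta> t * ?F t) integrable_on {c..b}"
        using cab by (intro integrable_continuous_real continuous_on_subset[OF Fc']) auto
      show "(\<lambda>t. deriv \<eta> t * (?F b - e / 2)) integrable_on {c..b}"
        by (intro integrable_continuous_real continuous_intros \<eta>'(2))
      fix t assume t: "t \<in> {c..b}"
      show "deriv \<eta> t * ?F t \<le> deriv \<eta> t * (?F b - e / 2)"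
      proof (cases "t > b - 2 * \<delta>")
        case True
        then have "\<bar>?F t - ?F b\<bar> < e / 2"
          using t cab \<delta>(4) by (intro d2(2)) auto
        then have "?F t \<ge> ?F b - e / 2" by linarith
        then show ?thesis using \<eta>(8)[of t] t by (intro mult_left_mono_neg) auto
      next
        case False
        then show ?thesis using \<eta>(9)[of t] t \<delta>(2) by (auto simp: c_def field_simps)
      qed
    qed
    also have "\<dots> = (?F b - e / 2) * (\<eta> b - \<eta> c)"
    proof -
      have "((\<lambda>t. deriv \<eta> t) has_integral (\<eta> b - \<eta> c)) {c..b}"
        using \<eta>'(1) cab by (intro fundamental_theorem_of_calculus)
          (auto simp: has_real_derivative_iff_has_vector_derivative[symmetric] intro: has_field_derivative_at_within)
      from integral_unique[OF has_integral_mult_left[OF this, of "?F b - e / 2"]] show ?thesis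
        by (simp only: mult.commute)
    qed
    finally have "0 \<le> (?F a + e / 2) * (\<eta> c - \<eta> a) + (?F b - e / 2) * (\<eta> b - \<eta> c) + (LINT t:{a..b}|lborel. ?A t)"
      unfolding h0 by simp
    then show ?thesis
      using \<eta>(4)[of a] \<eta>(5)[of b] \<eta>(6) \<delta>(1) by simp
  qed
  then show ?thesis
    using field_le_epsilon by blast
qed

section \<open>Soft maxima and entropic duality\<close>

text \<open>Log-sum-exp at inverse temperature \<open>\<beta>\<close>; its gradient in
  \<open>a\<close> is the Gibbs vector \<open>softw\<close>.\<close>

definition smax :: "real \<Rightarrow> nat \<Rightarrow> (nat \<Rightarrow> real) \<Rightarrow> real" where
  "smax \<beta> N a = ln (\<Sum>i<N. exp (\<beta> * a i)) / \<beta>"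

definition softw :: "real \<Rightarrow> nat \<Rightarrow> (nat \<Rightarrow> real) \<Rightarrow> nat \<Rightarrow> real" where
  "softw \<beta> N a i = exp (\<beta> * a i) / (\<Sum>j<N. exp (\<beta> * a j))"

lemma sum_exp_pos: "N \<ge> 1 \<Longrightarrow> (\<Sum>i<N. exp (f i :: real)) > 0" for N :: nat
  by (rule sum_pos) (auto simp: lessThan_empty_iff)

lemma softw_pos: "N \<ge> 1 \<Longrightarrow> softw \<beta> N a i > 0"
  using sum_exp_pos[of N "\<lambda>i. \<beta> * a i"] by (simp add: softw_def)

lemma softw_sum: "N \<ge> 1 \<Longrightarrow> (\<Sum>i<N. softw \<beta> N a i) = 1"
  using sum_exp_pos[of N "\<lambda>i. \<beta> * a i"] by (simp add: softw_def flip: sum_divide_distrib)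

lemma softw_le_1: "N \<ge> 1 \<Longrightarrow> i < N \<Longrightarrow> softw \<beta> N a i \<le> 1"
  using member_le_sum[of i "{..<N}" "softw \<beta> N a"] softw_sum[of N \<beta> a] less_imp_le[OF softw_pos[of N \<beta> a]]
  by auto

lemma smax_ge:
  assumes "\<beta> > 0" "i < N"
  shows "a i \<le> smax \<beta> N a"
proof -
  have "exp (\<beta> * a i) \<le> (\<Sum>j<N. exp (\<beta> * a j))"
    using assms by (intro member_le_sum) auto
  then have "\<beta> * a i \<le> ln (\<Sum>j<N. exp (\<beta> * a j))"
    using sum_exp_pos[of N "\<lambda>i. \<beta> * a i"] assms by (subst ln_ge_iff) auto
  then show ?thesis
    using assms by (simp add: smax_def field_simps)
qed

lemma smax_le:
  assumes "\<beta> > 0" "N \<ge> 1" "\<And>i. i < N \<Longrightarrow> a i \<le> A"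
  shows "smax \<beta> N a \<le> A + ln N / \<beta>"
proof -
  have "(\<Sum>j<N. exp (\<beta> * a j)) \<le> (\<Sum>j<N. exp (\<beta> * A))"
    using assms by (intro sum_mono) auto
  then have "ln (\<Sum>j<N. exp (\<beta> * a j)) \<le> ln (real N * exp (\<beta> * A))"
    using sum_exp_pos[OF assms(2)] assms(2) by (subst ln_le_cancel_iff) auto
  also have "\<dots> = ln N + \<beta> * A"
    using assms(2) by (subst ln_mult) auto
  finally show ?thesis
    using assms(1) by (simp add: smax_def field_simps)
qed

lemma smax_eq_softw:
  assumes "\<beta> > 0" "N \<ge> 1"
  shows "smax \<beta> N a - a i = - ln (softw \<beta> N a i) / \<beta>"
  using assms sum_exp_pos[OF assms(2), of "\<lambda>i. \<beta> * a i"]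
  by (simp add: smax_def softw_def ln_div field_simps)

lemma smax_mono:
  assumes "\<beta> > 0" "N \<ge> 1" "\<And>i. i < N \<Longrightarrow> a i \<le> b i"
  shows "smax \<beta> N a \<le> smax \<beta> N b"
proof -
  have "(\<Sum>j<N. exp (\<beta> * a j)) \<le> (\<Sum>j<N. exp (\<beta> * b j))"
    using assms by (intro sum_mono) auto
  then show ?thesis
    using sum_exp_pos[OF assms(2)] assms(1) by (auto simp: smax_def intro!: divide_right_mono)
qed

lemma smax_add_const:
  assumes "\<beta> > 0" "N \<ge> 1"
  shows "smax \<beta> N (\<lambda>i. a i + r) = smax \<beta> N a + r"
proof -
  have "(\<Sum>i<N. exp (\<beta> * (a i + r))) = (\<Sum>i<N. exp (\<beta> * a i)) * exp (\<beta> * r)"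
    by (simp add: distrib_left exp_add sum_distrib_right)
  then have "ln (\<Sum>i<N. exp (\<beta> * (a i + r))) = ln (\<Sum>i<N. exp (\<beta> * a i)) + \<beta> * r"
    using sum_exp_pos[OF assms(2), of "\<lambda>i. \<beta> * a i"] by (simp add: ln_mult)
  then show ?thesis using assms(1) by (simp add: smax_def field_simps)
qed

text \<open>The error is the entropy of the weights.\<close>

lemma smax_le_softw_sum:
  assumes "\<beta> > 0" "N \<ge> 1"
  shows "smax \<beta> N a \<le> (\<Sum>i<N. softw \<beta> N a i * a i) + ln N / \<beta>"
proof -
  let ?w = "softw \<beta> N a"
  have w: "?w i > 0" for i using softw_pos[OF assms(2)] .
  have "smax \<beta> N a - (\<Sum>i<N. ?w i * a i) = (\<Sum>i<N. ?w i * (smax \<beta> N a - a i))"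
    by (simp add: right_diff_distrib sum_subtractf softw_sum[OF assms(2)] flip: sum_distrib_right)
  also have "\<dots> = (\<Sum>i<N. ?w i * (- ln (?w i))) / \<beta>"
    by (simp add: smax_eq_softw[OF assms] sum_divide_distrib)
  \<comment> \<open>The bound \<open>ln z \<le> z - 1\<close> at \<open>z = 1 / (N * ?w i)\<close>,
    that is, nonnegativity of the entropy relative to uniform weights; the corrections
    \<open>1 / N - ?w i\<close> sum to 0.\<close>
  also have "(\<Sum>i<N. ?w i * (- ln (?w i))) \<le> (\<Sum>i<N. ?w i * ln N + (1 / N - ?w i))"
  proof (rule sum_mono)
    fix i
    have "ln (1 / (N * ?w i)) \<le> 1 / (N * ?w i) - 1"
      using w[of i] assms(2) by (intro ln_le_minus_one) auto
    then have "- ln (?w i) \<le> ln N + (1 / (N * ?w i) - 1)"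
      using w[of i] assms(2) by (simp add: ln_div ln_mult)
    then have "?w i * (- ln (?w i)) \<le> ?w i * (ln N + (1 / (N * ?w i) - 1))"
      using w[of i] by (intro mult_left_mono) auto
    also have "\<dots> = ?w i * ln N + (1 / N - ?w i)"
      using w[of i] assms(2) by (simp add: field_simps)
    finally show "?w i * (- ln (?w i)) \<le> ?w i * ln N + (1 / N - ?w i)" .
  qed
  also have "\<dots> = ln N"
    using assms(2) by (simp add: sum.distrib sum_subtractf softw_sum[OF assms(2)] flip: sum_distrib_right)
  finally show ?thesis
    using assms(1) by (simp add: divide_right_mono)
qed

lemma smax_abs_le:
  assumes "\<beta> > 0" "N \<ge> 1"
  shows "\<bar>smax \<beta> N a\<bar> \<le> (\<Sum>i<N. \<bar>a i\<bar>) + ln N / \<beta>"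
proof -
  have a: "\<bar>a i\<bar> \<le> (\<Sum>i<N. \<bar>a i\<bar>)" if "i < N" for i
    using that by (intro member_le_sum) auto
  have "smax \<beta> N a \<le> (\<Sum>i<N. \<bar>a i\<bar>) + ln N / \<beta>"
    using a by (intro smax_le assms) (auto simp: abs_le_iff)
  moreover have "- (\<Sum>i<N. \<bar>a i\<bar>) \<le> smax \<beta> N a"
    using smax_ge[OF assms(1), of 0 N a] a[of 0] assms(2) by linarith
  moreover have "ln N / \<beta> \<ge> 0" using assms by simp
  ultimately show ?thesis by linarith
qed

lemma smax_lipschitz:
  assumes "\<beta> > 0" "N \<ge> 1"
  shows "smax \<beta> N a \<le> smax \<beta> N b + (\<Sum>i<N. \<bar>a i - b i\<bar>)"
proof -
  have "a i \<le> b i + (\<Sum>i<N. \<bar>a i - b i\<bar>)" if "i < N" for i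
    using member_le_sum[of i "{..<N}" "\<lambda>i. \<bar>a i - b i\<bar>"] that by auto
  then have "smax \<beta> N a \<le> smax \<beta> N (\<lambda>i. b i + (\<Sum>i<N. \<bar>a i - b i\<bar>))"
    by (intro smax_mono assms)
  then show ?thesis by (simp add: smax_add_const[OF assms])
qed

text \<open>The sum of exponentials is multiplied by exactly \<open>1 + ?z\<close>, and
  \<open>ln (1 + z) \<le> z\<close> makes the increment linear in the weight. Such a bound can be
  integrated as it stands, so the first order condition below is found without differentiating under
  the integral.\<close>

lemma smax_update_le:
  assumes "\<beta> > 0" "N \<ge> 1" "i < N"
  shows "smax \<beta> N (a(i := a i + h)) \<le> smax \<beta> N a + softw \<beta> N a i * ((exp (\<beta> * h) - 1) / \<beta>)"
proof -
  let ?S = "\<Sum>j<N. exp (\<beta> * a j)" and ?z = "softw \<beta> N a i * (exp (\<beta> * h) - 1)"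
  have S: "?S > 0" by (rule sum_exp_pos[OF assms(2)])
  have "(\<Sum>j<N. exp (\<beta> * (a(i := a i + h)) j)) - ?S
      = (\<Sum>j<N. if j = i then exp (\<beta> * a i) * (exp (\<beta> * h) - 1) else 0)"
    unfolding sum_subtractf[symmetric]
    by (intro sum.cong) (auto simp: distrib_left exp_add algebra_simps)
  also have "\<dots> = ?S * ?z"
    using assms(3) S by (simp add: softw_def)
  finally have eq: "(\<Sum>j<N. exp (\<beta> * (a(i := a i + h)) j)) = ?S * (1 + ?z)"
    by (simp add: algebra_simps)
  then have pos: "1 + ?z > 0"
    using sum_exp_pos[OF assms(2), of "\<lambda>j. \<beta> * (a(i := a i + h)) j"] S by (simp add: zero_less_mult_iff)
  have "ln (?S * (1 + ?z)) = ln ?S + ln (1 + ?z)"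
    using S pos by (simp add: ln_mult)
  also have "\<dots> \<le> ln ?S + ?z"
    using ln_le_minus_one[OF pos] by simp
  finally show ?thesis
    using assms(1) unfolding smax_def eq by (simp add: field_simps)
qed

text \<open>The weights of an optimal dual potential split the measure into \<open>N\<close> equal parts: this is the
  first order condition for the concave dual functional.\<close>

lemma entropic_potential:
  fixes c :: "nat \<Rightarrow> 'a \<Rightarrow> real"
  assumes \<nu>: "prob_space \<nu>" and c: "\<And>i. i < N \<Longrightarrow> integrable \<nu> (c i)" and N: "N \<ge> 1" and \<beta>: "\<beta> > 0"
  shows "\<exists>\<psi>. (\<forall>i<N. (LINT y|\<nu>. softw \<beta> N (\<lambda>i. \<psi> i - c i y) i) = 1 / N) \<and>
    (\<Sum>i<N. LINT y|\<nu>. softw \<beta> N (\<lambda>i. \<psi> i - c i y) i * c i y)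
       \<le> (\<Sum>i<N. \<psi> i) / N - (LINT y|\<nu>. smax \<beta> N (\<lambda>i. \<psi> i - c i y)) + ln N / \<beta>"
proof -
  interpret prob_space \<nu> by fact
  define D where "D \<psi> = (\<Sum>i<N. \<psi> i) / N - (LINT y|\<nu>. smax \<beta> N (\<lambda>i. \<psi> i - c i y))" for \<psi> :: "nat \<Rightarrow> real"
  note [measurable] = borel_measurable_integrable[OF c]
  have sm: "(\<lambda>y. smax \<beta> N (\<lambda>i. \<psi> i - c i y)) \<in> borel_measurable \<nu>" for \<psi>
    unfolding smax_def by measurable
  have si: "integrable \<nu> (\<lambda>y. smax \<beta> N (\<lambda>i. \<psi> i - c i y))" for \<psi>
  proof (rule Bochner_Integration.integrable_bound)
    show "integrable \<nu> (\<lambda>y. (\<Sum>i<N. \<bar>\<psi> i - c i y\<bar>) + ln N / \<beta>)"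
      by (intro Bochner_Integration.integrable_add integrable_const Bochner_Integration.integrable_sum
          integrable_abs Bochner_Integration.integrable_diff) (use c in auto)
    have "ln N / \<beta> \<ge> 0" "(\<Sum>i<N. \<bar>\<psi> i - c i y\<bar>) \<ge> 0" for y
      using N \<beta> by (auto intro: sum_nonneg)
    then show "AE y in \<nu>. norm (smax \<beta> N (\<lambda>i. \<psi> i - c i y)) \<le> norm ((\<Sum>i<N. \<bar>\<psi> i - c i y\<bar>) + ln N / \<beta>)"
      using smax_abs_le[OF \<beta> N, of "\<lambda>i. \<psi> i - c i y" for y] by (intro AE_I2) fastforce
  qed (rule sm)
  \<comment> \<open>Adding a constant to the potential leaves \<open>D\<close> unchanged, so the
    largest of the first \<open>N\<close> values can be normalised to 0.\<close>
  have D_shift: "D (\<lambda>i. \<psi> i + r) = D \<psi>" for \<psi> r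
  proof -
    have "smax \<beta> N (\<lambda>i. \<psi> i + r - c i y) = smax \<beta> N (\<lambda>i. \<psi> i - c i y) + r" for y
      using smax_add_const[OF \<beta> N, of "\<lambda>i. \<psi> i - c i y" r] by (simp add: algebra_simps)
    then show ?thesis
      using N si[of \<psi>] by (simp add: D_def prob_space sum.distrib field_simps)
  qed
  have D_lip: "D \<psi> \<le> D \<psi>' + 2 * (\<Sum>i<N. \<bar>\<psi> i - \<psi>' i\<bar>)" for \<psi> \<psi>'
  proof -
    let ?s = "\<Sum>i<N. \<bar>\<psi> i - \<psi>' i\<bar>"
    have "(LINT y|\<nu>. smax \<beta> N (\<lambda>i. \<psi>' i - c i y)) \<le> (LINT y|\<nu>. smax \<beta> N (\<lambda>i. \<psi> i - c i y) + ?s)"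
    proof (intro integral_mono si Bochner_Integration.integrable_add integrable_const)
      fix y
      show "smax \<beta> N (\<lambda>i. \<psi>' i - c i y) \<le> smax \<beta> N (\<lambda>i. \<psi> i - c i y) + ?s"
        using smax_lipschitz[OF \<beta> N, of "\<lambda>i. \<psi>' i - c i y" "\<lambda>i. \<psi> i - c i y"]
        by (simp add: abs_minus_commute)
    qed
    also have "\<dots> = (LINT y|\<nu>. smax \<beta> N (\<lambda>i. \<psi> i - c i y)) + ?s"
      using si by (simp add: prob_space)
    finally have 1: "(LINT y|\<nu>. smax \<beta> N (\<lambda>i. \<psi>' i - c i y)) \<le> (LINT y|\<nu>. smax \<beta> N (\<lambda>i. \<psi> i - c i y)) + ?s" .
    have "(\<Sum>i<N. \<psi> i) - (\<Sum>i<N. \<psi>' i) \<le> ?s"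
      unfolding sum_subtractf[symmetric] by (intro sum_mono) auto
    then have "((\<Sum>i<N. \<psi> i) - (\<Sum>i<N. \<psi>' i)) / N \<le> ?s / N"
      using N by (intro divide_right_mono) auto
    also have "?s / N \<le> ?s"
    proof -
      have "?s \<ge> 0" by (intro sum_nonneg) auto
      then have "?s * 1 \<le> ?s * N" using N by (intro mult_left_mono) auto
      then show ?thesis using N by (simp add: field_simps)
    qed
    finally show ?thesis
      using 1 by (simp add: D_def diff_divide_distrib)
  qed
  \<comment> \<open>Coercivity: with largest value 0 attained at \<open>i0\<close>, the soft maximum
    is at least \<open>- \<bar>c i0 y\<bar>\<close>. So \<open>D \<psi>\<close> is at most the mean
    of \<open>\<psi>\<close> plus a constant, and doing as well as the zero potential bounds every
    value below by \<open>- (N * R)\<close>.\<close>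
  define R where "R = (\<Sum>i<N. LINT y|\<nu>. \<bar>c i y\<bar>) - D (\<lambda>_. 0)"
  have coer: "\<psi> i \<ge> - (N * R)" if "D \<psi> \<ge> D (\<lambda>_. 0)" "\<And>i. i < N \<Longrightarrow> \<psi> i \<le> 0" "\<psi> i0 = 0" "i0 < N" "i < N" for \<psi> i0 i
  proof -
    have "- (\<Sum>i<N. LINT y|\<nu>. \<bar>c i y\<bar>) \<le> - (LINT y|\<nu>. \<bar>c i0 y\<bar>)"
      using member_le_sum[of i0 "{..<N}" "\<lambda>i. LINT y|\<nu>. \<bar>c i y\<bar>"] that by auto
    also have "\<dots> = (LINT y|\<nu>. - \<bar>c i0 y\<bar>)" by simp
    also have "\<dots> \<le> (LINT y|\<nu>. smax \<beta> N (\<lambda>i. \<psi> i - c i y))"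
    proof (intro integral_mono si)
      show "integrable \<nu> (\<lambda>y. - \<bar>c i0 y\<bar>)" using c[OF that(4)] by auto
      show "- \<bar>c i0 y\<bar> \<le> smax \<beta> N (\<lambda>i. \<psi> i - c i y)" for y
        using smax_ge[OF \<beta> that(4), of "\<lambda>i. \<psi> i - c i y"] that(3) by linarith
    qed
    finally have "D \<psi> \<le> (\<Sum>i<N. \<psi> i) / N + (\<Sum>i<N. LINT y|\<nu>. \<bar>c i y\<bar>)"
      by (simp add: D_def)
    then have "- R \<le> (\<Sum>i<N. \<psi> i) / N" using that(1) by (simp add: R_def)
    then have "- (N * R) \<le> (\<Sum>i<N. \<psi> i)" using N by (simp add: field_simps)
    also have "\<dots> = \<psi> i + (\<Sum>j\<in>{..<N} - {i}. \<psi> j)"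
      using that(5) by (simp add: sum.remove)
    also have "\<dots> \<le> \<psi> i" using that(2) sum_nonpos[of "{..<N} - {i}" \<psi>] by auto
    finally show ?thesis .
  qed
  \<comment> \<open>Compact by Tychonoff: the coordinates from \<open>N\<close> on, which do not
    enter \<open>D\<close>, are pinned to 0, and \<open>max R 0\<close> keeps the intervals
    nonempty.\<close>
  define X where "X = PiE UNIV (\<lambda>i :: nat. if i < N then {- (N * max R 0)..0 :: real} else {0})"
  have "compactin (product_topology (\<lambda>_. euclidean) UNIV) X"
    unfolding X_def compactin_PiE by auto
  then have X: "compact X"
    by (simp add: euclidean_product_topology)
  have Dc: "continuous_on X D"
  proof (rule continuous_on_subset[of UNIV])
    show "continuous_on UNIV D"
      unfolding continuous_on_def
    proof
      fix \<psi> :: "nat \<Rightarrow> real"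
      have proj: "((\<lambda>\<psi>'. \<psi>' i) \<longlongrightarrow> \<psi> i) (at \<psi>)" for i
        using continuous_on_product_coordinates[of i, where 'b = real] unfolding continuous_on_def by blast
      have "((\<lambda>\<psi>'. 2 * (\<Sum>i<N. \<bar>\<psi>' i - \<psi> i\<bar>)) \<longlongrightarrow> 2 * (\<Sum>i<N. \<bar>\<psi> i - \<psi> i\<bar>)) (at \<psi>)"
        by (intro tendsto_intros proj)
      then have lim: "((\<lambda>\<psi>'. 2 * (\<Sum>i<N. \<bar>\<psi>' i - \<psi> i\<bar>)) \<longlongrightarrow> 0) (at \<psi>)" by simp
      have "((\<lambda>\<psi>'. D \<psi>' - D \<psi>) \<longlongrightarrow> 0) (at \<psi>)"
      proof (rule Lim_null_comparison[OF _ lim], rule always_eventually, rule allI)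
        fix \<psi>'
        show "norm (D \<psi>' - D \<psi>) \<le> 2 * (\<Sum>i<N. \<bar>\<psi>' i - \<psi> i\<bar>)"
          using D_lip[of \<psi>' \<psi>] D_lip[of \<psi> \<psi>'] by (simp add: abs_minus_commute abs_le_iff)
      qed
      then show "(D \<longlongrightarrow> D \<psi>) (at \<psi> within UNIV)"
        by (simp add: Lim_null[of D])
    qed
  qed auto
  have "(\<lambda>_. 0) \<in> X" by (auto simp: X_def)
  then obtain \<psi> where \<psi>: "\<psi> \<in> X" "\<And>\<psi>'. \<psi>' \<in> X \<Longrightarrow> D \<psi>' \<le> D \<psi>"
    using continuous_attains_sup[OF X _ Dc] by auto
  have max: "D \<psi>' \<le> D \<psi>" for \<psi>'
  proof (cases "D \<psi>' \<ge> D (\<lambda>_. 0)")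
    case True
    define M where "M = Max (\<psi>' ` {..<N})"
    have fin: "finite (\<psi>' ` {..<N})" "\<psi>' ` {..<N} \<noteq> {}" using N by (auto simp: lessThan_empty_iff)
    obtain i0 where i0: "i0 < N" "\<psi>' i0 = M"
      using Max_in[OF fin] by (auto simp: M_def)
    have le: "\<psi>' i \<le> M" if "i < N" for i
      using Max_ge[OF fin(1)] that by (auto simp: M_def)
    define \<xi> where "\<xi> i = (if i < N then \<psi>' i + (- M) else 0)" for i
    have D\<xi>: "D \<xi> = D \<psi>'"
    proof -
      have "D \<xi> = D (\<lambda>i. \<psi>' i + (- M))"
        by (simp add: D_def \<xi>_def smax_def)
      also have "\<dots> = D \<psi>'" by (rule D_shift)
      finally show ?thesis .
    qed
    have "- (N * max R 0) \<le> \<xi> i" if "i < N" for i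
    proof -
      have "- (N * max R 0) \<le> - (N * R)" by (simp add: mult_left_mono)
      also have "\<dots> \<le> \<xi> i"
        by (rule coer[of \<xi> i0]) (use True D\<xi> le i0 that in \<open>auto simp: \<xi>_def\<close>)
      finally show ?thesis .
    qed
    moreover have "\<xi> i \<le> 0" if "i < N" for i
      using le that by (simp add: \<xi>_def)
    moreover have "\<xi> i = 0" if "\<not> i < N" for i
      using that by (simp add: \<xi>_def)
    ultimately have "\<xi> \<in> X"
      by (auto simp: X_def PiE_iff extensional_def)
    from \<psi>(2)[OF this] show ?thesis by (simp add: D\<xi>)
  next
    case False
    with \<psi>(2)[OF \<open>(\<lambda>_. 0) \<in> X\<close>] show ?thesis by linarith
  qed
  let ?w = "\<lambda>i y. softw \<beta> N (\<lambda>i. \<psi> i - c i y) i"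
  have wm: "?w i \<in> borel_measurable \<nu>" if "i < N" for i
    unfolding softw_def using that by measurable
  have wb: "\<bar>?w i y\<bar> \<le> 1" if "i < N" for i y
    using softw_le_1[OF N that] less_imp_le[OF softw_pos[OF N]] by auto
  have wi: "integrable \<nu> (?w i)" if "i < N" for i
    by (rule integrable_const_bound[of _ 1]) (use wb wm that in auto)
  have wci: "integrable \<nu> (\<lambda>y. ?w i y * c i y)" if "i < N" for i
  proof (rule Bochner_Integration.integrable_bound[OF c[OF that]])
    show "(\<lambda>y. ?w i y * c i y) \<in> borel_measurable \<nu>"
      using wm[OF that] borel_measurable_integrable[OF c[OF that]] by (rule borel_measurable_times)
    show "AE y in \<nu>. norm (?w i y * c i y) \<le> norm (c i y)"
      using wb[OF that] by (intro AE_I2) (simp add: abs_mult mult_left_le_one_le)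
  qed
  have q: "(LINT y|\<nu>. ?w i y) = 1 / N" if i: "i < N" for i
  proof -
    define q where "q = (LINT y|\<nu>. ?w i y)"
    \<comment> \<open>Moving one coordinate by \<open>h\<close> cannot increase \<open>D\<close>.
      The right-hand side is therefore a nonnegative function of \<open>h\<close> that vanishes at
      0, and its derivative there, \<open>q - 1 / N\<close>, must be 0.\<close>
    have key: "0 \<le> q * ((exp (\<beta> * h) - 1) / \<beta>) - h / N" for h
    proof -
      let ?\<psi> = "\<psi>(i := \<psi> i + h)"
      have eq: "(\<lambda>j. ?\<psi> j - c j y) = (\<lambda>j. \<psi> j - c j y)(i := (\<psi> i - c i y) + h)" for y
        by auto
      have "(LINT y|\<nu>. smax \<beta> N (\<lambda>j. ?\<psi> j - c j y)) \<le>
          (LINT y|\<nu>. smax \<beta> N (\<lambda>j. \<psi> j - c j y) + ?w i y * ((exp (\<beta> * h) - 1) / \<beta>))"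
      proof (intro integral_mono si Bochner_Integration.integrable_add integrable_mult_left wi i)
        fix y
        show "smax \<beta> N (\<lambda>j. ?\<psi> j - c j y) \<le> smax \<beta> N (\<lambda>j. \<psi> j - c j y) + ?w i y * ((exp (\<beta> * h) - 1) / \<beta>)"
          unfolding eq by (rule smax_update_le[OF \<beta> N i])
      qed
      also have "\<dots> = (LINT y|\<nu>. smax \<beta> N (\<lambda>j. \<psi> j - c j y)) + q * ((exp (\<beta> * h) - 1) / \<beta>)"
        using si wi[OF i] by (subst Bochner_Integration.integral_add) (auto simp: q_def)
      finally have 1: "(LINT y|\<nu>. smax \<beta> N (\<lambda>j. ?\<psi> j - c j y)) \<le>
          (LINT y|\<nu>. smax \<beta> N (\<lambda>j. \<psi> j - c j y)) + q * ((exp (\<beta> * h) - 1) / \<beta>)" .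
      have "(\<Sum>j<N. ?\<psi> j) = (\<Sum>j<N. \<psi> j) + h"
        using i by (subst (1 2) sum.remove[of _ i]) auto
      then have "(\<Sum>j<N. ?\<psi> j) / N = (\<Sum>j<N. \<psi> j) / N + h / N"
        by (simp add: add_divide_distrib)
      then show ?thesis
        using max[of ?\<psi>] 1 by (simp add: D_def)
    qed
    have "((\<lambda>h. q * ((exp (\<beta> * h) - 1) / \<beta>) - h / N) has_real_derivative q - 1 / N) (at 0)"
      using \<beta> N by (auto intro!: derivative_eq_intros)
    from DERIV_local_min[OF this, of 1] key have "q - 1 / N = 0" by simp
    then show ?thesis
      by (simp add: q_def)
  qed
  \<comment> \<open>The entropy bound, integrated: as every weight has mass \<open>1 / N\<close>,
    the terms with \<open>\<psi>\<close> give the mean of \<open>\<psi>\<close>.\<close>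
  have "(LINT y|\<nu>. smax \<beta> N (\<lambda>i. \<psi> i - c i y)) \<le> (LINT y|\<nu>. (\<Sum>i<N. ?w i y * \<psi> i - ?w i y * c i y) + ln N / \<beta>)"
  proof (rule integral_mono[OF si])
    show "integrable \<nu> (\<lambda>y. (\<Sum>i<N. ?w i y * \<psi> i - ?w i y * c i y) + ln N / \<beta>)"
      by (intro Bochner_Integration.integrable_add integrable_const Bochner_Integration.integrable_sum
          Bochner_Integration.integrable_diff wci integrable_mult_left wi) auto
    show "smax \<beta> N (\<lambda>i. \<psi> i - c i y) \<le> (\<Sum>i<N. ?w i y * \<psi> i - ?w i y * c i y) + ln N / \<beta>" for y
      using smax_le_softw_sum[OF \<beta> N, of "\<lambda>i. \<psi> i - c i y"] by (simp only: right_diff_distrib)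
  qed
  also have "\<dots> = (LINT y|\<nu>. (\<Sum>i<N. ?w i y * \<psi> i - ?w i y * c i y)) + ln N / \<beta>"
    by (subst Bochner_Integration.integral_add)
       (use wi wci in \<open>auto simp: prob_space intro!: Bochner_Integration.integrable_sum\<close>)
  also have "(LINT y|\<nu>. (\<Sum>i<N. ?w i y * \<psi> i - ?w i y * c i y)) = (\<Sum>i<N. LINT y|\<nu>. ?w i y * \<psi> i - ?w i y * c i y)"
    by (rule Bochner_Integration.integral_sum) (use wi wci in auto)
  also have "\<dots> = (\<Sum>i<N. \<psi> i / N - (LINT y|\<nu>. ?w i y * c i y))"
    by (rule sum.cong) (use wi wci q in auto)
  also have "\<dots> = (\<Sum>i<N. \<psi> i) / N - (\<Sum>i<N. LINT y|\<nu>. ?w i y * c i y)"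
    by (simp add: sum_subtractf sum_divide_distrib)
  finally show ?thesis
    by (intro exI[of _ \<psi>] conjI allI impI q) auto
qed

section \<open>The dual bound\<close>

lemma smax_has_derivative:
  assumes "\<And>i. i < N \<Longrightarrow> (a i has_derivative a' i) (at z)" "N \<ge> 1" "\<beta> > 0"
  shows "((\<lambda>z. smax \<beta> N (\<lambda>i. a i z)) has_derivative
           (\<lambda>v. \<Sum>i<N. softw \<beta> N (\<lambda>i. a i z) i * a' i v)) (at z)"
proof -
  let ?S = "\<lambda>z. \<Sum>i<N. exp (\<beta> * a i z)"
  have S: "?S z > 0" by (rule sum_exp_pos[OF assms(2)])
  have "((\<lambda>z. exp (\<beta> * a i z)) has_derivative (\<lambda>v. exp (\<beta> * a i z) * (\<beta> * a' i v))) (at z)" if "i < N" for i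
    by (rule has_derivative_eq_rhs[OF has_derivative_exp[OF has_derivative_mult_right[OF assms(1)[OF that]]]])
       (simp add: mult.commute)
  then have "(?S has_derivative (\<lambda>v. \<Sum>i<N. exp (\<beta> * a i z) * (\<beta> * a' i v))) (at z)"
    by (intro has_derivative_sum) auto
  moreover have "(ln has_derivative (*) (1 / ?S z)) (at (?S z))"
    using DERIV_ln_divide[OF S] by (simp add: has_field_derivative_def)
  ultimately have "((\<lambda>z. ln (?S z)) has_derivative
      (\<lambda>v. (1 / ?S z) * (\<Sum>i<N. exp (\<beta> * a i z) * (\<beta> * a' i v)))) (at z)"
    by (rule has_derivative_compose)
  then have "((\<lambda>z. (1 / \<beta>) * ln (?S z)) has_derivative
      (\<lambda>v. (1 / \<beta>) * ((1 / ?S z) * (\<Sum>i<N. exp (\<beta> * a i z) * (\<beta> * a' i v))))) (at z)"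
    by (rule has_derivative_mult_right)
  then have "((\<lambda>z. smax \<beta> N (\<lambda>i. a i z)) has_derivative
      (\<lambda>v. (1 / \<beta>) * ((1 / ?S z) * (\<Sum>i<N. exp (\<beta> * a i z) * (\<beta> * a' i v))))) (at z)"
    by (simp add: smax_def)
  then show ?thesis
  proof (rule has_derivative_eq_rhs, intro ext)
    fix v
    show "(1 / \<beta>) * ((1 / ?S z) * (\<Sum>i<N. exp (\<beta> * a i z) * (\<beta> * a' i v))) =
        (\<Sum>i<N. softw \<beta> N (\<lambda>i. a i z) i * a' i v)"
      unfolding sum_distrib_left using assms(3) by (intro sum.cong) (auto simp: softw_def)
  qed
qed

lemma Ck_on_smax:
  assumes "open S" "N \<ge> 1" "\<And>i. i < N \<Longrightarrow> Ck_on k S (a i)"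
  shows "Ck_on k S (\<lambda>z. smax \<beta> N (\<lambda>i. a i z))"
proof -
  have "Ck_on k S (\<lambda>z. \<Sum>i<N. exp (\<beta> * a i z))"
    by (intro Ck_on_sum assms(1) Ck_on_compose[OF assms(1) open_UNIV _ Ck_on_exp] Ck_on_mult Ck_on_const)
       (use assms(3) in auto)
  then have "Ck_on k S (\<lambda>z. ln (\<Sum>i<N. exp (\<beta> * a i z)) * (1 / \<beta>))"
    using sum_exp_pos[OF assms(2)]
    by (intro Ck_on_mult Ck_on_const assms(1) Ck_on_compose[OF assms(1) _ _ Ck_on_ln]) auto
  then show ?thesis by (simp add: smax_def)
qed

text \<open>For positive \<open>\<kappa>\<close> and \<open>u\<close> this is
  \<open>u * exp (- (\<kappa> / u))\<close>, a smooth substitute for the positive part. It vanishes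
  exactly on the nonpositive half-line, which will give compact support; its slope stays between 0
  and 1, which preserves subsolutions; and it loses at most \<open>\<kappa>\<close>.\<close>

definition softpos :: "real \<Rightarrow> real \<Rightarrow> real" where
  "softpos \<kappa> u = u * expflat 0 (u / \<kappa>)"

lemma Ck_on_softpos: "Ck_on k UNIV (softpos \<kappa>)"
proof -
  have "Ck_on k UNIV (\<lambda>u :: real. u * (1 / \<kappa>))"
    by (intro Ck_on_linear bounded_linear_mult_left) auto
  then have "Ck_on k UNIV (\<lambda>u. expflat 0 (u * (1 / \<kappa>)))"
    by (intro Ck_on_compose[OF open_UNIV open_UNIV _ Ck_on_expflat]) auto
  then have "Ck_on k UNIV (\<lambda>u. u * expflat 0 (u * (1 / \<kappa>)))"
    by (rule Ck_on_mult[OF open_UNIV Ck_on_linear[OF open_UNIV bounded_linear_ident]])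
  then show ?thesis by (simp add: softpos_def[abs_def])
qed

lemma softpos_nonpos: "\<kappa> > 0 \<Longrightarrow> u \<le> 0 \<Longrightarrow> softpos \<kappa> u = 0"
  by (simp add: softpos_def expflat_def divide_nonpos_pos not_less zero_less_divide_iff)

lemma softpos_nonneg: "\<kappa> > 0 \<Longrightarrow> softpos \<kappa> u \<ge> 0"
  by (cases "u \<le> 0") (auto simp: softpos_nonpos, simp add: softpos_def expflat_nonneg)

lemma softpos_le: "\<kappa> > 0 \<Longrightarrow> softpos \<kappa> u \<le> max u 0"
proof (cases "u \<le> 0")
  case False
  assume "\<kappa> > 0"
  then have "u * exp (- (\<kappa> / u)) \<le> u * 1"
    using False by (intro mult_left_mono) auto
  then show ?thesis using False \<open>\<kappa> > 0\<close> by (simp add: softpos_def expflat_def)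
qed (simp add: softpos_nonpos)

lemma softpos_ge: "\<kappa> > 0 \<Longrightarrow> u - \<kappa> \<le> softpos \<kappa> u"
proof (cases "u \<le> 0")
  case False
  assume "\<kappa> > 0"
  have "u * (1 - \<kappa> / u) \<le> u * exp (- (\<kappa> / u))"
    using False exp_ge_add_one_self[of "- (\<kappa> / u)"] by (intro mult_left_mono) auto
  then show ?thesis using False \<open>\<kappa> > 0\<close> by (simp add: softpos_def expflat_def algebra_simps)
qed (simp add: softpos_nonpos)

lemma softpos_deriv:
  assumes "\<kappa> > 0"
  shows "\<exists>D. 0 \<le> D \<and> D \<le> 1 \<and> (softpos \<kappa> has_real_derivative D) (at u)"
proof -
  let ?z = "u / \<kappa>"
  have "(expflat 0 has_real_derivative expflat 2 ?z) (at ?z)"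
    using expflat_has_derivative[of 0 ?z] by (simp add: numeral_2_eq_2)
  then have "((\<lambda>u. expflat 0 (u / \<kappa>)) has_real_derivative expflat 2 ?z * (1 / \<kappa>)) (at u)"
    by (rule DERIV_chain2) (use assms in \<open>auto intro!: derivative_eq_intros\<close>)
  from DERIV_mult[OF DERIV_ident this]
  have D: "(softpos \<kappa> has_real_derivative expflat 0 ?z + ?z * expflat 2 ?z) (at u)"
    by (simp add: softpos_def[abs_def] mult.commute)
  \<comment> \<open>In \<open>x = \<kappa> / u\<close> the slope is
    \<open>(1 + x) * exp (- x)\<close>, at most 1 because \<open>1 + x \<le> exp x\<close>.\<close>
  have "expflat 0 ?z + ?z * expflat 2 ?z = (if u > 0 then (1 + 1 / ?z) * exp (- (1 / ?z)) else 0)"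
    using assms by (auto simp: expflat_def zero_less_divide_iff field_simps power2_eq_square)
  moreover have "0 \<le> (1 + x) * exp (- x) \<and> (1 + x) * exp (- x) \<le> 1" if "x \<ge> 0" for x :: real
    using exp_ge_add_one_self[of x] that by (simp add: exp_minus field_simps)
  ultimately have "0 \<le> expflat 0 ?z + ?z * expflat 2 ?z \<and> expflat 0 ?z + ?z * expflat 2 ?z \<le> 1"
    using assms by auto
  with D show ?thesis by blast
qed

section \<open>Quadratic kernels of the Hamilton--Jacobi equation\<close>

lemma quadratic_has_derivative:
  fixes x y :: "'a::euclidean_space"
  assumes "t > a - e"
  shows "((\<lambda>z. p - (norm (snd z - y))\<^sup>2 / (2 * (e + (fst z - a)))) has_derivative
      (\<lambda>v. - ((x - y) \<bullet> snd v / (e + (t - a)) - (norm (x - y))\<^sup>2 * fst v / (2 * (e + (t - a))\<^sup>2)))) (at (t, x))"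
proof -
  let ?r = "e + (t - a)"
  have r: "?r > 0" using assms by simp
  have sub: "((\<lambda>z. snd z - y) has_derivative snd) (at (t, x))"
    by (auto intro!: derivative_eq_intros)
  from has_derivative_inner[OF this this]
  have num: "((\<lambda>z. (norm (snd z - y))\<^sup>2) has_derivative (\<lambda>v. 2 * ((x - y) \<bullet> snd v))) (at (t, x))"
    by (simp add: power2_norm_eq_inner inner_commute)
  have "((\<lambda>u. 1 / (2 * u)) has_real_derivative - 1 / (2 * u\<^sup>2)) (at u)" if "u > 0" for u :: real
    using that by (auto intro!: derivative_eq_intros simp: field_simps power2_eq_square)
  from DERIV_chain2[where g = "\<lambda>s. e + (s - a)", OF this[OF r]]
  have "((\<lambda>s. 1 / (2 * (e + (s - a)))) has_real_derivative - 1 / (2 * ?r\<^sup>2) * 1) (at t)"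
    by this (auto intro!: derivative_eq_intros)
  then have "((\<lambda>s. 1 / (2 * (e + (s - a)))) has_real_derivative - 1 / (2 * ?r\<^sup>2)) (at (fst (t, x)))"
    by simp
  from has_derivative_compose[OF has_derivative_fst[OF has_derivative_ident] this[unfolded has_field_derivative_def]]
  have "((\<lambda>z. 1 / (2 * (e + (fst z - a)))) has_derivative (\<lambda>v. - 1 / (2 * ?r\<^sup>2) * fst v)) (at (t, x))"
    by simp
  from has_derivative_diff[OF has_derivative_const has_derivative_mult[OF num this]]
  have "((\<lambda>z. p - (norm (snd z - y))\<^sup>2 * (1 / (2 * (e + (fst z - a))))) has_derivative
      (\<lambda>v. 0 - ((norm (x - y))\<^sup>2 * (- 1 / (2 * ?r\<^sup>2) * fst v) + 2 * ((x - y) \<bullet> snd v) * (1 / (2 * ?r))))) (at (t, x))"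
    by simp
  moreover have "(\<lambda>v. 0 - ((norm (x - y))\<^sup>2 * (- 1 / (2 * ?r\<^sup>2) * fst v) + 2 * ((x - y) \<bullet> snd v) * (1 / (2 * ?r)))) =
      (\<lambda>v. - ((x - y) \<bullet> snd v / ?r - (norm (x - y))\<^sup>2 * fst v / (2 * ?r\<^sup>2)))"
  proof
    fix v :: "real \<times> 'a"
    have "0 - (n * (- 1 / (2 * u\<^sup>2) * f) + 2 * q * (1 / (2 * u))) = - (q / u - n * f / (2 * u\<^sup>2))"
      if "u > 0" for n f q u :: real
      using that by (simp add: field_simps)
    from this[OF r] show "0 - ((norm (x - y))\<^sup>2 * (- 1 / (2 * ?r\<^sup>2) * fst v) + 2 * ((x - y) \<bullet> snd v) * (1 / (2 * ?r))) =
      - ((x - y) \<bullet> snd v / ?r - (norm (x - y))\<^sup>2 * fst v / (2 * ?r\<^sup>2))" .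
  qed
  ultimately show ?thesis by simp
qed

text \<open>Completing the square. The left-hand side is the derivative along \<open>(1, w)\<close>
  of the quadratic kernel, with displacement \<open>y\<close> and elapsed time \<open>r\<close>;
  equality when \<open>w\<close> is \<open>y\<close> divided by \<open>r\<close> means that the
  kernel is a solution and not only a subsolution. For \<open>r = 1\<close> this is Young's
  inequality, on which both Jensen arguments below rest.\<close>

lemma quadratic_HJ:
  fixes y w :: "'a::euclidean_space"
  assumes "r > 0"
  shows "y \<bullet> w / r - (norm y)\<^sup>2 / (2 * r\<^sup>2) \<le> (1/2) * (norm w)\<^sup>2"
proof -
  have "0 \<le> (norm (w - (1 / r) *\<^sub>R y))\<^sup>2" by simp
  also have "\<dots> = (norm w)\<^sup>2 - 2 * (y \<bullet> w / r) + (norm y)\<^sup>2 / r\<^sup>2"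
    unfolding power2_norm_eq_inner using assms
    by (simp add: inner_diff_left inner_diff_right inner_commute[of y w] power2_eq_square field_simps)
  finally show ?thesis by simp
qed

text \<open>In coordinates the squared norm is a polynomial in linear forms. The shift
  \<open>e\<close> makes the domain an open neighbourhood of the initial time
  \<open>a\<close>.\<close>

lemma Ck_on_quadratic:
  fixes y :: "'a::euclidean_space"
  assumes "e > 0"
  shows "Ck_on k ({a - e<..} \<times> UNIV) (\<lambda>z. p - (norm (snd z - y))\<^sup>2 / (2 * (e + (fst z - a))))"
proof -
  let ?S = "{a - e<..} \<times> (UNIV :: 'a set)"
  have op: "open ?S" by (intro open_Times) auto
  have lin: "Ck_on k ?S (\<lambda>z. snd z \<bullet> b)" for b
    by (intro Ck_on_linear op bounded_linear_compose[OF bounded_linear_inner_left bounded_linear_snd])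
  have "Ck_on k ?S (\<lambda>z. 2 * (e + (fst z - a)))"
    by (intro Ck_on_mult Ck_on_add Ck_on_diff Ck_on_const op Ck_on_linear bounded_linear_fst)
  then have "Ck_on k ?S (\<lambda>z. inverse (2 * (e + (fst z - a))))"
    by (intro Ck_on_compose[OF op _ _ Ck_on_inverse]) auto
  moreover have "Ck_on k ?S (\<lambda>z. \<Sum>b\<in>Basis. (snd z \<bullet> b - y \<bullet> b) * (snd z \<bullet> b - y \<bullet> b))"
    by (intro Ck_on_sum Ck_on_mult Ck_on_diff Ck_on_const op lin)
  ultimately have "Ck_on k ?S (\<lambda>z. p - (\<Sum>b\<in>Basis. (snd z \<bullet> b - y \<bullet> b) * (snd z \<bullet> b - y \<bullet> b)) *
      inverse (2 * (e + (fst z - a))))"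
    by (intro Ck_on_mult Ck_on_diff Ck_on_const op)
  moreover have "(\<Sum>b\<in>Basis. (x \<bullet> b - y \<bullet> b) * (x \<bullet> b - y \<bullet> b)) = (norm (x - y))\<^sup>2" for x
    unfolding power2_norm_eq_inner by (subst euclidean_inner) (simp add: inner_diff_left)
  ultimately show ?thesis by (simp add: divide_inverse)
qed

text \<open>Minus the soft maximum is a subsolution of the Hamilton--Jacobi equation, being a soft minimum
  of solutions; cutting it off at height \<open>M\<close> makes it compactly supported up to a constant.\<close>

lemma dual_value_le:
  fixes m :: "real \<Rightarrow> (real ^ 'd) measure"
  assumes AC: "AC_curve a b m" and ab: "a < b" and \<alpha>: "\<alpha> \<in> L2_fields a b m"
    and CE: "continuity_equation a b m \<alpha>" and m0: "m a = empirical N X"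
    and N: "N \<ge> 1" and \<beta>: "\<beta> > 0" and e: "e > 0"
  shows "(\<Sum>i<N. \<psi> i) / N - (LINT y|m b. smax \<beta> N (\<lambda>i. \<psi> i - (norm (y - X i))\<^sup>2 / (2 * (e + (b - a)))))
           \<le> (LINT t:{a..b}|lborel. LINT x|m t. (1/2) * (norm (\<alpha> t x))\<^sup>2)"
    (is "_ \<le> ?C")
proof -
  define p where "p i z = \<psi> i - (norm (snd z - X i))\<^sup>2 / (2 * (e + (fst z - a)))" for i and z :: "real \<times> (real ^ 'd)"
  define s where "s z = smax \<beta> N (\<lambda>i. p i z)" for z
  let ?S = "{a - e<..} \<times> (UNIV :: (real ^ 'd) set)"
  have op: "open ?S" by (intro open_Times) auto
  have bP: "m b \<in> P2" and aP: "m a \<in> P2" using AC_curve_P2[OF AC] ab by auto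
  have pC: "Ck_on k ?S (p i)" for k i
    unfolding p_def[abs_def] by (rule Ck_on_quadratic[OF e])
  have sC: "Ck_on k ?S s" for k
    unfolding s_def[abs_def] by (rule Ck_on_smax[OF op N pC])
  have sc: "continuous_on UNIV (\<lambda>x. s (t, x))" if "t \<in> {a..b}" for t
    by (rule continuous_on_compose2[OF Ck_on_continuous[OF sC[of 0]]])
       (use that e in \<open>auto intro!: continuous_intros\<close>)
  have sm: "(\<lambda>x. s (t, x)) \<in> borel_measurable borel" if "t \<in> {a..b}" for t
    using sc[OF that] by (rule borel_measurable_continuous_onI)
  \<comment> \<open>\<open>M\<close> is the height of the cut-off and \<open>\<kappa>\<close> the
    loss of the smooth positive part; afterwards \<open>\<kappa>\<close> tends to 0 and
    \<open>M\<close> to infinity.\<close>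
  have main: "(\<Sum>i<N. \<psi> i) / N - (LINT y|m b. max (s (b, y)) (- M)) \<le> ?C + \<kappa>" if M: "M \<ge> 0" and \<kappa>: "\<kappa> > 0" for M \<kappa>
  proof -
    define g where "g z = - softpos \<kappa> (M + s z)" for z
    have gC: "Ck_on k ?S g" for k
      unfolding g_def[abs_def]
      by (intro Ck_on_minus op Ck_on_compose[OF op open_UNIV _ Ck_on_softpos] Ck_on_add Ck_on_const sC) auto
    \<comment> \<open>Beyond radius \<open>B\<close> every \<open>p i\<close> is at most
      \<open>- M - ln N / \<beta>\<close>, so \<open>s\<close> is at most \<open>- M\<close> in
      spite of the excess of a soft maximum over the maximum. The summand 1 in \<open>B\<close>
      makes \<open>norm (x - X i)\<close> at least 1, hence at most its square.\<close>
    define R where "R = M + (\<Sum>i<N. \<bar>\<psi> i\<bar>) + ln N / \<beta>"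
    define B where "B = (\<Sum>i<N. norm (X i)) + 1 + 2 * (e + (b - a)) * R"
    have R: "R \<ge> 0" using M N \<beta> by (auto simp: R_def intro!: add_nonneg_nonneg sum_nonneg)
    have supp: "g (t, x) = 0" if t: "t \<in> {a..b}" and x: "norm x > B" for t x
    proof -
      have "p i (t, x) \<le> - M - ln N / \<beta>" if i: "i < N" for i
      proof -
        have "norm (X i) \<le> (\<Sum>i<N. norm (X i))" "\<bar>\<psi> i\<bar> \<le> (\<Sum>i<N. \<bar>\<psi> i\<bar>)"
          using i by (auto intro!: member_le_sum)
        then have n: "norm (x - X i) \<ge> 1 + 2 * (e + (b - a)) * R" and \<psi>: "\<psi> i \<le> R - M - ln N / \<beta>"
          using x norm_triangle_ineq2[of x "X i"] by (auto simp: B_def R_def abs_le_iff)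
        have R': "2 * (e + (b - a)) * R \<ge> 0" using R ab e by simp
        have "2 * (e + (b - a)) * R \<le> norm (x - X i) * 1" using n by simp
        also have "\<dots> \<le> norm (x - X i) * norm (x - X i)"
          using n R' by (intro mult_left_mono) auto
        finally have "2 * (e + (b - a)) * R \<le> (norm (x - X i))\<^sup>2" by (simp add: power2_eq_square)
        moreover have "2 * (e + (t - a)) * R \<le> 2 * (e + (b - a)) * R"
          using t R by (intro mult_right_mono) auto
        ultimately have "R \<le> (norm (x - X i))\<^sup>2 / (2 * (e + (t - a)))"
          using t e by (simp add: field_simps)
        then show ?thesis using \<psi> by (simp add: p_def)
      qed
      then have "s (t, x) \<le> (- M - ln N / \<beta>) + ln N / \<beta>"
        unfolding s_def by (intro smax_le \<beta> N)
      then show ?thesis by (simp add: g_def softpos_nonpos[OF \<kappa>])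
    qed
    have HJ: "frechet_derivative g (at (t, x)) (1, w) \<le> (1/2) * (norm w)\<^sup>2" if t: "t \<in> {a..b}" for t x w
    proof -
      let ?w = "softw \<beta> N (\<lambda>i. p i (t, x))"
      define q where "q i v = - ((x - X i) \<bullet> snd v / (e + (t - a)) - (norm (x - X i))\<^sup>2 * fst v / (2 * (e + (t - a))\<^sup>2))"
        for i and v :: "real \<times> (real ^ 'd)"
      have "(p i has_derivative q i) (at (t, x))" for i
        unfolding p_def[abs_def] q_def[abs_def] by (rule quadratic_has_derivative) (use t e in auto)
      then have "(s has_derivative (\<lambda>v. \<Sum>i<N. ?w i * q i v)) (at (t, x))"
        unfolding s_def[abs_def] by (intro smax_has_derivative N \<beta>)
      from has_derivative_add[OF has_derivative_const[of M] this]
      have s': "((\<lambda>z. M + s z) has_derivative (\<lambda>v. \<Sum>i<N. ?w i * q i v)) (at (t, x))" by simp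
      obtain D where D: "0 \<le> D" "D \<le> 1" "(softpos \<kappa> has_real_derivative D) (at (M + s (t, x)))"
        using softpos_deriv[OF \<kappa>] by blast
      have "(g has_derivative (\<lambda>v. - (D * (\<Sum>i<N. ?w i * q i v)))) (at (t, x))"
        unfolding g_def[abs_def]
        by (rule has_derivative_minus[OF has_derivative_compose[OF s' D(3)[unfolded has_field_derivative_def]]])
      then have "(\<lambda>v. - (D * (\<Sum>i<N. ?w i * q i v))) = frechet_derivative g (at (t, x))"
        by (rule frechet_derivative_at)
      from fun_cong[OF this[symmetric], of "(1, w)"]
      have "frechet_derivative g (at (t, x)) (1, w) = - (D * (\<Sum>i<N. ?w i * q i (1, w)))" .
      also have "\<dots> = D * (\<Sum>i<N. ?w i * - q i (1, w))"
        by (simp add: sum_negf)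
      \<comment> \<open>Each kernel satisfies the bound, and so does their convex combination; a
        slope \<open>D\<close> between 0 and 1 keeps it, as the kinetic energy is
        nonnegative.\<close>
      also have "\<dots> \<le> D * (\<Sum>i<N. ?w i * ((1/2) * (norm w)\<^sup>2))"
      proof (intro mult_left_mono sum_mono D(1))
        show "- q i (1, w) \<le> (1/2) * (norm w)\<^sup>2" for i
          using quadratic_HJ[of "e + (t - a)" "x - X i" w] t e by (simp add: q_def)
        show "0 \<le> ?w i" for i using softw_pos[OF N] less_imp_le by blast
      qed
      also have "\<dots> = D * ((1/2) * (norm w)\<^sup>2)"
        unfolding sum_distrib_right[symmetric] softw_sum[OF N] by simp
      also have "\<dots> \<le> 1 * ((1/2) * (norm w)\<^sup>2)"
        by (intro mult_right_mono D(2)) auto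
      finally show ?thesis by simp
    qed
    have le: "(LINT x|m b. g (b, x)) - (LINT x|m a. g (a, x)) \<le> ?C"
      by (rule subsolution_integral_le[OF AC ab \<alpha> CE _ _ gC supp HJ]) (use e in auto)
    have gb: "\<bar>g (t, x)\<bar> \<le> max (M + s (t, x)) 0" for t x
      using softpos_nonneg[OF \<kappa>] softpos_le[OF \<kappa>] by (simp add: g_def)
    have "(LINT x|m a. g (a, x)) \<le> - (M + (\<Sum>i<N. \<psi> i) / N - \<kappa>)"
    proof -
      have "(\<lambda>x. g (a, x)) \<in> borel_measurable borel"
        by (intro borel_measurable_continuous_onI continuous_on_compose2[OF Ck_on_continuous[OF gC[of 0]]])
           (use ab e in \<open>auto intro!: continuous_intros\<close>)
      then have "(LINT x|m a. g (a, x)) = (1 / N) * (\<Sum>i<N. g (a, X i))"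
        unfolding m0 by (rule integral_empirical)
      also have "\<dots> \<le> (1 / N) * (\<Sum>i<N. - (M + \<psi> i - \<kappa>))"
      proof (intro mult_left_mono sum_mono)
        \<comment> \<open>The \<open>i\<close>-th kernel vanishes at its own centre, so the soft
          maximum there is at least \<open>\<psi> i\<close>.\<close>
        fix i assume "i \<in> {..<N}"
        then have "\<psi> i \<le> s (a, X i)"
          using smax_ge[OF \<beta>, of i N "\<lambda>j. p j (a, X i)"] by (simp add: s_def p_def)
        then show "g (a, X i) \<le> - (M + \<psi> i - \<kappa>)"
          using softpos_ge[OF \<kappa>, of "M + s (a, X i)"] by (simp add: g_def)
      qed auto
      also have "\<dots> = - (M + (\<Sum>i<N. \<psi> i) / N - \<kappa>)"
        using N by (simp add: sum.distrib sum_subtractf sum_negf field_simps)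
      finally show ?thesis .
    qed
    moreover have "- (M + (LINT y|m b. max (s (b, y)) (- M))) \<le> (LINT x|m b. g (b, x))"
    proof -
      interpret prob_space "m b" using P2_D(1)[OF bP] .
      have sb: "(\<lambda>x. s (b, x)) \<in> borel_measurable borel" using sm ab by auto
      have A: "max (s (b, y)) (- M) \<le> (\<Sum>i<N. \<bar>\<psi> i\<bar>) + ln N / \<beta>" for y
      proof -
        have "p i (b, y) \<le> (\<Sum>i<N. \<bar>\<psi> i\<bar>)" if "i < N" for i
        proof -
          have "\<bar>\<psi> i\<bar> \<le> (\<Sum>i<N. \<bar>\<psi> i\<bar>)" using that by (auto intro!: member_le_sum)
          moreover have "(norm (y - X i))\<^sup>2 / (2 * (e + (b - a))) \<ge> 0" using e ab by simp
          ultimately show ?thesis by (simp add: p_def abs_le_iff)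
        qed
        then have "s (b, y) \<le> (\<Sum>i<N. \<bar>\<psi> i\<bar>) + ln N / \<beta>"
          unfolding s_def by (intro smax_le \<beta> N)
        moreover have "0 \<le> (\<Sum>i<N. \<bar>\<psi> i\<bar>) + ln N / \<beta>"
          using N \<beta> by (auto intro!: add_nonneg_nonneg sum_nonneg)
        ultimately show ?thesis using M by simp
      qed
      have i1: "integrable (m b) (\<lambda>y. max (s (b, y)) (- M))"
      proof (rule P2_integrable_bounded[OF bP])
        show "(\<lambda>y. max (s (b, y)) (- M)) \<in> borel_measurable borel" using sb by simp
        have "0 \<le> (\<Sum>i<N. \<bar>\<psi> i\<bar>) + ln N / \<beta>"
          using N \<beta> by (auto intro!: add_nonneg_nonneg sum_nonneg)
        then show "\<bar>max (s (b, y)) (- M)\<bar> \<le> (\<Sum>i<N. \<bar>\<psi> i\<bar>) + ln N / \<beta> + M" for y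
          using A[of y] M by linarith
      qed
      have i2: "integrable (m b) (\<lambda>y. g (b, y))"
      proof (rule P2_integrable_bounded[OF bP])
        show "(\<lambda>x. g (b, x)) \<in> borel_measurable borel"
          by (intro borel_measurable_continuous_onI continuous_on_compose2[OF Ck_on_continuous[OF gC[of 0]]])
             (use ab e in \<open>auto intro!: continuous_intros\<close>)
        show "\<bar>g (b, y)\<bar> \<le> (\<Sum>i<N. \<bar>\<psi> i\<bar>) + ln N / \<beta> + M" for y
          using gb[of b y] A[of y] M by linarith
      qed
      have "- (M + (LINT y|m b. max (s (b, y)) (- M))) = (LINT y|m b. - (M + max (s (b, y)) (- M)))"
        using i1 by (simp add: prob_space)
      also have "\<dots> \<le> (LINT x|m b. g (b, x))"
      proof (intro integral_mono i2)
        show "integrable (m b) (\<lambda>y. - (M + max (s (b, y)) (- M)))" using i1 by auto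
        show "- (M + max (s (b, y)) (- M)) \<le> g (b, y)" for y
          using gb[of b y] by linarith
      qed
      finally show ?thesis .
    qed
    ultimately show ?thesis using le by linarith
  qed
  have main': "(\<Sum>i<N. \<psi> i) / N - (LINT y|m b. max (s (b, y)) (- M)) \<le> ?C" if "M \<ge> 0" for M
    by (rule field_le_epsilon) (use main[OF that] in auto)
  have si: "integrable (m b) (\<lambda>y. s (b, y))"
  proof (rule Bochner_Integration.integrable_bound)
    interpret prob_space "m b" using P2_D(1)[OF bP] .
    let ?f = "\<lambda>y. (\<Sum>i<N. \<bar>\<psi> i\<bar> + (2 * (norm y)\<^sup>2 + 2 * (norm (X i))\<^sup>2) / (2 * (e + (b - a)))) + ln N / \<beta>"
    show "integrable (m b) ?f"
      by (intro Bochner_Integration.integrable_add integrable_const Bochner_Integration.integrable_sum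
          integrable_divide integrable_mult_right P2_D(4)[OF bP])
    show "(\<lambda>y. s (b, y)) \<in> borel_measurable (m b)"
      using sm ab by (intro P2_measurable[OF bP]) auto
    have "\<bar>s (b, y)\<bar> \<le> ?f y" for y
    proof -
      have "\<bar>s (b, y)\<bar> \<le> (\<Sum>i<N. \<bar>p i (b, y)\<bar>) + ln N / \<beta>"
        unfolding s_def by (rule smax_abs_le[OF \<beta> N])
      also have "(\<Sum>i<N. \<bar>p i (b, y)\<bar>) \<le> (\<Sum>i<N. \<bar>\<psi> i\<bar> + (2 * (norm y)\<^sup>2 + 2 * (norm (X i))\<^sup>2) / (2 * (e + (b - a))))"
      proof (rule sum_mono)
        fix i
        have "(norm (y - X i))\<^sup>2 / (2 * (e + (b - a))) \<le> (2 * (norm y)\<^sup>2 + 2 * (norm (X i))\<^sup>2) / (2 * (e + (b - a)))"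
          using ab e by (intro divide_right_mono norm_diff_square_le) auto
        moreover have "(norm (y - X i))\<^sup>2 / (2 * (e + (b - a))) \<ge> 0" using ab e by simp
        ultimately show "\<bar>p i (b, y)\<bar> \<le> \<bar>\<psi> i\<bar> + (2 * (norm y)\<^sup>2 + 2 * (norm (X i))\<^sup>2) / (2 * (e + (b - a)))"
          unfolding p_def fst_conv snd_conv by linarith
      qed
      finally show ?thesis by simp
    qed
    then show "AE y in m b. norm (s (b, y)) \<le> norm (?f y)"
      unfolding real_norm_def by (intro AE_I2 order_trans[OF _ abs_ge_self])
  qed
  \<comment> \<open>The truncations are dominated by \<open>\<bar>s (b, y)\<bar>\<close>, integrable
    because the kernels grow quadratically and \<open>m b\<close> has a finite second
    moment.\<close>
  have "(\<lambda>n. LINT y|m b. max (s (b, y)) (- real n)) \<longlonglongrightarrow> (LINT y|m b. s (b, y))"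
  proof (rule integral_dominated_convergence[where w = "\<lambda>y. \<bar>s (b, y)\<bar>"])
    show "integrable (m b) (\<lambda>y. \<bar>s (b, y)\<bar>)" using si by simp
    show "(\<lambda>y. s (b, y)) \<in> borel_measurable (m b)" "(\<lambda>y. max (s (b, y)) (- real n)) \<in> borel_measurable (m b)" for n
      using borel_measurable_integrable[OF si] by auto
    show "AE y in m b. norm (max (s (b, y)) (- real n)) \<le> \<bar>s (b, y)\<bar>" for n
      by (intro AE_I2) auto
    have "(\<lambda>n. max r (- real n)) \<longlonglongrightarrow> r" for r
    proof -
      obtain n0 :: nat where "- r \<le> n0" using real_arch_simple by blast
      then have "\<forall>n\<ge>n0. max r (- real n) = r" by auto
      then show ?thesis by (intro tendsto_eventually) (auto simp: eventually_sequentially)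
    qed
    then show "AE y in m b. (\<lambda>n. max (s (b, y)) (- real n)) \<longlonglongrightarrow> s (b, y)" by simp
  qed
  then have "(\<lambda>n. (\<Sum>i<N. \<psi> i) / N - (LINT y|m b. max (s (b, y)) (- real n))) \<longlonglongrightarrow>
      (\<Sum>i<N. \<psi> i) / N - (LINT y|m b. s (b, y))"
    by (intro tendsto_intros)
  then have "(\<Sum>i<N. \<psi> i) / N - (LINT y|m b. s (b, y)) \<le> ?C"
    by (rule LIMSEQ_le_const2) (use main' in auto)
  then show ?thesis by (simp add: s_def p_def)
qed

section \<open>Barycentric projection onto \<open>N\<close> particles\<close>

lemma emeasure_empirical:
  assumes "A \<in> sets borel"
  shows "emeasure (empirical N x) A = ennreal (card {i. i < N \<and> x i \<in> A} / N)"
proof -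
  have "emeasure (empirical N x) A = emeasure (uniform_count_measure {..<N}) (x -` A \<inter> {..<N})"
    unfolding empirical_def by (subst emeasure_distr) (use assms in \<open>auto simp: space_uniform_count_measure\<close>)
  also have "\<dots> = ennreal (card (x -` A \<inter> {..<N}) / N)"
    by (subst emeasure_uniform_count_measure) auto
  also have "x -` A \<inter> {..<N} = {i. i < N \<and> x i \<in> A}" by auto
  finally show ?thesis .
qed

lemma empirical_P2:
  assumes "N \<ge> 1"
  shows "empirical N x \<in> P2"
proof -
  interpret prob_space "uniform_count_measure {..<N}"
    by (rule prob_space_uniform_count_measure) (use assms in \<open>auto simp: lessThan_empty_iff\<close>)
  have "prob_space (empirical N x)"
    unfolding empirical_def by (rule prob_space_distr) auto
  moreover have "integrable (empirical N x) (\<lambda>y. (norm y)\<^sup>2)"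
    unfolding empirical_def
    by (subst integrable_distr_eq)
       (auto simp: uniform_count_measure_def intro!: integrable_point_measure_finite)
  ultimately show ?thesis
    by (auto simp: P2_def empirical_def)
qed

lemma P2_weighted_integrable:
  fixes w :: "real ^ 'd \<Rightarrow> real"
  assumes \<nu>: "\<nu> \<in> P2" and w: "w \<in> borel_measurable borel" "\<And>y. \<bar>w y\<bar> \<le> 1"
  shows "integrable \<nu> (\<lambda>y. w y *\<^sub>R y)"
proof -
  interpret prob_space \<nu> using P2_D(1)[OF \<nu>] .
  have "integrable \<nu> (\<lambda>y. 1 + (norm y)\<^sup>2)"
    using P2_D(4)[OF \<nu>] by auto
  then show ?thesis
  proof (rule Bochner_Integration.integrable_bound)
    show "(\<lambda>y. w y *\<^sub>R y) \<in> borel_measurable \<nu>"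
      using w(1) by (intro P2_measurable[OF \<nu>]) simp
    have "norm (w y *\<^sub>R y) \<le> 1 + (norm y)\<^sup>2" for y
    proof -
      have "norm (w y *\<^sub>R y) \<le> 1 * norm y"
        unfolding norm_scaleR using w(2) by (intro mult_right_mono) auto
      with norm_le_1_plus_square[of y] show ?thesis by linarith
    qed
    then show "AE y in \<nu>. norm (w y *\<^sub>R y) \<le> norm (1 + (norm y)\<^sup>2)"
      by (intro AE_I2) (simp add: abs_of_nonneg)
  qed
qed

text \<open>A partition of unity \<open>w\<close> whose members have mass \<open>1/N\<close> each turns \<open>\<nu>\<close> into the law of a pair
  (index, point) with uniform index; conditioning the point on the index yields the barycentres.\<close>

lemma barycentres_decrease:
  fixes w :: "nat \<Rightarrow> real ^ 'd \<Rightarrow> real" and G :: "(real ^ 'd) measure \<Rightarrow> real"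
  assumes G: "cond_exp_decreasing TYPE((real ^ 'd) \<times> (real ^ 'd)) G"
    and \<nu>: "\<nu> \<in> P2" and N: "N \<ge> 1"
    and wm: "\<And>i. w i \<in> borel_measurable borel" and w0: "\<And>i y. w i y \<ge> 0"
    and w1: "\<And>y. (\<Sum>i<N. w i y) = 1" and wN: "\<And>i. i < N \<Longrightarrow> (LINT y|\<nu>. w i y) = 1 / N"
  shows "G (empirical N (\<lambda>i. real N *\<^sub>R (LINT y|\<nu>. w i y *\<^sub>R y))) \<le> G \<nu>"
proof -
  define b where "b i = real N *\<^sub>R (LINT y|\<nu>. w i y *\<^sub>R y)" for i
  interpret \<nu>: prob_space \<nu> using P2_D(1)[OF \<nu>] .
  have [measurable_cong]: "sets \<nu> = sets borel" and sp\<nu>: "space \<nu> = UNIV"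
    using P2_D(2,3)[OF \<nu>] by auto
  note [measurable] = wm
  let ?K = "count_space {..<N}"
  interpret K: sigma_finite_measure ?K
    by (rule sigma_finite_measure_count_space_finite) simp
  interpret pair_sigma_finite ?K \<nu> ..
  define d where "d z = w (fst z) (snd z)" for z
  have dm[measurable]: "d \<in> borel_measurable (?K \<Otimes>\<^sub>M \<nu>)"
  proof -
    have "(\<lambda>z. w (fst z) (snd z)) \<in> borel_measurable (?K \<Otimes>\<^sub>M \<nu>)"
      by (rule measurable_compose_countable'[where g = fst and I = "{..<N}" and f = "\<lambda>i z. w i (snd z)"]) auto
    then show ?thesis by (simp add: d_def[abs_def])
  qed
  define M where "M = density (?K \<Otimes>\<^sub>M \<nu>) (\<lambda>z. ennreal (d z))"
  have setsM[measurable_cong]: "sets M = sets (?K \<Otimes>\<^sub>M \<nu>)" and spM: "space M = {..<N} \<times> UNIV"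
    by (auto simp: M_def space_pair_measure sp\<nu>)
  have wle: "w i y \<le> 1" if "i < N" for i y
    using member_le_sum[of i "{..<N}" "\<lambda>i. w i y"] w0 w1[of y] that by auto
  have wi: "integrable \<nu> (w i)" if "i < N" for i
    by (rule \<nu>.integrable_const_bound[of _ 1]) (use w0 wle that in auto)
  have nnM: "(\<integral>\<^sup>+z. f z \<partial>M) = (\<Sum>i<N. \<integral>\<^sup>+y. ennreal (w i y) * f (i, y) \<partial>\<nu>)"
    if [measurable]: "f \<in> borel_measurable (?K \<Otimes>\<^sub>M \<nu>)" for f
  proof -
    have "(\<integral>\<^sup>+z. f z \<partial>M) = (\<integral>\<^sup>+z. ennreal (d z) * f z \<partial>(?K \<Otimes>\<^sub>M \<nu>))"
      unfolding M_def by (rule nn_integral_density) measurable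
    also have "\<dots> = (\<integral>\<^sup>+i. \<integral>\<^sup>+y. ennreal (d (i, y)) * f (i, y) \<partial>\<nu> \<partial>?K)"
      by (rule \<nu>.nn_integral_fst[symmetric]) measurable
    also have "\<dots> = (\<Sum>i<N. \<integral>\<^sup>+y. ennreal (w i y) * f (i, y) \<partial>\<nu>)"
      by (subst nn_integral_count_space_finite) (auto simp: d_def)
    finally show ?thesis .
  qed
  have intM: "(LINT z|M. f z) = (\<Sum>i<N. LINT y|\<nu>. w i y * f (i, y))"
    if f: "integrable M f" for f :: "nat \<times> (real ^ 'd) \<Rightarrow> real"
  proof -
    have [measurable]: "f \<in> borel_measurable (?K \<Otimes>\<^sub>M \<nu>)"
      using borel_measurable_integrable[OF f] measurable_cong_sets[OF setsM refl] by blast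
    have i: "integrable (?K \<Otimes>\<^sub>M \<nu>) (\<lambda>z. d z * f z)"
      using f unfolding M_def by (subst (asm) integrable_density) (auto simp: d_def w0)
    have "(LINT z|M. f z) = (LINT z|(?K \<Otimes>\<^sub>M \<nu>). d z * f z)"
      unfolding M_def by (subst integral_density) (auto simp: d_def w0)
    also have "\<dots> = (LINT i|?K. LINT y|\<nu>. d (i, y) * f (i, y))"
      by (rule integral_fst'[OF i, symmetric])
    also have "\<dots> = (\<Sum>i<N. LINT y|\<nu>. w i y * f (i, y))"
      by (subst lebesgue_integral_count_space_finite) (auto simp: d_def)
    finally show ?thesis .
  qed
  have wnn: "(\<integral>\<^sup>+y. ennreal (w i y) \<partial>\<nu>) = ennreal (1 / N)" if "i < N" for i
    using nn_integral_eq_integral[OF wi[OF that]] w0 wN[OF that] by simp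
  have emM: "emeasure M A = (\<Sum>i<N. \<integral>\<^sup>+y. ennreal (w i y) * indicator A (i, y) \<partial>\<nu>)"
    if "A \<in> sets (?K \<Otimes>\<^sub>M \<nu>)" for A
    using nnM[of "indicator A"] that nn_integral_indicator[of A M] setsM by simp
  have "emeasure M (space M) = (\<Sum>i<N. \<integral>\<^sup>+y. ennreal (w i y) \<partial>\<nu>)"
  proof -
    have "space M \<in> sets (?K \<Otimes>\<^sub>M \<nu>)" using setsM sets.top by blast
    from emM[OF this] show ?thesis by (simp add: spM indicator_def cong: nn_integral_cong)
  qed
  also have "\<dots> = (\<Sum>i<N. ennreal (1 / N))"
    using wnn by simp
  also have "\<dots> = 1"
    using N by (simp add: ennreal_of_nat_eq_real_of_nat flip: ennreal_mult')
  finally interpret M: prob_space M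
    by (rule prob_spaceI)
  have lawsnd: "law M snd = \<nu>"
  proof (rule measure_eqI)
    show "sets (law M snd) = sets \<nu>" using P2_D(2)[OF \<nu>] by simp
    fix A assume "A \<in> sets (law M snd)"
    then have A[measurable]: "A \<in> sets borel" by simp
    have sm[measurable]: "snd \<in> M \<rightarrow>\<^sub>M borel" by measurable
    have B: "snd -` A \<inter> space M \<in> sets (?K \<Otimes>\<^sub>M \<nu>)"
      using measurable_sets[OF sm A] setsM by simp
    have "emeasure (law M snd) A = emeasure M (snd -` A \<inter> space M)"
      by (rule emeasure_distr) auto
    also have "\<dots> = (\<Sum>i<N. \<integral>\<^sup>+y. ennreal (w i y) * indicator A y \<partial>\<nu>)"
      unfolding emM[OF B] by (intro sum.cong nn_integral_cong) (auto simp: spM indicator_def)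
    also have "\<dots> = (\<integral>\<^sup>+y. (\<Sum>i<N. ennreal (w i y) * indicator A y) \<partial>\<nu>)"
      by (rule nn_integral_sum[symmetric]) measurable
    also have "\<dots> = (\<integral>\<^sup>+y. indicator A y \<partial>\<nu>)"
      by (intro nn_integral_cong) (simp add: w0 w1 sum_ennreal flip: sum_distrib_right)
    also have "\<dots> = emeasure \<nu> A" using A P2_D(2)[OF \<nu>] by simp
    finally show "emeasure (law M snd) A = emeasure \<nu> A" .
  qed
  have fm: "fst \<in> M \<rightarrow>\<^sub>M ?K" by measurable
  have bm[measurable]: "(\<lambda>z. b (fst z)) \<in> borel_measurable M"
    by (rule measurable_compose[OF fm]) simp
  have lawfst: "law M (\<lambda>z. b (fst z)) = empirical N b"
  proof (rule measure_eqI)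
    show "sets (law M (\<lambda>z. b (fst z))) = sets (empirical N b)" by (simp add: empirical_def)
    fix A assume "A \<in> sets (law M (\<lambda>z. b (fst z)))"
    then have A[measurable]: "A \<in> sets borel" by simp
    have B: "(\<lambda>z. b (fst z)) -` A \<inter> space M \<in> sets (?K \<Otimes>\<^sub>M \<nu>)"
      using measurable_sets[OF bm A] setsM by simp
    have "emeasure (law M (\<lambda>z. b (fst z))) A = emeasure M ((\<lambda>z. b (fst z)) -` A \<inter> space M)"
      by (rule emeasure_distr) auto
    also have "\<dots> = (\<Sum>i<N. \<integral>\<^sup>+y. ennreal (w i y) * indicator A (b i) \<partial>\<nu>)"
      unfolding emM[OF B] by (intro sum.cong nn_integral_cong) (auto simp: spM indicator_def)
    also have "\<dots> = (\<Sum>i<N. if b i \<in> A then ennreal (1 / N) else 0)"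
      by (rule sum.cong) (auto simp: wnn)
    also have "\<dots> = (\<Sum>i\<in>{i. i < N \<and> b i \<in> A}. ennreal (1 / N))"
      by (subst sum.inter_filter[symmetric]) (auto intro!: sum.cong)
    also have "\<dots> = emeasure (empirical N b) A"
      unfolding emeasure_empirical[OF A] by (simp add: ennreal_of_nat_eq_real_of_nat flip: ennreal_mult')
    finally show "emeasure (law M (\<lambda>z. b (fst z))) A = emeasure (empirical N b) A" .
  qed
  \<comment> \<open>\<open>cond_exp_decreasing\<close> conditions on random vectors, so the index is
    encoded as a vector with equal components; distinct indices give distinct vectors.\<close>
  define Y where "Y z = (vec (real (fst z)) :: real ^ 'd)" for z :: "nat \<times> (real ^ 'd)"
  have Ym[measurable]: "Y \<in> borel_measurable M"
    unfolding Y_def[abs_def] by (rule measurable_compose[OF fm]) simp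
  have YL: "Y \<in> L2_rv M"
    unfolding L2_rv_def
  proof (intro CollectI conjI Ym)
    show "integrable M (\<lambda>z. (norm (Y z))\<^sup>2)"
    proof (rule M.integrable_const_bound)
      show "AE z in M. norm ((norm (Y z))\<^sup>2) \<le> (\<Sum>i<N. (norm (vec (real i) :: real ^ 'd))\<^sup>2)"
        by (rule AE_I2) (auto simp: spM Y_def intro!: member_le_sum[of _ _ "\<lambda>i. (norm (vec (real i) :: real ^ 'd))\<^sup>2"])
    qed measurable
  qed
  have sndm[measurable]: "snd \<in> borel_measurable M" by measurable
  have XL: "snd \<in> L2_rv M"
    unfolding L2_rv_def
  proof (intro CollectI conjI sndm)
    show "integrable M (\<lambda>z. (norm (snd z))\<^sup>2)"
      using P2_D(4)[OF \<nu>] unfolding lawsnd[symmetric] by (subst (asm) integrable_distr_eq) auto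
  qed
  define F where "F = vimage_algebra (space M) Y borel"
  have sub: "subalgebra M F"
    unfolding F_def by (rule subalgebra_vimage_algebra[OF Ym])
  interpret S: finite_measure_subalgebra M F by unfold_locales (rule sub)
  have "AE z in M. cond_exp_given M snd Y z $ k = b (fst z) $ k" for k
  proof -
    have intX: "integrable M (\<lambda>z. snd z $ k)"
      by (rule L2_rv_component_integrable[OF M.prob_space_axioms XL])
    have intb: "integrable M (\<lambda>z. b (fst z) $ k)"
    proof (rule M.integrable_const_bound)
      show "AE z in M. norm (b (fst z) $ k) \<le> (\<Sum>i<N. \<bar>b i $ k\<bar>)"
        by (rule AE_I2) (auto simp: spM intro!: member_le_sum[of _ _ "\<lambda>i. \<bar>b i $ k\<bar>"])
      show "(\<lambda>z. b (fst z) $ k) \<in> borel_measurable M"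
        by (rule measurable_compose[OF fm]) simp
    qed
    have "AE z in M. real_cond_exp M F (\<lambda>z. snd z $ k) z = b (fst z) $ k"
    proof (rule S.real_cond_exp_charact[OF _ intX intb])
      \<comment> \<open>Decodes the index, which exhibits the barycentre as a Borel function of
        \<open>Y\<close>.\<close>
      define h where "h v = (\<Sum>i<N. if v = vec (real i) then b i $ k else 0)" for v :: "real ^ 'd"
      have hm: "h \<in> borel_measurable borel" unfolding h_def by measurable
      have "Y \<in> F \<rightarrow>\<^sub>M borel"
        unfolding F_def by (rule measurable_vimage_algebra1) auto
      from measurable_compose[OF this hm] have hY: "(\<lambda>z. h (Y z)) \<in> borel_measurable F" .
      have heq: "h (Y z) = b (fst z) $ k" if "z \<in> space F" for z
      proof -
        have "fst z < N" using that sub by (auto simp: subalgebra_def spM)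
        moreover have "(vec (real i) = (vec (real j) :: real ^ 'd)) = (i = j)" for i j
          by (simp add: vec_eq_iff)
        ultimately show ?thesis by (simp add: h_def Y_def)
      qed
      show "(\<lambda>z. b (fst z) $ k) \<in> borel_measurable F"
        by (rule measurable_cong[THEN iffD1, OF heq hY])
    next
      fix A assume "A \<in> sets F"
      then obtain B where B[measurable]: "B \<in> sets borel" and A: "A = Y -` B \<inter> space M"
        unfolding F_def by (subst (asm) sets_vimage_algebra2) auto
      have Am[measurable]: "A \<in> sets M" unfolding A by measurable
      \<comment> \<open>An event generated by \<open>Y\<close> is a union of slices with fixed
        index, so an integral over it is a sum over the indices whose code lies in
        \<open>B\<close>.\<close>
      have tr: "(LINT z:A|M. f z) = (\<Sum>i<N. if vec (real i) \<in> B then (LINT y|\<nu>. w i y * f (i, y)) else 0)"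
        if f: "integrable M f" for f :: "nat \<times> (real ^ 'd) \<Rightarrow> real"
      proof -
        have "integrable M (\<lambda>z. indicator A z * f z)"
          using integrable_mult_indicator[OF Am f] by simp
        from intM[OF this] have "(LINT z:A|M. f z) = (\<Sum>i<N. LINT y|\<nu>. w i y * (indicator A (i, y) * f (i, y)))"
          by (simp add: set_lebesgue_integral_def)
        also have "\<dots> = (\<Sum>i<N. if vec (real i) \<in> B then (LINT y|\<nu>. w i y * f (i, y)) else 0)"
          by (rule sum.cong) (auto simp: A spM Y_def indicator_def)
        finally show ?thesis .
      qed
      have "(LINT y|\<nu>. w i y * snd (i, y) $ k) = (LINT y|\<nu>. w i y * b (fst (i, y)) $ k)" if i: "i < N" for i
      proof -
        have "(LINT y|\<nu>. w i y * y $ k) = (LINT y|\<nu>. (w i y *\<^sub>R y) $ k)" by simp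
        also have "\<dots> = (LINT y|\<nu>. w i y *\<^sub>R y) $ k"
        proof -
          have "integrable \<nu> (\<lambda>y. w i y *\<^sub>R y)"
            by (rule P2_weighted_integrable[OF \<nu> wm]) (use w0 wle i in auto)
          from integral_inner_left[OF this, of "axis k 1"] show ?thesis
            by (simp add: inner_axis)
        qed
        also have "\<dots> = (1 / N) * b i $ k"
          using N by (simp add: b_def)
        also have "\<dots> = (LINT y|\<nu>. w i y * b i $ k)"
          using wi[OF i] wN[OF i] by simp
        finally show ?thesis by simp
      qed
      then show "(LINT z:A|M. snd z $ k) = (LINT z:A|M. b (fst z) $ k)"
        unfolding tr[OF intX] tr[OF intb] by (intro sum.cong) auto
    qed
    then show ?thesis
      by (simp add: cond_exp_given_def F_def)
  qed
  then have "AE z in M. \<forall>k. cond_exp_given M snd Y z $ k = b (fst z) $ k"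
    by (subst AE_all_countable) auto
  then have "AE z in M. cond_exp_given M snd Y z = b (fst z)"
    by (simp add: vec_eq_iff)
  then have "law M (cond_exp_given M snd Y) = law M (\<lambda>z. b (fst z))"
    by (intro distr_cong_AE cond_exp_given_measurable) auto
  \<comment> \<open>The pairs live on the type \<open>nat \<times> (real ^ 'd)\<close>, which is not
    the one in the hypothesis on \<open>G\<close>, hence the transfer.\<close>
  moreover have "G (law M (cond_exp_given M snd Y)) \<le> G (law M snd)"
    using cond_exp_decreasing_transfer[OF G, where 'w = "nat \<times> (real ^ 'd)"] M.prob_space_axioms XL YL
    unfolding cond_exp_decreasing_def by blast
  ultimately show ?thesis
    unfolding b_def[symmetric] by (simp add: lawsnd lawfst)
qed

text \<open>Jensen for the probability density \<open>N * w\<close>. With \<open>?v\<close> the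
  barycentre minus \<open>x\<close>, its squared norm is \<open>N\<close> times the integral of
  \<open>w y * (?v \<bullet> (y - x))\<close>; Young's inequality bounds this by half of the squared
  norm plus half of the claimed bound, and the first half is absorbed.\<close>

lemma barycentre_norm_le:
  fixes w :: "real ^ 'd \<Rightarrow> real"
  assumes \<nu>: "\<nu> \<in> P2" and N: "N \<ge> 1"
    and wm: "w \<in> borel_measurable borel" and w0: "\<And>y. w y \<ge> 0" and w1: "\<And>y. w y \<le> 1"
    and wN: "(LINT y|\<nu>. w y) = 1 / N"
  shows "(norm (real N *\<^sub>R (LINT y|\<nu>. w y *\<^sub>R y) - x))\<^sup>2 \<le> N * (LINT y|\<nu>. w y * (norm (y - x))\<^sup>2)"
proof -
  interpret prob_space \<nu> using P2_D(1)[OF \<nu>] .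
  let ?v = "real N *\<^sub>R (LINT y|\<nu>. w y *\<^sub>R y) - x"
  have wi: "integrable \<nu> w"
    by (rule P2_integrable_bounded[OF \<nu> wm, of 1]) (use w0 w1 in auto)
  have wyi: "integrable \<nu> (\<lambda>y. w y *\<^sub>R y)"
    by (rule P2_weighted_integrable[OF \<nu> wm]) (use w0 w1 in auto)
  have wvi: "integrable \<nu> (\<lambda>y. w y * (?v \<bullet> (y - x)))"
  proof -
    have "integrable \<nu> (\<lambda>y. ?v \<bullet> (w y *\<^sub>R y) - w y * (?v \<bullet> x))"
      by (intro Bochner_Integration.integrable_diff integrable_inner_right integrable_mult_left wyi wi)
    then show ?thesis by (simp add: inner_diff_right right_diff_distrib)
  qed
  have wqi: "integrable \<nu> (\<lambda>y. w y * (norm (y - x))\<^sup>2)"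
  proof (rule Bochner_Integration.integrable_bound)
    show "integrable \<nu> (\<lambda>y. 2 * (norm y)\<^sup>2 + 2 * (norm x)\<^sup>2)"
      using P2_D(4)[OF \<nu>] by auto
    show "(\<lambda>y. w y * (norm (y - x))\<^sup>2) \<in> borel_measurable \<nu>"
      using wm by (intro P2_measurable[OF \<nu>]) simp
    have "\<bar>w y * (norm (y - x))\<^sup>2\<bar> \<le> 2 * (norm y)\<^sup>2 + 2 * (norm x)\<^sup>2" for y
    proof -
      have "\<bar>w y * (norm (y - x))\<^sup>2\<bar> \<le> 1 * (norm (y - x))\<^sup>2"
        unfolding abs_mult using w0[of y] w1[of y] by (intro mult_mono) auto
      with norm_diff_square_le[of y x] show ?thesis by simp
    qed
    then show "AE y in \<nu>. norm (w y * (norm (y - x))\<^sup>2) \<le> norm (2 * (norm y)\<^sup>2 + 2 * (norm x)\<^sup>2)"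
      unfolding real_norm_def by (intro AE_I2 order_trans[OF _ abs_ge_self])
  qed
  have "(norm ?v)\<^sup>2 = ?v \<bullet> (real N *\<^sub>R (LINT y|\<nu>. w y *\<^sub>R y) - x)"
    by (simp only: power2_norm_eq_inner)
  also have "\<dots> = N * ((LINT y|\<nu>. ?v \<bullet> (w y *\<^sub>R y)) - (LINT y|\<nu>. w y * (?v \<bullet> x)))"
  proof -
    have "(LINT y|\<nu>. ?v \<bullet> (w y *\<^sub>R y)) = ?v \<bullet> (LINT y|\<nu>. w y *\<^sub>R y)"
      by (rule integral_inner_right[OF wyi])
    moreover have "(LINT y|\<nu>. w y * (?v \<bullet> x)) = (1 / N) * (?v \<bullet> x)"
      using wi wN by simp
    ultimately show ?thesis
      using N by (simp only: inner_diff_right[of ?v] inner_scaleR_right right_diff_distrib) simp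
  qed
  also have "(LINT y|\<nu>. ?v \<bullet> (w y *\<^sub>R y)) - (LINT y|\<nu>. w y * (?v \<bullet> x)) = (LINT y|\<nu>. ?v \<bullet> (w y *\<^sub>R y) - w y * (?v \<bullet> x))"
    by (intro Bochner_Integration.integral_diff[symmetric] integrable_inner_right integrable_mult_left wyi wi)
  also have "\<dots> = (LINT y|\<nu>. w y * (?v \<bullet> (y - x)))"
    by (simp add: inner_diff_right[of ?v] right_diff_distrib)
  also have "\<dots> \<le> (LINT y|\<nu>. w y * ((1/2) * (norm ?v)\<^sup>2) + (1/2) * (w y * (norm (y - x))\<^sup>2))"
  proof (rule integral_mono[OF wvi])
    show "integrable \<nu> (\<lambda>y. w y * ((1/2) * (norm ?v)\<^sup>2) + (1/2) * (w y * (norm (y - x))\<^sup>2))"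
      by (intro Bochner_Integration.integrable_add integrable_mult_left integrable_mult_right wi wqi)
    fix y
    have "?v \<bullet> (y - x) \<le> (1/2) * (norm ?v)\<^sup>2 + (1/2) * (norm (y - x))\<^sup>2"
      using quadratic_HJ[of 1 ?v "y - x"] by simp
    from mult_left_mono[OF this w0[of y]]
    show "w y * (?v \<bullet> (y - x)) \<le> w y * ((1/2) * (norm ?v)\<^sup>2) + (1/2) * (w y * (norm (y - x))\<^sup>2)"
      by (simp add: distrib_left)
  qed
  also have "\<dots> = (1 / N) * ((1/2) * (norm ?v)\<^sup>2) + (1/2) * (LINT y|\<nu>. w y * (norm (y - x))\<^sup>2)"
    by (subst Bochner_Integration.integral_add)
       (use wi wqi wN in \<open>auto intro!: integrable_mult_left integrable_mult_right\<close>)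
  finally have "(norm ?v)\<^sup>2 \<le> N * ((1 / N) * ((1/2) * (norm ?v)\<^sup>2) + (1/2) * (LINT y|\<nu>. w y * (norm (y - x))\<^sup>2))"
    by (simp add: mult_left_mono)
  also have "\<dots> = (1/2) * (norm ?v)\<^sup>2 + (1/2) * (N * (LINT y|\<nu>. w y * (norm (y - x))\<^sup>2))"
    using N by (simp add: distrib_left)
  finally show ?thesis by simp
qed

section \<open>The particle value is at most the mean field value\<close>

lemma particle_value_le:
  fixes G :: "(real ^ 'd) measure \<Rightarrow> real"
  assumes bdd: "bdd_below (G ` P2)" and N: "N \<ge> 1" and \<alpha>: "\<And>i. i < N \<Longrightarrow> \<alpha> i \<in> L2_controls t T"
  shows "particle_value T G N t x \<le> particle_cost T G N t x \<alpha>"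
  unfolding particle_value_def
proof (rule cINF_lower)
  obtain L where L: "\<And>\<mu>. \<mu> \<in> P2 \<Longrightarrow> L \<le> G \<mu>"
    using bdd by (auto simp: bdd_below_def)
  show "bdd_below (particle_cost T G N t x ` {\<alpha>. \<forall>i<N. \<alpha> i \<in> L2_controls t T})"
  proof (rule bdd_belowI2)
    fix \<alpha> :: "nat \<Rightarrow> real \<Rightarrow> real ^ 'd"
    have "0 \<le> (1 / real N) * (\<Sum>i<N. LINT s:{t..T}|lborel. (1/2) * (norm (\<alpha> i s))\<^sup>2)"
      by (intro mult_nonneg_nonneg sum_nonneg) (auto simp: set_lebesgue_integral_def intro!: integral_nonneg_AE)
    with L[OF empirical_P2[OF N]] show "L \<le> particle_cost T G N t x \<alpha>"
      by (auto simp: particle_cost_def intro: add_increasing)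
  qed
qed (use \<alpha> in auto)

lemma integral_Icc_const:
  fixes c :: "'a::{banach, second_countable_topology}"
  shows "a \<le> b \<Longrightarrow> (LINT s:{a..b}|lborel. c) = (b - a) *\<^sub>R c"
  by (simp add: set_lebesgue_integral_def)

lemma particle_value_le_line:
  fixes G :: "(real ^ 'd) measure \<Rightarrow> real"
  assumes bdd: "bdd_below (G ` P2)" and N: "N \<ge> 1" and tT: "t < T"
  shows "particle_value T G N t x \<le> (1 / N) * (\<Sum>i<N. (norm (y i - x i))\<^sup>2 / (2 * (T - t))) + G (empirical N y)"
proof -
  let ?\<alpha> = "\<lambda>i s. (1 / (T - t)) *\<^sub>R (y i - x i)"
  have "?\<alpha> i \<in> L2_controls t T" for i
    unfolding L2_controls_def set_borel_measurable_def
    by (auto intro!: borel_integrable_atLeastAtMost')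
  from particle_value_le[OF bdd N this]
  have "particle_value T G N t x \<le> particle_cost T G N t x ?\<alpha>" .
  also have "(\<lambda>i. trajectory t (x i) (?\<alpha> i) T) = y"
    using tT by (auto simp: trajectory_def integral_Icc_const)
  then have "particle_cost T G N t x ?\<alpha> = (1 / N) * (\<Sum>i<N. (T - t) *\<^sub>R ((1/2) * (norm ((1 / (T - t)) *\<^sub>R (y i - x i)))\<^sup>2)) + G (empirical N y)"
    using tT by (simp add: particle_cost_def integral_Icc_const)
  also have "(\<lambda>i. (T - t) *\<^sub>R ((1/2) * (norm ((1 / (T - t)) *\<^sub>R (y i - x i)))\<^sup>2)) = (\<lambda>i. (norm (y i - x i))\<^sup>2 / (2 * (T - t)))"
  proof
    fix i
    have "r *\<^sub>R ((1/2) * (norm ((1 / r) *\<^sub>R v))\<^sup>2) = (norm v)\<^sup>2 / (2 * r)" if "r > 0" for r and v :: "real ^ 'd"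
      using that by (simp add: power2_eq_square)
    then show "(T - t) *\<^sub>R ((1/2) * (norm ((1 / (T - t)) *\<^sub>R (y i - x i)))\<^sup>2) = (norm (y i - x i))\<^sup>2 / (2 * (T - t))"
      using tT by simp
  qed
  finally show ?thesis .
qed

lemma particle_value_le_mf_cost:
  fixes G :: "(real ^ 'd) measure \<Rightarrow> real"
  assumes bdd: "bdd_below (G ` P2)" and G: "cond_exp_decreasing TYPE((real ^ 'd) \<times> (real ^ 'd)) G"
    and N: "N \<ge> 1" and tT: "t < T" and adm: "(m, \<alpha>) \<in> mf_admissible T t (empirical N x)"
  shows "particle_value T G N t x \<le> mf_cost T G t m \<alpha>"
proof -
  have AC: "AC_curve t T m" and \<alpha>: "\<alpha> \<in> L2_fields t T m" and CE: "continuity_equation t T m \<alpha>"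
    and m0: "m t = empirical N x"
    using adm by (auto simp: mf_admissible_def)
  define C where "C = (LINT s:{t..T}|lborel. LINT x|m s. (1/2) * (norm (\<alpha> s x))\<^sup>2)"
  let ?\<tau> = "T - t" and ?\<nu> = "m T"
  have \<nu>: "?\<nu> \<in> P2" using AC_curve_P2[OF AC] tT by auto
  interpret prob_space ?\<nu> using P2_D(1)[OF \<nu>] .
  \<comment> \<open>The dual bound measures transport over the horizon \<open>e + ?\<tau>\<close>,
    while the particles travel for \<open>?\<tau>\<close>: the ratio of the two is the factor, and
    \<open>ln N / \<beta>\<close> is the entropic error.\<close>
  have bound: "particle_value T G N t x \<le> ((?\<tau> + e) / ?\<tau>) * (C + ln N / \<beta>) + G ?\<nu>" if e: "e > 0" and \<beta>: "\<beta> > 0" for e \<beta>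
  proof -
    define c where "c i y = (norm (y - x i))\<^sup>2 / (2 * (e + ?\<tau>))" for i and y :: "real ^ 'd"
    have cm: "c i \<in> borel_measurable borel" for i unfolding c_def by measurable
    have ci: "integrable ?\<nu> (c i)" for i
    proof (rule Bochner_Integration.integrable_bound)
      show "integrable ?\<nu> (\<lambda>y. (2 * (norm y)\<^sup>2 + 2 * (norm (x i))\<^sup>2) / (2 * (e + ?\<tau>)))"
        using P2_D(4)[OF \<nu>] by auto
      show "c i \<in> borel_measurable ?\<nu>" by (rule P2_measurable[OF \<nu> cm])
      have "\<bar>c i y\<bar> \<le> (2 * (norm y)\<^sup>2 + 2 * (norm (x i))\<^sup>2) / (2 * (e + ?\<tau>))" for y
        using e tT norm_diff_square_le[of y "x i"] by (auto simp: c_def intro!: divide_right_mono)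
      then show "AE y in ?\<nu>. norm (c i y) \<le> norm ((2 * (norm y)\<^sup>2 + 2 * (norm (x i))\<^sup>2) / (2 * (e + ?\<tau>)))"
        unfolding real_norm_def by (intro AE_I2 order_trans[OF _ abs_ge_self])
    qed
    obtain \<psi> where q': "\<forall>i<N. (LINT y|?\<nu>. softw \<beta> N (\<lambda>i. \<psi> i - c i y) i) = 1 / N"
      and cost: "(\<Sum>i<N. LINT y|?\<nu>. softw \<beta> N (\<lambda>i. \<psi> i - c i y) i * c i y)
        \<le> (\<Sum>i<N. \<psi> i) / N - (LINT y|?\<nu>. smax \<beta> N (\<lambda>i. \<psi> i - c i y)) + ln N / \<beta>"
      using entropic_potential[where c = c, OF prob_space_axioms ci N \<beta>] by blast
    have q: "(LINT y|?\<nu>. softw \<beta> N (\<lambda>i. \<psi> i - c i y) i) = 1 / N" if "i < N" for i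
      using q' that by blast
    have "(\<Sum>i<N. \<psi> i) / N - (LINT y|?\<nu>. smax \<beta> N (\<lambda>i. \<psi> i - c i y)) \<le> C"
      unfolding C_def c_def by (rule dual_value_le[OF AC tT \<alpha> CE m0 N \<beta> e])
    with cost have cost': "(\<Sum>i<N. LINT y|?\<nu>. softw \<beta> N (\<lambda>i. \<psi> i - c i y) i * c i y) \<le> C + ln N / \<beta>"
      by linarith
    define w where "w i y = softw \<beta> N (\<lambda>i. \<psi> i - c i y) i" for i y
    define b where "b i = real N *\<^sub>R (LINT y|?\<nu>. w i y *\<^sub>R y)" for i
    have wm: "w i \<in> borel_measurable borel" for i
      using cm unfolding w_def softw_def by measurable
    have w0: "w i y \<ge> 0" for i y
      using softw_pos[OF N] less_imp_le unfolding w_def by blast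
    have w1: "(\<Sum>i<N. w i y) = 1" for y
      unfolding w_def by (rule softw_sum[OF N])
    have wle: "w i y \<le> 1" if "i < N" for i y
      unfolding w_def by (rule softw_le_1[OF N that])
    have "G (empirical N b) \<le> G ?\<nu>"
      unfolding b_def[abs_def] by (rule barycentres_decrease[OF G \<nu> N wm w0 w1]) (use q in \<open>simp add: w_def\<close>)
    moreover have "(1 / N) * (\<Sum>i<N. (norm (b i - x i))\<^sup>2 / (2 * ?\<tau>)) \<le> ((?\<tau> + e) / ?\<tau>) * (C + ln N / \<beta>)"
    proof -
      have "(1 / N) * (\<Sum>i<N. (norm (b i - x i))\<^sup>2 / (2 * ?\<tau>)) = (\<Sum>i<N. (1 / N) * ((norm (b i - x i))\<^sup>2 / (2 * ?\<tau>)))"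
        by (simp add: sum_distrib_left)
      also have "\<dots> \<le> (\<Sum>i<N. ((?\<tau> + e) / ?\<tau>) * (LINT y|?\<nu>. w i y * c i y))"
      proof (rule sum_mono)
        fix i assume "i \<in> {..<N}"
        then have i: "i < N" by simp
        \<comment> \<open>The factor \<open>N\<close> from Jensen cancels against the weight
          \<open>1 / N\<close> of a particle.\<close>
        have "(norm (b i - x i))\<^sup>2 \<le> N * (LINT y|?\<nu>. w i y * (norm (y - x i))\<^sup>2)"
          unfolding b_def by (rule barycentre_norm_le[OF \<nu> N wm w0 wle[OF i]]) (use q[OF i] in \<open>simp add: w_def\<close>)
        also have "(\<lambda>y. w i y * (norm (y - x i))\<^sup>2) = (\<lambda>y. (2 * (e + ?\<tau>)) * (w i y * c i y))"
          using e tT by (auto simp: c_def fun_eq_iff)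
        finally have "(norm (b i - x i))\<^sup>2 \<le> N * (2 * (e + ?\<tau>)) * (LINT y|?\<nu>. w i y * c i y)"
          by (simp add: mult.assoc)
        moreover have *: "(2 * p) * I / (2 * q) = (p / q) * I" for p I q :: real by simp
        ultimately have "(1 / N) * (norm (b i - x i))\<^sup>2 \<le> (1 / N) * (N * (2 * (e + ?\<tau>)) * (LINT y|?\<nu>. w i y * c i y))"
          by (intro mult_left_mono) auto
        then have "(1 / N) * (norm (b i - x i))\<^sup>2 / (2 * ?\<tau>) \<le> (2 * (e + ?\<tau>)) * (LINT y|?\<nu>. w i y * c i y) / (2 * ?\<tau>)"
          using N tT by (intro divide_right_mono) auto
        then show "(1 / N) * ((norm (b i - x i))\<^sup>2 / (2 * ?\<tau>)) \<le> ((?\<tau> + e) / ?\<tau>) * (LINT y|?\<nu>. w i y * c i y)"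
          by (simp only: * times_divide_eq_right add.commute[of e])
      qed
      also have "\<dots> = ((?\<tau> + e) / ?\<tau>) * (\<Sum>i<N. LINT y|?\<nu>. w i y * c i y)"
        by (rule sum_distrib_left[symmetric])
      also have "\<dots> \<le> ((?\<tau> + e) / ?\<tau>) * (C + ln N / \<beta>)"
        using cost' tT e unfolding w_def by (intro mult_left_mono) auto
      finally show ?thesis .
    qed
    ultimately show ?thesis
      using particle_value_le_line[OF bdd N tT, of x b] by linarith
  qed
  \<comment> \<open>One sequence removes both errors: \<open>e\<close> is \<open>1 / (n + 1)\<close>
    and \<open>\<beta>\<close> is \<open>n + 1\<close>.\<close>
  have "(\<lambda>n. ((?\<tau> + inverse (real (Suc n))) / ?\<tau>) * (C + ln N * inverse (real (Suc n))) + G ?\<nu>)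
      \<longlonglongrightarrow> ((?\<tau> + 0) / ?\<tau>) * (C + ln N * 0) + G ?\<nu>"
    using tT by (intro tendsto_intros LIMSEQ_inverse_real_of_nat) auto
  then have "particle_value T G N t x \<le> ((?\<tau> + 0) / ?\<tau>) * (C + ln N * 0) + G ?\<nu>"
  proof (rule LIMSEQ_le_const, intro exI allI impI)
    fix n
    show "particle_value T G N t x \<le> ((?\<tau> + inverse (real (Suc n))) / ?\<tau>) * (C + ln N * inverse (real (Suc n))) + G ?\<nu>"
      using bound[of "inverse (real (Suc n))" "real (Suc n)"] by (simp add: divide_inverse)
  qed
  then show ?thesis
    using tT by (simp add: mf_cost_def C_def)
qed

section \<open>The mean field value is at most the particle value\<close>

lemma nn_integral_empirical_le:
  assumes N: "N \<ge> 1" and f: "f \<in> borel_measurable borel" and le: "\<And>x. f x \<le> c"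
  shows "(\<integral>\<^sup>+x. f x \<partial>empirical N z) \<le> c"
proof -
  interpret prob_space "empirical N z" using P2_D(1)[OF empirical_P2[OF N]] .
  have "(\<integral>\<^sup>+x. f x \<partial>empirical N z) \<le> (\<integral>\<^sup>+x. c \<partial>empirical N z)"
    by (intro nn_integral_mono le)
  also have "\<dots> = c" by (simp add: emeasure_space_1)
  finally show ?thesis .
qed

section \<open>Particles on straight lines as a mean field competitor\<close>

context
  fixes N :: nat and a :: real and X V :: "nat \<Rightarrow> real ^ 'd"
begin

definition line :: "nat \<Rightarrow> real \<Rightarrow> real ^ 'd" where
  "line i t = X i + (t - a) *\<^sub>R V i"

text \<open>Zero where no particle passes, by division by zero.\<close>

definition line_field :: "real \<Rightarrow> real ^ 'd \<Rightarrow> real ^ 'd" where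
  "line_field t x = (1 / (\<Sum>i<N. if x = line i t then 1 else 0)) *\<^sub>R (\<Sum>i<N. if x = line i t then V i else 0)"

definition line_law :: "real \<Rightarrow> (real ^ 'd) measure" where
  "line_law t = empirical N (\<lambda>i. line i t)"

lemma line_measurable[measurable]: "line i \<in> borel_measurable borel"
  unfolding line_def[abs_def] by measurable

lemma line_field_measurable: "case_prod line_field \<in> borel_measurable (borel \<Otimes>\<^sub>M borel)"
  unfolding line_field_def[abs_def] by measurable

lemma line_field_norm_le: "norm (line_field t x) \<le> (\<Sum>i<N. norm (V i))"
proof -
  let ?k = "\<Sum>i<N. if x = line i t then 1 else 0 :: real"
  have V: "norm (\<Sum>i<N. if x = line i t then V i else 0) \<le> (\<Sum>i<N. norm (V i))"
    by (rule order_trans[OF norm_sum]) (auto intro!: sum_mono)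
  have k: "?k = real (card {i. i < N \<and> x = line i t})"
    by (simp add: sum.If_cases Int_def)
  \<comment> \<open>\<open>?k\<close> counts particles, so the quotient is at most 1; for a count of
    0 it is 0 by convention.\<close>
  have "1 / ?k \<le> 1" "0 \<le> 1 / ?k"
    unfolding k by (auto simp: divide_le_eq)
  then have "norm (line_field t x) \<le> 1 * (\<Sum>i<N. norm (V i))"
    unfolding line_field_def norm_scaleR using V by (intro mult_mono) auto
  then show ?thesis by simp
qed

text \<open>A point occupied by several particles carries the average of their velocities, which can
  be wrong for one of them only if it meets another with a different velocity. Each such pair meets
  at most once; particles that stay together share their velocity and do no harm.\<close>

lemma line_field_AE: "AE t in lborel. \<forall>i<N. line_field t (line i t) = V i"
proof -
  let ?bad = "\<Union>i<N. \<Union>j<N. {t. line i t = line j t \<and> V i \<noteq> V j}"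
  have "finite {t. line i t = line j t \<and> V i \<noteq> V j}" for i j
  proof (cases "\<exists>s. line i s = line j s \<and> V i \<noteq> V j")
    case True
    then obtain s where s: "line i s = line j s" "V i \<noteq> V j" by blast
    have "t = s" if "line i t = line j t" for t
    proof -
      have "(t - s) *\<^sub>R V i = line i t - line i s"
        by (simp add: line_def algebra_simps)
      also have "\<dots> = line j t - line j s" using that s by simp
      also have "\<dots> = (t - s) *\<^sub>R V j"
        by (simp add: line_def algebra_simps)
      finally show ?thesis using s(2) by simp
    qed
    then have "{t. line i t = line j t \<and> V i \<noteq> V j} \<subseteq> {s}" by auto
    then show ?thesis by (rule finite_subset) simp
  next
    case False
    then have "{t. line i t = line j t \<and> V i \<noteq> V j} = {}" by blast
    then show ?thesis by (rule ssubst) simp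
  qed
  then have "finite ?bad" by auto
  then have "AE t in lborel. t \<notin> ?bad"
    by (intro AE_not_in finite_imp_null_set_lborel)
  then show ?thesis
  proof (rule AE_mp, intro AE_I2 impI allI)
    fix t i assume t: "t \<notin> ?bad" and i: "i < N"
    let ?k = "\<Sum>j<N. if line i t = line j t then 1 else 0 :: real"
    have "?k > 0"
      using i by (intro sum_pos2[of _ i]) auto
    have "(\<Sum>j<N. if line i t = line j t then V j else 0) = (\<Sum>j<N. (if line i t = line j t then 1 else 0 :: real) *\<^sub>R V i)"
    proof (rule sum.cong)
      fix j assume j: "j \<in> {..<N}"
      have "V j = V i" if "line i t = line j t"
      proof (rule ccontr)
        assume "V j \<noteq> V i"
        then have "t \<in> {t. line i t = line j t \<and> V i \<noteq> V j}" using that by simp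
        then have "t \<in> ?bad" using i j by (intro UN_I[of i] UN_I[of j]) simp_all
        with t show False by (rule notE)
      qed
      then show "(if line i t = line j t then V j else 0) = (if line i t = line j t then 1 else 0 :: real) *\<^sub>R V i"
        by simp
    qed simp
    also have "\<dots> = ?k *\<^sub>R V i"
      by (rule scaleR_left.sum[symmetric])
    finally show "line_field t (line i t) = V i"
      unfolding line_field_def using \<open>?k > 0\<close> by simp
  qed
qed

text \<open>Keeping the index couples the empirical measures at two times. The mean squared
  displacement is \<open>(t - s)^2\<close> times the mean squared speed, so the root mean square
  speed serves as the dominating function.\<close>

lemma line_law_AC:
  assumes N: "N \<ge> 1" and ab: "a \<le> b"
  shows "AC_curve a b line_law"
proof -
  define c where "c = sqrt ((1 / N) * (\<Sum>i<N. (norm (V i))\<^sup>2))"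
  have "W2 (line_law s) (line_law t) \<le> (LINT r:{s..t}|lborel. c)" if st: "s \<le> t" for s t
  proof -
    define \<gamma> where "\<gamma> = distr (uniform_count_measure {..<N}) (borel \<Otimes>\<^sub>M borel) (\<lambda>i. (line i s, line i t))"
    have "\<gamma> \<in> couplings (line_law s) (line_law t)"
      unfolding couplings_def \<gamma>_def line_law_def empirical_def
      by (auto simp: distr_distr comp_def space_pair_measure measurable_def[of "uniform_count_measure {..<N}"])
    then have "W2 (line_law s) (line_law t) \<le> sqrt (LINT z|\<gamma>. (norm (fst z - snd z))\<^sup>2)"
      by (rule W2_le_coupling)
    also have "(LINT z|\<gamma>. (norm (fst z - snd z))\<^sup>2) = (LINT i|uniform_count_measure {..<N}. (norm (line i s - line i t))\<^sup>2)"
      unfolding \<gamma>_def by (subst integral_distr) (auto simp: space_pair_measure measurable_def[of "uniform_count_measure {..<N}"])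
    also have "\<dots> = (1 / N) * (\<Sum>i<N. (norm (line i s - line i t))\<^sup>2)"
      by (simp add: integral_uniform_count_measure)
    also have "(\<lambda>i. (norm (line i s - line i t))\<^sup>2) = (\<lambda>i. (t - s)\<^sup>2 * (norm (V i))\<^sup>2)"
    proof
      fix i
      have "line i s - line i t = (s - t) *\<^sub>R V i"
        by (simp add: line_def algebra_simps)
      then show "(norm (line i s - line i t))\<^sup>2 = (t - s)\<^sup>2 * (norm (V i))\<^sup>2"
        by (simp add: power_mult_distrib power2_commute)
    qed
    also have "(1 / N) * (\<Sum>i<N. (t - s)\<^sup>2 * (norm (V i))\<^sup>2) = (t - s)\<^sup>2 * ((1 / N) * (\<Sum>i<N. (norm (V i))\<^sup>2))"
      by (simp add: sum_distrib_left)
    also have "sqrt \<dots> = (t - s) * c"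
      unfolding c_def real_sqrt_mult using st by simp
    also have "\<dots> = (LINT r:{s..t}|lborel. c)"
      using st by (simp add: integral_Icc_const)
    finally show ?thesis .
  qed
  moreover have "set_integrable lborel {a..b} (\<lambda>r. c)"
    by (rule borel_integrable_atLeastAtMost') auto
  ultimately show ?thesis
    unfolding AC_curve_def using empirical_P2[OF N] by (auto simp: line_law_def)
qed

lemma line_field_L2:
  assumes N: "N \<ge> 1"
  shows "line_field \<in> L2_fields a b line_law"
proof -
  note [measurable] = line_field_measurable
  let ?B = "ennreal ((\<Sum>i<N. norm (V i))\<^sup>2)"
  have "(\<integral>\<^sup>+t\<in>{a..b}. (\<integral>\<^sup>+x. ennreal ((norm (line_field t x))\<^sup>2) \<partial>line_law t) \<partial>lborel)
      \<le> (\<integral>\<^sup>+t\<in>{a..b}. ?B \<partial>lborel)"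
    unfolding line_law_def
    by (intro nn_integral_mono mult_right_mono nn_integral_empirical_le N ennreal_leI power_mono line_field_norm_le)
       auto
  also have "\<dots> < \<infinity>"
    by (simp add: nn_integral_cmult ennreal_mult_less_top emeasure_lborel_Icc_eq)
  finally show ?thesis
    using line_field_measurable by (simp add: L2_fields_def)
qed

text \<open>Along each line the integrand is, at almost every time, the total derivative of the test
  function. It integrates to the difference of the end values, both 0 because the support lies
  strictly between \<open>a\<close> and \<open>b\<close>.\<close>

lemma line_continuity_equation:
  assumes N: "N \<ge> 1" and ab: "a \<le> b"
  shows "continuity_equation a b line_law line_field"
  unfolding continuity_equation_def
proof
  fix \<phi> :: "real \<times> (real ^ 'd) \<Rightarrow> real" assume \<phi>: "\<phi> \<in> test_functions a b"
  define h where "h z = frechet_derivative \<phi> (at z) (1, 0) + frechet_derivative \<phi> (at z) (0, case_prod line_field z)" for z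
  have hm[measurable]: "h \<in> borel_measurable (borel \<Otimes>\<^sub>M borel)"
    unfolding h_def[abs_def] by (rule test_functions_deriv_measurable[OF \<phi> line_field_measurable])
  have hx: "(\<lambda>x. h (t, x)) \<in> borel_measurable borel" for t
    by measurable
  let ?D = "\<lambda>i t. frechet_derivative \<phi> (at (t, line i t)) (1, V i)"
  have Dc: "continuous_on S (?D i)" for i S
    by (rule continuous_on_compose2[OF test_functions_D(4)[OF \<phi>, of UNIV]])
       (auto simp: line_def[abs_def] intro!: continuous_intros)
  have D: "((\<lambda>t. ?D i t) has_integral 0) {a..b}" for i
  proof -
    have "((\<lambda>t. \<phi> (t, line i t)) has_vector_derivative ?D i t) (at t within {a..b})" for t
    proof -
      have "((\<lambda>t. (t, line i t)) has_derivative (\<lambda>s. (s, s *\<^sub>R V i))) (at t within {a..b})"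
        unfolding line_def[abs_def] by (auto intro!: derivative_eq_intros)
      from has_derivative_compose[OF this test_functions_D(5)[OF \<phi>]]
      have "((\<lambda>t. \<phi> (t, line i t)) has_derivative
          (\<lambda>s. frechet_derivative \<phi> (at (t, line i t)) (s, s *\<^sub>R V i))) (at t within {a..b})" .
      moreover have "frechet_derivative \<phi> (at (t, line i t)) (s, s *\<^sub>R V i) = s *\<^sub>R ?D i t" for s
        using linear_scale[OF test_functions_D(3)[OF \<phi>], of "(t, line i t)" s "(1, V i)"] by simp
      ultimately show ?thesis by (simp add: has_vector_derivative_def)
    qed
    from fundamental_theorem_of_calculus[OF ab this]
    have "((\<lambda>t. ?D i t) has_integral (\<phi> (b, line i b) - \<phi> (a, line i a))) {a..b}" by blast
    moreover have "\<phi> (b, line i b) = 0" "\<phi> (a, line i a) = 0"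
    proof -
      obtain K where K: "K \<subseteq> {a<..<b} \<times> UNIV" "\<And>z. z \<notin> K \<Longrightarrow> \<phi> z = 0"
        using \<phi> unfolding test_functions_def by blast
      show "\<phi> (b, line i b) = 0" "\<phi> (a, line i a) = 0"
        using K(1) by (auto intro!: K(2))
    qed
    ultimately show ?thesis by simp
  qed
  have "(LINT t:{a..b}|lborel. LINT x|line_law t. h (t, x)) = (LINT t:{a..b}|lborel. (1 / N) * (\<Sum>i<N. h (t, line i t)))"
    unfolding line_law_def integral_empirical[OF hx] ..
  also have "\<dots> = (LINT t:{a..b}|lborel. (1 / N) * (\<Sum>i<N. ?D i t))"
    unfolding set_lebesgue_integral_def
  proof (rule integral_cong_AE)
    have Dm: "?D i \<in> borel_measurable borel" for i
      by (rule borel_measurable_continuous_onI[OF Dc])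
    show "(\<lambda>t. indicator {a..b} t *\<^sub>R ((1 / N) * (\<Sum>i<N. ?D i t))) \<in> borel_measurable lborel"
      using Dm by measurable
    show "(\<lambda>t. indicator {a..b} t *\<^sub>R ((1 / N) * (\<Sum>i<N. h (t, line i t)))) \<in> borel_measurable lborel"
      by measurable
    show "AE t in lborel. indicator {a..b} t *\<^sub>R ((1 / N) * (\<Sum>i<N. h (t, line i t))) = indicator {a..b} t *\<^sub>R ((1 / N) * (\<Sum>i<N. ?D i t))"
      using line_field_AE
    proof eventually_elim
      case (elim t)
      have "(\<Sum>i<N. h (t, line i t)) = (\<Sum>i<N. ?D i t)"
        using elim by (intro sum.cong) (auto simp: h_def linear_split_pair[OF test_functions_D(3)[OF \<phi>]])
      then show ?case by simp
    qed
  qed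
  also have "\<dots> = integral {a..b} (\<lambda>t. (1 / N) * (\<Sum>i<N. ?D i t))"
    by (intro set_borel_integral_eq_integral(2) borel_integrable_atLeastAtMost' continuous_intros Dc)
  also have "\<dots> = 0"
  proof (rule integral_unique)
    have "((\<lambda>t. \<Sum>i<N. ?D i t) has_integral (\<Sum>i<N. 0)) {a..b}"
      by (intro has_integral_sum D) auto
    from has_integral_mult_right[OF this, of "1 / N"]
    show "((\<lambda>t. (1 / N) * (\<Sum>i<N. ?D i t)) has_integral 0) {a..b}" by simp
  qed
  finally show "(LINT t:{a..b}|lborel. LINT x|line_law t.
      frechet_derivative \<phi> (at (t, x)) (1, 0) + frechet_derivative \<phi> (at (t, x)) (0, line_field t x)) = 0"
    by (simp add: h_def)
qed

lemma line_admissible: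
  assumes "N \<ge> 1" "a \<le> b"
  shows "(line_law, line_field) \<in> mf_admissible b a (empirical N X)"
  using line_law_AC[OF assms] line_field_L2[OF assms(1)] line_continuity_equation[OF assms]
  by (simp add: mf_admissible_def) (simp add: line_law_def line_def)

lemma line_cost:
  assumes N: "N \<ge> 1" and ab: "a \<le> b"
  shows "mf_cost b G a line_law line_field
    = (1 / N) * (\<Sum>i<N. (b - a) * ((1/2) * (norm (V i))\<^sup>2)) + G (empirical N (\<lambda>i. X i + (b - a) *\<^sub>R V i))"
proof -
  note [measurable] = line_field_measurable
  have fm: "(\<lambda>x. (1/2) * (norm (line_field t x))\<^sup>2) \<in> borel_measurable borel" for t
    by measurable
  have "(LINT t:{a..b}|lborel. LINT x|line_law t. (1/2) * (norm (line_field t x))\<^sup>2)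
      = (LINT t:{a..b}|lborel. (1 / N) * (\<Sum>i<N. (1/2) * (norm (line_field t (line i t)))\<^sup>2))"
    unfolding line_law_def integral_empirical[OF fm] ..
  also have "\<dots> = (LINT t:{a..b}|lborel. (1 / N) * (\<Sum>i<N. (1/2) * (norm (V i))\<^sup>2))"
    unfolding set_lebesgue_integral_def
  proof (rule integral_cong_AE)
    show "(\<lambda>t. indicator {a..b} t *\<^sub>R ((1 / N) * (\<Sum>i<N. (1/2) * (norm (line_field t (line i t)))\<^sup>2))) \<in> borel_measurable lborel"
      by measurable
    show "AE t in lborel. indicator {a..b} t *\<^sub>R ((1 / N) * (\<Sum>i<N. (1/2) * (norm (line_field t (line i t)))\<^sup>2))
        = indicator {a..b} t *\<^sub>R ((1 / N) * (\<Sum>i<N. (1/2) * (norm (V i))\<^sup>2))"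
      using line_field_AE by eventually_elim simp
  qed measurable
  also have "\<dots> = (1 / N) * (\<Sum>i<N. (b - a) * ((1/2) * (norm (V i))\<^sup>2))"
    using ab by (simp add: integral_Icc_const sum_distrib_left)
  finally show ?thesis
    by (simp add: mf_cost_def line_law_def line_def)
qed

end

text \<open>Jensen: among the controls with given end point, the constant one is cheapest.\<close>

lemma control_cost_ge:
  fixes \<alpha> :: "real \<Rightarrow> real ^ 'd"
  assumes \<alpha>: "\<alpha> \<in> L2_controls a b" and ab: "a < b"
  defines "v \<equiv> (1 / (b - a)) *\<^sub>R (LINT t:{a..b}|lborel. \<alpha> t)"
  shows "(b - a) * ((1/2) * (norm v)\<^sup>2) \<le> (LINT t:{a..b}|lborel. (1/2) * (norm (\<alpha> t))\<^sup>2)"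
proof -
  have m: "set_borel_measurable lborel {a..b} \<alpha>" and i2: "set_integrable lborel {a..b} (\<lambda>t. (norm (\<alpha> t))\<^sup>2)"
    using \<alpha> by (auto simp: L2_controls_def)
  have ic: "set_integrable lborel {a..b} (\<lambda>t. c)" for c :: real
    by (rule borel_integrable_atLeastAtMost') auto
  have i1: "set_integrable lborel {a..b} \<alpha>"
    unfolding set_integrable_def
  proof (rule Bochner_Integration.integrable_bound)
    show "integrable lborel (\<lambda>t. indicator {a..b} t *\<^sub>R (1 + (norm (\<alpha> t))\<^sup>2))"
      using set_integral_add(1)[OF ic[of 1] i2] by (simp add: set_integrable_def)
    show "(\<lambda>t. indicator {a..b} t *\<^sub>R \<alpha> t) \<in> borel_measurable lborel"
      using m by (simp add: set_borel_measurable_def)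
    show "AE t in lborel. norm (indicator {a..b} t *\<^sub>R \<alpha> t) \<le> norm (indicator {a..b} t *\<^sub>R (1 + (norm (\<alpha> t))\<^sup>2))"
      using norm_le_1_plus_square by (intro AE_I2) (auto simp: indicator_def abs_of_nonneg)
  qed
  have iv: "set_integrable lborel {a..b} (\<lambda>t. v \<bullet> \<alpha> t)"
    using integrable_inner_right[of v lborel "\<lambda>t. indicator {a..b} t *\<^sub>R \<alpha> t"] i1
    by (simp add: set_integrable_def)
  have LV: "(LINT t:{a..b}|lborel. v \<bullet> \<alpha> t) = v \<bullet> (LINT t:{a..b}|lborel. \<alpha> t)"
    using integral_inner_right[of v lborel "\<lambda>t. indicator {a..b} t *\<^sub>R \<alpha> t"] i1
    by (simp add: set_integrable_def set_lebesgue_integral_def)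
  have "(LINT t:{a..b}|lborel. \<alpha> t) = (b - a) *\<^sub>R v"
    using ab by (simp add: v_def)
  with LV have "(LINT t:{a..b}|lborel. v \<bullet> \<alpha> t) = (b - a) * (norm v)\<^sup>2"
    by (simp add: power2_norm_eq_inner)
  moreover have "(LINT t:{a..b}|lborel. (1/2) * (norm v)\<^sup>2) = (b - a) * ((1/2) * (norm v)\<^sup>2)"
    using ab by (simp add: integral_Icc_const)
  \<comment> \<open>The integrand on the right is the tangent at \<open>v\<close> of half the
    squared norm, evaluated at \<open>\<alpha> t\<close>; as \<open>v\<close> is the mean of
    \<open>\<alpha>\<close>, the integral is the same as for the constant control
    \<open>v\<close>.\<close>
  ultimately have "(b - a) * ((1/2) * (norm v)\<^sup>2) = (LINT t:{a..b}|lborel. v \<bullet> \<alpha> t - (1/2) * (norm v)\<^sup>2)"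
    by (simp add: set_integral_diff(2)[OF iv ic])
  also have "\<dots> \<le> (LINT t:{a..b}|lborel. (1/2) * (norm (\<alpha> t))\<^sup>2)"
  proof (rule set_integral_mono)
    show "set_integrable lborel {a..b} (\<lambda>t. v \<bullet> \<alpha> t - (1/2) * (norm v)\<^sup>2)"
      by (rule set_integral_diff(1)[OF iv ic])
    show "set_integrable lborel {a..b} (\<lambda>t. (1/2) * (norm (\<alpha> t))\<^sup>2)"
      using i2 by (intro set_integrable_mult_right)
    show "v \<bullet> \<alpha> t - (1/2) * (norm v)\<^sup>2 \<le> (1/2) * (norm (\<alpha> t))\<^sup>2" for t
      using quadratic_HJ[of 1 v "\<alpha> t"] by simp
  qed
  finally show ?thesis .
qed

lemma mf_value_le:
  assumes bdd: "bdd_below (G ` P2)" and tT: "t \<le> T" and adm: "(m, \<alpha>) \<in> mf_admissible T t m0"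
  shows "mf_value T G t m0 \<le> mf_cost T G t m \<alpha>"
proof -
  obtain L where L: "\<And>\<mu>. \<mu> \<in> P2 \<Longrightarrow> L \<le> G \<mu>"
    using bdd by (auto simp: bdd_below_def)
  have "bdd_below ((\<lambda>(m, \<alpha>). mf_cost T G t m \<alpha>) ` mf_admissible T t m0)"
  proof (rule bdd_belowI2)
    fix p assume p: "p \<in> mf_admissible T t m0"
    obtain m \<alpha> where [simp]: "p = (m, \<alpha>)" by (cases p)
    have "m T \<in> P2"
      using p tT AC_curve_P2[of t T m T] by (auto simp: mf_admissible_def)
    moreover have "0 \<le> (LINT s:{t..T}|lborel. LINT x|m s. (1/2) * (norm (\<alpha> s x))\<^sup>2)"
      unfolding set_lebesgue_integral_def
      by (intro integral_nonneg_AE AE_I2) (auto intro!: scaleR_nonneg_nonneg)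
    ultimately show "L \<le> (case p of (m, \<alpha>) \<Rightarrow> mf_cost T G t m \<alpha>)"
      using L[of "m T"] by (simp add: mf_cost_def)
  qed
  from cINF_lower[OF this adm] show ?thesis by (simp add: mf_value_def)
qed

lemma mf_value_le_particle_cost:
  fixes G :: "(real ^ 'd) measure \<Rightarrow> real"
  assumes bdd: "bdd_below (G ` P2)" and N: "N \<ge> 1" and tT: "t < T"
    and \<alpha>: "\<And>i. i < N \<Longrightarrow> \<alpha> i \<in> L2_controls t T"
  shows "mf_value T G t (empirical N x) \<le> particle_cost T G N t x \<alpha>"
proof -
  \<comment> \<open>Mean velocities, so that lines and trajectories share their end points and hence
    the terminal cost.\<close>
  define V where "V i = (1 / (T - t)) *\<^sub>R (LINT s:{t..T}|lborel. \<alpha> i s)" for i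
  have "mf_value T G t (empirical N x) \<le> mf_cost T G t (line_law N t x V) (line_field N t x V)"
    using tT by (intro mf_value_le bdd line_admissible N) auto
  also have "\<dots> = (1 / N) * (\<Sum>i<N. (T - t) * ((1/2) * (norm (V i))\<^sup>2)) + G (empirical N (\<lambda>i. x i + (T - t) *\<^sub>R V i))"
    using tT by (intro line_cost N) auto
  also have "(\<lambda>i. x i + (T - t) *\<^sub>R V i) = (\<lambda>i. trajectory t (x i) (\<alpha> i) T)"
    using tT by (simp add: V_def trajectory_def)
  also have "(1 / N) * (\<Sum>i<N. (T - t) * ((1/2) * (norm (V i))\<^sup>2)) \<le> (1 / N) * (\<Sum>i<N. LINT s:{t..T}|lborel. (1/2) * (norm (\<alpha> i s))\<^sup>2)"
    unfolding V_def using tT \<alpha> by (intro mult_left_mono sum_mono control_cost_ge) auto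
  finally show ?thesis
    by (simp add: particle_cost_def)
qed

lemma integral_singleton_lborel:
  fixes f :: "real \<Rightarrow> 'a::{banach, second_countable_topology}"
  shows "(LINT s:{t}|lborel. f s) = 0"
proof -
  have "(LINT s:{t}|lborel. f s) = (LINT s:{t}|lborel. f t)"
    unfolding set_lebesgue_integral_def by (rule Bochner_Integration.integral_cong) (auto simp: indicator_def)
  then show ?thesis by (simp add: set_lebesgue_integral_def)
qed

theorem proposition6p11:
  fixes T :: real and G :: "(real ^ 'd) measure \<Rightarrow> real"
  assumes "T > 0"
    and "bdd_below (G ` P2)"
    and "W2_continuous G"
    and "cond_exp_decreasing TYPE((real ^ 'd) \<times> (real ^ 'd)) G"
  shows "\<forall>N\<ge>1. \<forall>t\<in>{0..T}. \<forall>x :: nat \<Rightarrow> real ^ 'd.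
           particle_value T G N t x = mf_value T G t (empirical N x)"
proof (intro allI impI ballI)
  fix N :: nat and t and x :: "nat \<Rightarrow> real ^ 'd"
  assume N: "1 \<le> N" and t: "t \<in> {0..T}"
  have "(\<lambda>_ _. 0) \<in> {\<alpha> :: nat \<Rightarrow> real \<Rightarrow> real ^ 'd. \<forall>i<N. \<alpha> i \<in> L2_controls t T}"
    by (simp add: L2_controls_def set_borel_measurable_def set_integrable_def)
  then have ctrl: "{\<alpha> :: nat \<Rightarrow> real \<Rightarrow> real ^ 'd. \<forall>i<N. \<alpha> i \<in> L2_controls t T} \<noteq> {}"
    by (metis empty_iff)
  \<comment> \<open>Particles at rest; a greatest lower bound in the reals requires a nonempty set
    of competitors.\<close>
  have adm: "(line_law N t x (\<lambda>_. 0), line_field N t x (\<lambda>_. 0)) \<in> mf_admissible T t (empirical N x)"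
    using t by (intro line_admissible N) auto
  then have adm_ne: "mf_admissible T t (empirical N x) \<noteq> {}"
    by (metis empty_iff)
  show "particle_value T G N t x = mf_value T G t (empirical N x)"
  proof (cases "t = T")
    \<comment> \<open>With horizon 0 the kinetic terms are integrals over a single time and the
      terminal measure is the initial one. The case stands apart because constant velocities divide
      by \<open>T - t\<close>.\<close>
    case True
    have "particle_value T G N t x = (INF \<alpha>\<in>{\<alpha> :: nat \<Rightarrow> real \<Rightarrow> real ^ 'd. \<forall>i<N. \<alpha> i \<in> L2_controls t T}. G (empirical N x))"
      unfolding particle_value_def by (simp add: True particle_cost_def trajectory_def integral_singleton_lborel)
    also have "\<dots> = G (empirical N x)"
      by (rule cINF_const[OF ctrl])
    also have "\<dots> = (INF p\<in>mf_admissible T t (empirical N x). G (empirical N x))"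
      by (rule cINF_const[symmetric, OF adm_ne])
    also have "\<dots> = mf_value T G t (empirical N x)"
      unfolding mf_value_def
      by (intro INF_cong refl) (auto simp: True mf_cost_def integral_singleton_lborel mf_admissible_def)
    finally show ?thesis .
  next
    case False
    then have tT: "t < T" using t by simp
    show ?thesis
    proof (rule antisym)
      show "particle_value T G N t x \<le> mf_value T G t (empirical N x)"
        unfolding mf_value_def
      proof (rule cINF_greatest)
        show "mf_admissible T t (empirical N x) \<noteq> {}" by (rule adm_ne)
        fix p assume "p \<in> mf_admissible T t (empirical N x)"
        then show "particle_value T G N t x \<le> (case p of (m, \<alpha>) \<Rightarrow> mf_cost T G t m \<alpha>)"
          by (cases p) (simp add: particle_value_le_mf_cost[OF assms(2,4) N tT])
      qed
      show "mf_value T G t (empirical N x) \<le> particle_value T G N t x"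
        unfolding particle_value_def
      proof (rule cINF_greatest)
        show "{\<alpha> :: nat \<Rightarrow> real \<Rightarrow> real ^ 'd. \<forall>i<N. \<alpha> i \<in> L2_controls t T} \<noteq> {}" by (rule ctrl)
        fix \<alpha> assume "\<alpha> \<in> {\<alpha> :: nat \<Rightarrow> real \<Rightarrow> real ^ 'd. \<forall>i<N. \<alpha> i \<in> L2_controls t T}"
        then show "mf_value T G t (empirical N x) \<le> particle_cost T G N t x \<alpha>"
          by (intro mf_value_le_particle_cost[OF assms(2) N tT]) simp
      qed
    qed
  qed
qed

end
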